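(* Let $L$ be a well-defined IPS generator with semigroup $(P^L_t)_{t\ge 0}$ which satisfies conditions (i), (ii), (iii), (iv) and (v) of the context. Let $\gamma$ be a translation-invariant, non-null and quasilocal specification, and let $\mu\in\mathcal{G}(\gamma)$ be translation invariant, asymptotically decoupled and time-stationary for $L$ (i.e. $\mu P^L_t=\mu$ for all $t\ge0$). Let $D_L(\mu)\subset\mathcal{P}_\theta$ be a weakly closed set with $\mu\in D_L(\mu)$ which is preserved by the dynamics (i.e. $\nu\in D_L(\mu)$ implies $\nu P_t^L\in D_L(\mu)$ for all $t\ge 0$). Assume that for every $\nu\in D_L(\mu)$ the equality $g_L(\nu|\mu)=0$ implies $\nu\in\mathcal{G}(\gamma)$. Then, for any starting measure $\nu\in D_L(\mu)$ and any sequence of times $t_n\uparrow\infty$ such that the measures $\nu P^L_{t_n}$, $n\in\mathbb{N}$, are all non-null and $(\nu P^L_{t_n})_{n\in\mathbb{N}}$ converges weakly to a non-null probability measure $\nu_*$, we have $\nu_*\in\mathcal{G}(\gamma)$.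
   Context: **Configurations and measures.** Fix integers $d,q\ge1$; $\Omega=\{1,\dots,q\}^{\mathbb{Z}^d}$ carries the product topology and Borel $\sigma$-algebra $\mathcal{F}$. $\mathcal{P}_\theta$ is the set of translation-invariant probability measures on $\Omega$, with the weak topology. $\Lambda\Subset\mathbb{Z}^d$ means that $\Lambda$ is a finite nonempty subset; $\Lambda^c=\mathbb{Z}^d\setminus\Lambda$; $o$ is the origin; $\eta_\Lambda$ is the restriction of $\eta$ to $\Lambda$, and $\eta_\Lambda\xi_\Delta$ is concatenation for disjoint $\Lambda,\Delta$. $1_{\eta_\Lambda}$ is the indicator function of $\{\omega:\omega_\Lambda=\eta_\Lambda\}$, and $\nu(f)=\int f\,d\nu$. **Non-null measure.** A probability measure $\nu$ on $\Omega$ is non-null if there are $\delta>0$ and a version of the single-site conditional probabilities such that for every $a\in\{1,\dots,q\}$, $\nu(\omega_o=a\,|\,\omega_{o^c})\ge\delta$ for $\nu$-a.a. $\omega$. **Specifications.** A specification is a family $\gamma=(\gamma_\Lambda)_{\Lambda\Subset\mathbb{Z}^d}$ of probability kernels $\gamma_\Lambda(\cdot|\eta_{\Lambda^c})$ from $(\Omega,\mathcal{F}_{\Lambda^c})$ to $(\Omega,\mathcal{F})$ ($\mathcal{F}_{\Lambda^c}$ the $\sigma$-algebra generated by the coordinates in $\Lambda^c$) that are proper ($\gamma_\Lambda(1_{\eta_\Lambda}1_{\eta_\Delta}|\eta_{\Lambda^c})=\gamma_\Lambda(1_{\eta_\Lambda}|\eta_{\Lambda^c})1_{\eta_\Delta}(\eta_{\Lambda^c})$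 for $\Delta\subset\Lambda^c$) and consistent ($\gamma_\Lambda\gamma_\Delta=\gamma_\Lambda$ for $\Delta\subset\Lambda$). It is translation invariant if $\gamma_{\Lambda+i}(1_{\eta_{\Lambda+i}}|\eta_{(\Lambda+i)^c})=\gamma_\Lambda(1_{\eta_\Lambda}|\eta_{\Lambda^c})$ for all $\Lambda\Subset\mathbb{Z}^d$, $i\in\mathbb{Z}^d$ (configurations being translated along); non-null if $\inf_\eta\gamma_o(1_{\eta_o}|\eta_{o^c})\ge\delta$ for some $\delta>0$; quasilocal if for all $\Lambda\Subset\mathbb{Z}^d$, $\lim_{\Delta\uparrow\mathbb{Z}^d}\sup_{\eta,\xi}|\gamma_\Lambda(1_{\eta_\Lambda}|\eta_{\Delta\setminus\Lambda}\xi_{\Delta^c})-\gamma_\Lambda(1_{\eta_\Lambda}|\eta_{\Lambda^c})|=0$. $\mathcal{G}(\gamma)$ is the set of probability measures $\mu$ with $\mu(\gamma_\Lambda(1_{\eta_\Lambda}|\cdot))=\mu(1_{\eta_\Lambda})$ for all $\Lambda\Subset\mathbb{Z}^d$ and $\eta_\Lambda$ (DLR equation: Gibbs measures for $\gamma$). **Asymptotic decoupling.** With $V_n=[-n,n]^d\cap\mathbb{Z}^d$, $\mu$ is asymptotically decoupled if there are $d(\cdot):\mathbb{N}\to\mathbb{N}$ and $c(\cdot):\mathbb{N}\to[0,\infty)$ with $d(n)/n\to0$, $c(n)/|V_n|\to0$ and $e^{-c(n)}\mu(A)\mu(B)\le\mu(A\cap B)\le e^{c(n)}\mu(A)\mu(B)$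 for all $i\in\mathbb{Z}^d$, $n\in\mathbb{N}$, all events $A$ measurable w.r.t. the coordinates in $V_n+i$ and all $B$ measurable w.r.t. the coordinates in $(V_{n+d(n)}+i)^c$. **IPS.** An interacting particle system (IPS) is given by rates $c_\Delta(\eta,\xi_\Delta)\ge0$, $\Delta\Subset\mathbb{Z}^d$, $\xi_\Delta\in\{1,\dots,q\}^\Delta$, continuous in $\eta\in\Omega$, with generator $Lf(\eta)=\sum_{\Delta\Subset\mathbb{Z}^d}\sum_{\xi_\Delta}c_\Delta(\eta,\xi_\Delta)[f(\xi_\Delta\eta_{\Delta^c})-f(\eta)]$ (sums only over terms with positive rate). Put $c_\Delta(\eta)=\sum_{\xi_\Delta\ne\eta_\Delta}c_\Delta(\eta,\xi_\Delta)$ and $c_\Delta=\sup_\eta c_\Delta(\eta)$. It is well-defined if it satisfies Liggett's conditions $\sup_x\sum_{\Delta\ni x}c_\Delta<\infty$ and $\sup_x\sum_{u\neq x}\sum_{\Delta\ni x}\sup\{\sum_{\xi_\Delta}|c_\Delta(\eta,\xi_\Delta)-c_\Delta(\zeta,\xi_\Delta)|:\eta_y=\zeta_y\ \forall y\ne u\}<\infty$; then (the closure of) $L$ generates a unique Feller Markov semigroup $(P^L_t)_{t\ge0}$ on $C(\Omega)$, and $\nu P_t^L$ denotes the time-evolved measure. **Conditions on $L$.** (i) $L$ is translation invariant: all rates are translation invariant. (ii) Finitely many types of transitions: up to lattice translations, $c_\Delta>0$ for only finitely many $\Delta\Subset\mathbb{Z}^d$. (iii) Uniformly continuous rates: $\lim_{\Lambda\uparrow\mathbb{Z}^d}\sup_{\Delta\ni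 o}\sup_{\eta,\xi,\sigma}|c_\Delta(\eta_\Lambda\sigma_{\Lambda^c},\xi_\Delta)-c_\Delta(\eta,\xi_\Delta)|=0$. (iv) Strictly positive minimal transition rate: for all $\Delta$ with $c_\Delta>0$, $\inf_{\eta,\xi:\,c_\Delta(\eta,\xi_\Delta)>0}c_\Delta(\eta,\xi_\Delta)>0$. (v) $L$ cannot enter trap states: for all $\eta$, $\Delta$ and $\xi_\Delta$, $c_\Delta(\eta,\xi_\Delta)>0$ implies $c_\Delta(\xi_\Delta\eta_{\Delta^c})>0$. **Relative entropy loss density.** For $\Lambda\Subset\mathbb{Z}^d$, $h_\Lambda(\nu|\mu)=\sum_{\omega_\Lambda}\nu(1_{\omega_\Lambda})\log\frac{\nu(1_{\omega_\Lambda})}{\mu(1_{\omega_\Lambda})}$ if $\nu\ll\mu$ on $\Lambda$, and $\infty$ otherwise. With $\Lambda_n=[-2^n+1,2^n-1]^d\cap\mathbb{Z}^d$, define for $\nu,\mu\in\mathcal{P}_\theta$ with $\mu P_t^L=\mu$: $g^n_L(\nu|\mu)=\frac{d}{dt}\big|_{t=0}h_{\Lambda_n}(\nu P^L_t|\mu)$ (right derivative) and $g_L(\nu|\mu)=\limsup_{n\uparrow\infty}|\Lambda_n|^{-1}g_L^n(\nu|\mu)$. *)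

theory Defs
  imports "HOL-Probability.Probability"
begin

text \<open>
  Sites are the points of \<open>int ^ 'd\<close> and spins the elements of a finite type \<open>'q\<close> with the discrete
  topology, so \<open>CARD('d)\<close> and \<open>CARD('q)\<close> are the integers \<open>d, q \<ge> 1\<close>.  The instance of
  \<^class>\<open>topological_space\<close> for functions is the product topology.  A local configuration on
  \<open>\<Delta>\<close> is an element of \<open>\<Delta> \<rightarrow>\<^sub>E UNIV\<close>, and the concatenation of \<open>\<xi>\<close> on \<open>\<Delta>\<close> with \<open>\<eta>\<close> off \<open>\<Delta>\<close>
  is \<open>override_on \<eta> \<xi> \<Delta>\<close>.
\<close>

type_synonym 'd site = "int ^ 'd"
type_synonym ('d, 'q) config = "'d site \<Rightarrow> 'q"

definition fin_sets :: "'a set set" where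
  "fin_sets = {\<Lambda>. finite \<Lambda> \<and> \<Lambda> \<noteq> {}}"

definition cube :: "nat \<Rightarrow> ('d::finite) site set" where
  "cube n = {x. \<forall>k. \<bar>x $ k\<bar> \<le> int n}"

abbreviation translate :: "('d::finite) site \<Rightarrow> 'd site set \<Rightarrow> 'd site set" where
  "translate i \<Lambda> \<equiv> (\<lambda>x. x + i) ` \<Lambda>"

text \<open>The shift also sends local configurations on \<open>\<Delta>\<close> to local configurations on \<open>\<Delta> + i\<close>.\<close>

definition shift :: "('d::finite) site \<Rightarrow> ('d, 'q) config \<Rightarrow> ('d, 'q) config" where
  "shift i \<eta> = (\<lambda>x. \<eta> (x - i))"

definition cyl :: "('d::finite) site set \<Rightarrow> ('d, 'q) config \<Rightarrow> ('d, 'q) config set" where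
  "cyl \<Lambda> \<eta> = {\<omega>. \<forall>x\<in>\<Lambda>. \<omega> x = \<eta> x}"

definition coord_algebra :: "('d::finite) site set \<Rightarrow> ('d, 'q) config measure" where
  "coord_algebra \<Lambda> = sigma UNIV {{\<omega>. \<omega> x = a} |x a. x \<in> \<Lambda>}"


section \<open>Measures on configurations\<close>

definition prob_measures :: "('d::finite, 'q::{finite,discrete_topology}) config measure set" where
  "prob_measures = {\<nu>. prob_space \<nu> \<and> sets \<nu> = sets borel}"

definition ti_measures :: "('d::finite, 'q::{finite,discrete_topology}) config measure set" where
  "ti_measures = {\<nu> \<in> prob_measures. \<forall>i. distr \<nu> borel (shift i) = \<nu>}"

text \<open>The coarsest topology making all \<open>\<nu> \<mapsto> \<nu>(f)\<close>, \<open>f \<in> C(\<Omega>)\<close>, continuous; as \<open>\<Omega>\<close> is compact,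
  \<open>C(\<Omega>)\<close> is the type of bounded continuous functions.\<close>

definition weak_topology ::
    "('d::finite, 'q::{finite,discrete_topology}) config measure topology" where
  "weak_topology = pullback_topology prob_measures
     (\<lambda>\<nu> (f :: ('d, 'q) config \<Rightarrow>\<^sub>C real). \<integral>\<omega>. apply_bcontfun f \<omega> \<partial>\<nu>) euclidean"

definition nonnull_measure ::
    "('d::finite, 'q::{finite,discrete_topology}) config measure \<Rightarrow> bool" where
  "nonnull_measure \<nu> \<longleftrightarrow> (\<exists>\<delta>>0. \<forall>a. AE \<omega> in \<nu>.
     \<delta> \<le> real_cond_exp \<nu> (coord_algebra (- {0})) (indicator {\<omega>. \<omega> 0 = a}) \<omega>)"

definition asymptotically_decoupled ::
    "('d::finite, 'q::{finite,discrete_topology}) config measure \<Rightarrow> bool" where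
  "asymptotically_decoupled \<mu> \<longleftrightarrow> (\<exists>(d :: nat \<Rightarrow> nat) (c :: nat \<Rightarrow> real).
     (\<forall>n. 0 \<le> c n) \<and>
     (\<lambda>n. real (d n) / real n) \<longlonglongrightarrow> 0 \<and>
     (\<lambda>n. c n / real (card (cube n :: 'd site set))) \<longlonglongrightarrow> 0 \<and>
     (\<forall>i n. \<forall>A \<in> sets (coord_algebra (translate i (cube n))).
       \<forall>B \<in> sets (coord_algebra (- translate i (cube (n + d n)))).
         exp (- c n) * measure \<mu> A * measure \<mu> B \<le> measure \<mu> (A \<inter> B) \<and>
         measure \<mu> (A \<inter> B) \<le> exp (c n) * measure \<mu> A * measure \<mu> B))"


section \<open>Specifications and Gibbs measures\<close>

type_synonym ('d, 'q) kernels =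
  "'d site set \<Rightarrow> ('d, 'q) config \<Rightarrow> ('d, 'q) config measure"

text \<open>Kernels take a full configuration as boundary condition; measurability with respect to
  \<open>coord_algebra (- \<Lambda>)\<close> makes them depend on its restriction to \<open>- \<Lambda>\<close> only.\<close>

definition is_specification ::
    "('d::finite, 'q::{finite,discrete_topology}) kernels \<Rightarrow> bool" where
  "is_specification \<gamma> \<longleftrightarrow>
     (\<forall>\<Lambda>\<in>fin_sets. \<gamma> \<Lambda> \<in> coord_algebra (- \<Lambda>) \<rightarrow>\<^sub>M prob_algebra borel) \<and>
     (\<forall>\<Lambda>\<in>fin_sets. \<forall>\<Delta>. \<Delta> \<subseteq> - \<Lambda> \<longrightarrow> (\<forall>\<eta> \<zeta>.
        measure (\<gamma> \<Lambda> \<zeta>) (cyl \<Lambda> \<eta> \<inter> cyl \<Delta> \<eta>)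
        = measure (\<gamma> \<Lambda> \<zeta>) (cyl \<Lambda> \<eta>) * indicator (cyl \<Delta> \<eta>) \<zeta>)) \<and>
     (\<forall>\<Lambda>\<in>fin_sets. \<forall>\<Delta>\<in>fin_sets. \<Delta> \<subseteq> \<Lambda> \<longrightarrow> (\<forall>\<eta>. \<gamma> \<Lambda> \<eta> \<bind> \<gamma> \<Delta> = \<gamma> \<Lambda> \<eta>))"

definition ti_specification ::
    "('d::finite, 'q::{finite,discrete_topology}) kernels \<Rightarrow> bool" where
  "ti_specification \<gamma> \<longleftrightarrow> (\<forall>\<Lambda>\<in>fin_sets. \<forall>i \<eta>.
     measure (\<gamma> (translate i \<Lambda>) (shift i \<eta>)) (cyl (translate i \<Lambda>) (shift i \<eta>))
     = measure (\<gamma> \<Lambda> \<eta>) (cyl \<Lambda> \<eta>))"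

definition nonnull_specification ::
    "('d::finite, 'q::{finite,discrete_topology}) kernels \<Rightarrow> bool" where
  "nonnull_specification \<gamma> \<longleftrightarrow>
     (\<exists>\<delta>>0. \<delta> \<le> (INF \<eta>. measure (\<gamma> {0} \<eta>) (cyl {0} \<eta>)))"

definition quasilocal ::
    "('d::finite, 'q::{finite,discrete_topology}) kernels \<Rightarrow> bool" where
  "quasilocal \<gamma> \<longleftrightarrow> (\<forall>\<Lambda>\<in>fin_sets.
     ((\<lambda>\<Delta>. SUP (\<eta>, \<xi>)\<in>UNIV.
         \<bar>measure (\<gamma> \<Lambda> (override_on \<xi> \<eta> (\<Delta> - \<Lambda>))) (cyl \<Lambda> \<eta>) - measure (\<gamma> \<Lambda> \<eta>) (cyl \<Lambda> \<eta>)\<bar>)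
       \<longlongrightarrow> 0) (finite_subsets_at_top UNIV))"

definition gibbs_measures :: "('d::finite, 'q::{finite,discrete_topology}) kernels
    \<Rightarrow> ('d, 'q) config measure set" where
  "gibbs_measures \<gamma> = {\<mu> \<in> prob_measures. \<forall>\<Lambda>\<in>fin_sets. \<forall>\<eta>.
     (\<integral>\<omega>. measure (\<gamma> \<Lambda> \<omega>) (cyl \<Lambda> \<eta>) \<partial>\<mu>) = measure \<mu> (cyl \<Lambda> \<eta>)}"


section \<open>Interacting particle systems\<close>

text \<open>\<open>c \<Delta> \<eta> \<xi>\<close> is the rate \<open>c\<^sub>\<Delta>(\<eta>, \<xi>\<^sub>\<Delta>)\<close>, relevant only for \<open>\<Delta> \<in> fin_sets\<close> and \<open>\<xi> \<in> \<Delta> \<rightarrow>\<^sub>E UNIV\<close>.\<close>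

type_synonym ('d, 'q) rates =
  "'d site set \<Rightarrow> ('d, 'q) config \<Rightarrow> ('d, 'q) config \<Rightarrow> real"

definition is_rates :: "('d::finite, 'q::{finite,discrete_topology}) rates \<Rightarrow> bool" where
  "is_rates c \<longleftrightarrow> (\<forall>\<Delta>\<in>fin_sets. \<forall>\<xi> \<in> \<Delta> \<rightarrow>\<^sub>E UNIV.
     (\<forall>\<eta>. 0 \<le> c \<Delta> \<eta> \<xi>) \<and> continuous_on UNIV (\<lambda>\<eta>. c \<Delta> \<eta> \<xi>))"

definition total_rate :: "('d::finite, 'q::{finite,discrete_topology}) rates
    \<Rightarrow> 'd site set \<Rightarrow> ('d, 'q) config \<Rightarrow> real" where
  "total_rate c \<Delta> \<eta> = (\<Sum>\<xi> \<in> (\<Delta> \<rightarrow>\<^sub>E UNIV) - {restrict \<eta> \<Delta>}. c \<Delta> \<eta> \<xi>)"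

definition max_rate ::
    "('d::finite, 'q::{finite,discrete_topology}) rates \<Rightarrow> 'd site set \<Rightarrow> real" where
  "max_rate c \<Delta> = (SUP \<eta>. total_rate c \<Delta> \<eta>)"

definition well_defined_ips :: "('d::finite, 'q::{finite,discrete_topology}) rates \<Rightarrow> bool" where
  "well_defined_ips c \<longleftrightarrow> is_rates c \<and>
     (SUP x. \<Sum>\<^sub>\<infinity>\<Delta>\<in>{\<Delta>\<in>fin_sets. x \<in> \<Delta>}. ennreal (max_rate c \<Delta>)) < \<infinity> \<and>
     (SUP x. \<Sum>\<^sub>\<infinity>u\<in>- {x}. \<Sum>\<^sub>\<infinity>\<Delta>\<in>{\<Delta>\<in>fin_sets. x \<in> \<Delta>}.
        SUP (\<eta>, \<zeta>)\<in>{(\<eta>, \<zeta>). \<forall>y. y \<noteq> u \<longrightarrow> \<eta> y = \<zeta> y}.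
          ennreal (\<Sum>\<xi> \<in> \<Delta> \<rightarrow>\<^sub>E UNIV. \<bar>c \<Delta> \<eta> \<xi> - c \<Delta> \<zeta> \<xi>\<bar>)) < \<infinity>"

definition ips_generator :: "('d::finite, 'q::{finite,discrete_topology}) rates
    \<Rightarrow> (('d, 'q) config \<Rightarrow> real) \<Rightarrow> ('d, 'q) config \<Rightarrow> real" where
  "ips_generator c f \<eta> =
     (\<Sum>\<^sub>\<infinity>\<Delta>\<in>fin_sets. \<Sum>\<xi> \<in> \<Delta> \<rightarrow>\<^sub>E UNIV. c \<Delta> \<eta> \<xi> * (f (override_on \<eta> \<xi> \<Delta>) - f \<eta>))"

definition local_function :: "(('d::finite, 'q) config \<Rightarrow> real) \<Rightarrow> bool" where
  "local_function f \<longleftrightarrow>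
     (\<exists>\<Lambda>. finite \<Lambda> \<and> (\<forall>\<eta> \<zeta>. (\<forall>x\<in>\<Lambda>. \<eta> x = \<zeta> x) \<longrightarrow> f \<eta> = f \<zeta>))"

text \<open>The graph of the generator on local functions. Its closure in \<open>C(\<Omega>) \<times> C(\<Omega>)\<close> is also the
  closure of the generator on Liggett's larger domain of functions with summable oscillations.\<close>

definition pregenerator_graph :: "('d::finite, 'q::{finite,discrete_topology}) rates
    \<Rightarrow> ((('d, 'q) config \<Rightarrow>\<^sub>C real) \<times> (('d, 'q) config \<Rightarrow>\<^sub>C real)) set" where
  "pregenerator_graph c = {(f, g). local_function (apply_bcontfun f) \<and>
     apply_bcontfun g = ips_generator c (apply_bcontfun f)}"

type_synonym ('d, 'q) semigroup =
  "real \<Rightarrow> (('d, 'q) config \<Rightarrow>\<^sub>C real) \<Rightarrow> (('d, 'q) config \<Rightarrow>\<^sub>C real)"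

definition feller_semigroup ::
    "('d::finite, 'q::{finite,discrete_topology}) semigroup \<Rightarrow> bool" where
  "feller_semigroup P \<longleftrightarrow>
     (\<forall>f. P 0 f = f) \<and>
     (\<forall>s\<ge>0. \<forall>t\<ge>0. \<forall>f. P (s + t) f = P s (P t f)) \<and>
     (\<forall>t\<ge>0. linear (P t)) \<and>
     (\<forall>t\<ge>0. P t (const_bcontfun 1) = const_bcontfun 1) \<and>
     (\<forall>t\<ge>0. \<forall>f. (\<forall>\<eta>. 0 \<le> apply_bcontfun f \<eta>) \<longrightarrow> (\<forall>\<eta>. 0 \<le> apply_bcontfun (P t f) \<eta>)) \<and>
     (\<forall>f. ((\<lambda>t. P t f) \<longlongrightarrow> f) (at_right 0))"

definition infinitesimal_generator :: "('d::finite, 'q::{finite,discrete_topology}) semigroup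
    \<Rightarrow> ((('d, 'q) config \<Rightarrow>\<^sub>C real) \<times> (('d, 'q) config \<Rightarrow>\<^sub>C real)) set" where
  "infinitesimal_generator P = {(f, g). ((\<lambda>t. (P t f - f) /\<^sub>R t) \<longlongrightarrow> g) (at_right 0)}"

definition ips_semigroup :: "('d::finite, 'q::{finite,discrete_topology}) rates
    \<Rightarrow> ('d, 'q) semigroup \<Rightarrow> bool" where
  "ips_semigroup c P \<longleftrightarrow>
     feller_semigroup P \<and> infinitesimal_generator P = closure (pregenerator_graph c)"

definition evolve :: "('d::finite, 'q::{finite,discrete_topology}) semigroup
    \<Rightarrow> real \<Rightarrow> ('d, 'q) config measure \<Rightarrow> ('d, 'q) config measure" where
  "evolve P t \<nu> = (THE \<nu>'. \<nu>' \<in> prob_measures \<and>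
     (\<forall>f. (\<integral>\<omega>. apply_bcontfun f \<omega> \<partial>\<nu>') = (\<integral>\<omega>. apply_bcontfun (P t f) \<omega> \<partial>\<nu>)))"


section \<open>Conditions on the rates\<close>

definition ti_rates :: "('d::finite, 'q::{finite,discrete_topology}) rates \<Rightarrow> bool" where
  "ti_rates c \<longleftrightarrow> (\<forall>\<Delta>\<in>fin_sets. \<forall>i \<eta>. \<forall>\<xi> \<in> \<Delta> \<rightarrow>\<^sub>E UNIV.
     c (translate i \<Delta>) (shift i \<eta>) (shift i \<xi>) = c \<Delta> \<eta> \<xi>)"

definition finitely_many_types :: "('d::finite, 'q::{finite,discrete_topology}) rates \<Rightarrow> bool" where
  "finitely_many_types c \<longleftrightarrow> (\<exists>\<D>. finite \<D> \<and>
     (\<forall>\<Delta>\<in>fin_sets. max_rate c \<Delta> > 0 \<longrightarrow> (\<exists>\<Delta>\<^sub>0\<in>\<D>. \<exists>i. \<Delta> = translate i \<Delta>\<^sub>0)))"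

definition uniformly_continuous_rates ::
    "('d::finite, 'q::{finite,discrete_topology}) rates \<Rightarrow> bool" where
  "uniformly_continuous_rates c \<longleftrightarrow>
     ((\<lambda>\<Lambda>. SUP \<Delta>\<in>{\<Delta>\<in>fin_sets. 0 \<in> \<Delta>}. SUP (\<eta>, \<xi>, \<sigma>)\<in>UNIV \<times> (\<Delta> \<rightarrow>\<^sub>E UNIV) \<times> UNIV.
         ennreal \<bar>c \<Delta> (override_on \<sigma> \<eta> \<Lambda>) \<xi> - c \<Delta> \<eta> \<xi>\<bar>)
       \<longlongrightarrow> 0) (finite_subsets_at_top UNIV)"

definition positive_min_rate :: "('d::finite, 'q::{finite,discrete_topology}) rates \<Rightarrow> bool" where
  "positive_min_rate c \<longleftrightarrow> (\<forall>\<Delta>\<in>fin_sets. max_rate c \<Delta> > 0 \<longrightarrow>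
     (INF (\<eta>, \<xi>)\<in>{(\<eta>, \<xi>). \<xi> \<in> \<Delta> \<rightarrow>\<^sub>E UNIV \<and> c \<Delta> \<eta> \<xi> > 0}. c \<Delta> \<eta> \<xi>) > 0)"

definition no_trap_entry :: "('d::finite, 'q::{finite,discrete_topology}) rates \<Rightarrow> bool" where
  "no_trap_entry c \<longleftrightarrow> (\<forall>\<Delta>\<in>fin_sets. \<forall>\<eta>. \<forall>\<xi> \<in> \<Delta> \<rightarrow>\<^sub>E UNIV.
     c \<Delta> \<eta> \<xi> > 0 \<longrightarrow> total_rate c \<Delta> (override_on \<eta> \<xi> \<Delta>) > 0)"


section \<open>Relative entropy loss\<close>

definition rel_entropy :: "('d::finite) site set
    \<Rightarrow> ('d, 'q::{finite,discrete_topology}) config measure \<Rightarrow> ('d, 'q) config measure \<Rightarrow> ereal" where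
  "rel_entropy \<Lambda> \<nu> \<mu> =
     (if \<forall>A \<in> sets (coord_algebra \<Lambda>). measure \<mu> A = 0 \<longrightarrow> measure \<nu> A = 0
      then ereal (\<Sum>\<omega> \<in> \<Lambda> \<rightarrow>\<^sub>E UNIV.
             measure \<nu> (cyl \<Lambda> \<omega>) * ln (measure \<nu> (cyl \<Lambda> \<omega>) / measure \<mu> (cyl \<Lambda> \<omega>)))
      else \<infinity>)"

text \<open>The right derivative is taken in \<^typ>\<open>ereal\<close>: it equals \<open>-\<infinity>\<close> as soon as some cylinder of
  \<open>\<nu>\<close>-measure zero gains mass at a positive rate at time zero.\<close>

definition entropy_loss :: "('d::finite, 'q::{finite,discrete_topology}) semigroup \<Rightarrow> nat
    \<Rightarrow> ('d, 'q) config measure \<Rightarrow> ('d, 'q) config measure \<Rightarrow> ereal" where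
  "entropy_loss P n \<nu> \<mu> = (let h = (\<lambda>t. rel_entropy (cube (2 ^ n - 1)) (evolve P t \<nu>) \<mu>)
     in Lim (at_right 0) (\<lambda>t. (h t - h 0) / ereal t))"

definition entropy_loss_density :: "('d::finite, 'q::{finite,discrete_topology}) semigroup
    \<Rightarrow> ('d, 'q) config measure \<Rightarrow> ('d, 'q) config measure \<Rightarrow> ereal" where
  "entropy_loss_density P \<nu> \<mu> = limsup (\<lambda>n.
     entropy_loss P n \<nu> \<mu> / ereal (real (card (cube (2 ^ n - 1) :: 'd site set))))"

end

theory Submission
  imports Defs
begin

text \<open>
  Write \<open>f = p / m\<close> for the density of \<open>\<rho>\<close> with respect to \<open>\<mu>\<close> on the cylinders over a cube and
  \<open>\<Phi>(a, b) = a ln (a / b) - a + b \<ge> 0\<close>.  Adding the vanishing integral \<open>\<mu>(L f)\<close> turns the entropy loss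
  of \<open>\<rho>\<close> into a sum over the possible transitions, where each transition inside the cube contributes
  a rate times \<open>m \<Phi>(f(\<omega>), f(\<omega>\<^sup>\<xi>))\<close>, up to errors that are small because the rates are uniformly
  continuous and bounded below where positive; transitions across the boundary have a bounded effect
  in the unfavourable direction.  By quasilocality of \<open>\<gamma>\<close> and the log-sum inequality, these
  contributions are almost increasing in the volume.

  If they all vanish in the limit for the limit measure \<open>\<nu>\<^sub>*\<close>, then \<open>g\<^sub>L(\<nu>\<^sub>*|\<mu>) = 0\<close>, which gives the
  claim.  Otherwise one contribution in a fixed finite volume is bounded away from zero at \<open>\<nu>\<^sub>*\<close>, hence
  also near \<open>\<nu>\<^sub>*\<close>, so during a fixed amount of time after each late \<open>t\<^sub>n\<close> the entropy per site in large
  cubes drops by a fixed amount.  As it never increases by more than \<open>o(1)\<close> and takes values in a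
  bounded interval, this is impossible.  To have positive cylinder probabilities at all times, this
  last argument is applied to a mixture of the evolving measure with the stationary measure \<open>\<mu>\<close>.
\<close>

section \<open>Topology of the configuration space\<close>

text \<open>The derivative of the relative entropy alone gives each transition a term
  \<open>x * (ln a - ln b)\<close> of no definite sign, because nothing like detailed balance is
  assumed. Stationarity of \<mu> supplies the terms \<open>y * (b - a)\<close>, whose total
  vanishes; the two combine to \<Phi> where the rate is almost constant on a cylinder. The
  difficulty is that logarithms of density ratios are unbounded. In the bulk they are absorbed by
  \<Phi> itself. At the boundary, ln u \<le> u - 1 gives a bound in one direction for every measure
  with positive cylinder probabilities, whereas the other direction uses non-nullness. Hence the
  upper bound on the entropy rate serves along the whole trajectory, the two-sided bound only at the
  limit. Mixing with \<mu> is harmless: the mixture obeys the same differential equation, since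
  \<mu>(L f) = 0, and its entropy in a volume V is at most - V ln \<delta> with \<delta> depending
  on \<mu> alone. The weight of the mixture is fixed before the volumes grow, so that a single curve
  of measures carries all the drops.\<close>

lemma compact_UNIV_config: "compact (UNIV :: ('d::finite, 'q::{finite,discrete_topology}) config set)"
proof -
  have "compact_space (euclidean :: 'q topology)"
    by (simp add: compact_space_def finite_imp_compact)
  then have "compact_space (product_topology (\<lambda>_::'d site. (euclidean :: 'q topology)) UNIV)"
    by (simp add: compact_space_product_topology)
  then have "compactin (euclidean :: ('d, 'q) config topology) UNIV"
    unfolding euclidean_product_topology compact_space_def by simp
  then show ?thesis by (subst (asm) compactin_euclidean_iff)
qed

lemma continuous_coordinate:
  "continuous_on A (\<lambda>\<omega> :: ('d::finite, 'q::{finite,discrete_topology}) config. \<omega> x)"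
  by (rule continuous_on_subset[OF continuous_on_product_coordinates]) simp

lemma cyl_clopen:
  fixes \<eta> :: "('d::finite, 'q::{finite,discrete_topology}) config"
  assumes "finite \<Lambda>"
  shows "open (cyl \<Lambda> \<eta>)" "closed (cyl \<Lambda> \<eta>)"
proof -
  have eq: "cyl \<Lambda> \<eta> = (\<Inter>x\<in>\<Lambda>. (\<lambda>\<omega>. \<omega> x) -` {\<eta> x})"
    by (auto simp: cyl_def)
  have "open ((\<lambda>\<omega> :: ('d, 'q) config. \<omega> x) -` {\<eta> x})" for x
    by (rule open_vimage[OF discrete_topology_class.open_discrete continuous_coordinate[of UNIV]])
  moreover have "closed ((\<lambda>\<omega> :: ('d, 'q) config. \<omega> x) -` {\<eta> x})" for x
    by (rule closed_vimage[OF _ continuous_coordinate[of UNIV]]) (simp add: closed_def discrete_topology_class.open_discrete)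
  ultimately show "open (cyl \<Lambda> \<eta>)" "closed (cyl \<Lambda> \<eta>)"
    unfolding eq using assms by (auto intro!: open_INT closed_INT)
qed

lemma cyl_self [simp]: "\<eta> \<in> cyl \<Lambda> \<eta>"
  by (simp add: cyl_def)

lemma cyl_cong: "(\<And>x. x \<in> \<Lambda> \<Longrightarrow> \<eta> x = \<zeta> x) \<Longrightarrow> cyl \<Lambda> \<eta> = cyl \<Lambda> \<zeta>"
  by (simp add: cyl_def)

lemma cyl_antimono: "\<Lambda>' \<subseteq> \<Lambda> \<Longrightarrow> cyl \<Lambda> \<eta> \<subseteq> cyl \<Lambda>' \<eta>"
  by (auto simp: cyl_def)

lemma cyl_empty [simp]: "cyl {} \<eta> = UNIV"
  by (simp add: cyl_def)

lemma open_contains_cyl: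
  fixes U :: "('d::finite, 'q::{finite,discrete_topology}) config set"
  assumes "open U" "\<eta> \<in> U"
  shows "\<exists>\<Lambda>. finite \<Lambda> \<and> cyl \<Lambda> \<eta> \<subseteq> U"
proof -
  have "openin (product_topology (\<lambda>_::'d site. (euclidean :: 'q topology)) UNIV) U"
    using assms by (simp add: euclidean_product_topology)
  from product_topology_open_contains_basis[OF this assms(2)]
  obtain X where X: "\<eta> \<in> (\<Pi>\<^sub>E i\<in>UNIV. X i)" "finite {i. X i \<noteq> UNIV}"
    "(\<Pi>\<^sub>E i\<in>UNIV. X i) \<subseteq> U"
    by auto
  have "cyl {i. X i \<noteq> UNIV} \<eta> \<subseteq> (\<Pi>\<^sub>E i\<in>UNIV. X i)"
    using X(1) by (fastforce simp: cyl_def PiE_def Pi_def)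
  with X show ?thesis by blast
qed

section \<open>Cylinders generate the Borel sets and determine measures\<close>

lemma countable_cyls:
  "countable {cyl \<Lambda> \<eta> |\<Lambda> (\<eta> :: ('d::finite, 'q::{finite,discrete_topology}) config). finite \<Lambda>}"
proof -
  have "{cyl \<Lambda> \<eta> |\<Lambda> (\<eta> :: ('d, 'q) config). finite \<Lambda>}
      \<subseteq> (\<Union>\<Lambda>\<in>{\<Lambda>. finite \<Lambda>}. cyl \<Lambda> ` (\<Lambda> \<rightarrow>\<^sub>E UNIV))"
  proof clarify
    fix \<Lambda> :: "'d site set" and \<eta> :: "('d, 'q) config" assume "finite \<Lambda>"
    moreover have "cyl \<Lambda> \<eta> = cyl \<Lambda> (restrict \<eta> \<Lambda>)" by (rule cyl_cong) simp
    ultimately show "cyl \<Lambda> \<eta> \<in> (\<Union>\<Lambda>\<in>{\<Lambda>. finite \<Lambda>}. cyl \<Lambda> ` (\<Lambda> \<rightarrow>\<^sub>E UNIV))"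
      by (auto intro!: image_eqI[of _ _ "restrict \<eta> \<Lambda>"])
  qed
  moreover have "countable (\<Union>\<Lambda>\<in>{\<Lambda> :: 'd site set. finite \<Lambda>}. cyl \<Lambda> ` (\<Lambda> \<rightarrow>\<^sub>E (UNIV :: 'q set)))"
    by (intro countable_UN countable_Collect_finite countable_image countable_finite finite_PiE) auto
  ultimately show ?thesis by (rule countable_subset)
qed

lemma cyl_sets [measurable, simp]:
  "finite \<Lambda> \<Longrightarrow> cyl \<Lambda> (\<eta> :: ('d::finite, 'q::{finite,discrete_topology}) config) \<in> sets borel"
  by (simp add: cyl_clopen borel_open)

text \<open>Cylinders form a base of the product topology, and there are only countably many of
  them, so every open set is a countable union of cylinders.\<close>

lemma sets_borel_eq_cyl:
  "sets (borel :: ('d::finite, 'q::{finite,discrete_topology}) config measure)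
   = sigma_sets UNIV {cyl \<Lambda> \<eta> |\<Lambda> \<eta>. finite \<Lambda>}"
proof (rule antisym)
  let ?C = "{cyl \<Lambda> \<eta> |\<Lambda> (\<eta> :: ('d, 'q) config). finite \<Lambda>}"
  have "U \<in> sigma_sets UNIV ?C" if U: "open U" for U
  proof -
    have "U = \<Union>{B \<in> ?C. B \<subseteq> U}"
    proof (intro equalityI subsetI)
      fix \<eta> assume "\<eta> \<in> U"
      then obtain \<Lambda> where "finite \<Lambda>" "cyl \<Lambda> \<eta> \<subseteq> U" using open_contains_cyl[OF U] by blast
      then show "\<eta> \<in> \<Union>{B \<in> ?C. B \<subseteq> U}" using cyl_self[of \<eta> \<Lambda>] by blast
    qed blast
    moreover have "countable {B \<in> ?C. B \<subseteq> U}"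
      by (rule countable_subset[OF _ countable_cyls]) auto
    moreover have "{B \<in> ?C. B \<subseteq> U} \<subseteq> sigma_sets UNIV ?C" by auto
    ultimately show ?thesis
      by (metis (no_types, lifting) sigma_sets_UNION subsetD)
  qed
  then show "sets borel \<subseteq> sigma_sets UNIV ?C"
    unfolding borel_def by (subst sets_measure_of) (auto intro!: sigma_sets_mono)
  show "sigma_sets UNIV ?C \<subseteq> sets borel"
  proof -
    have "?C \<subseteq> sets borel" by auto
    from sets.sigma_sets_subset[OF this] show ?thesis by simp
  qed
qed

text \<open>The empty set is added because cylinders with conflicting spins are disjoint; otherwise
  any common point describes the intersection as a cylinder over the union of the two
  windows.\<close>

lemma Int_stable_cyl:
  "Int_stable (insert {} {cyl \<Lambda> \<eta> |\<Lambda> (\<eta> :: ('d::finite, 'q) config). finite \<Lambda>})"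
proof (rule Int_stableI)
  fix A B assume A: "A \<in> insert {} {cyl \<Lambda> \<eta> |\<Lambda> (\<eta> :: ('d, 'q) config). finite \<Lambda>}"
    and B: "B \<in> insert {} {cyl \<Lambda> \<eta> |\<Lambda> (\<eta> :: ('d, 'q) config). finite \<Lambda>}"
  show "A \<inter> B \<in> insert {} {cyl \<Lambda> \<eta> |\<Lambda> (\<eta> :: ('d, 'q) config). finite \<Lambda>}"
  proof (cases "A \<inter> B = {}")
    case False
    then obtain \<omega> where \<omega>: "\<omega> \<in> A" "\<omega> \<in> B" by auto
    obtain \<Lambda> \<eta> where 1: "A = cyl \<Lambda> \<eta>" "finite \<Lambda>" using A \<omega> by auto
    obtain \<Lambda>' \<eta>' where 2: "B = cyl \<Lambda>' \<eta>'" "finite \<Lambda>'" using B \<omega> by auto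
    have "A \<inter> B = cyl (\<Lambda> \<union> \<Lambda>') \<omega>" using \<omega> 1 2 by (auto simp: cyl_def)
    with 1 2 show ?thesis by blast
  qed simp
qed

lemma measure_eqI_cyl:
  fixes \<nu> \<nu>' :: "('d::finite, 'q::{finite,discrete_topology}) config measure"
  assumes "\<nu> \<in> prob_measures" "\<nu>' \<in> prob_measures"
    and eq: "\<And>\<Lambda> \<eta>. finite \<Lambda> \<Longrightarrow> measure \<nu> (cyl \<Lambda> \<eta>) = measure \<nu>' (cyl \<Lambda> \<eta>)"
  shows "\<nu> = \<nu>'"
proof -
  let ?C = "insert {} {cyl \<Lambda> \<eta> |\<Lambda> (\<eta> :: ('d, 'q) config). finite \<Lambda>}"
  interpret \<nu>: prob_space \<nu> using assms by (simp add: prob_measures_def)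
  interpret \<nu>': prob_space \<nu>' using assms by (simp add: prob_measures_def)
  have gen: "sets borel = sigma_sets UNIV ?C"
    unfolding sets_borel_eq_cyl
    by (rule antisym; rule sigma_sets_mono) (auto intro: sigma_sets.Empty)
  show ?thesis
  proof (rule measure_eqI_generator_eq[OF Int_stable_cyl, of UNIV _ _ "\<lambda>_. UNIV"])
    show "\<And>X. X \<in> ?C \<Longrightarrow> emeasure \<nu> X = emeasure \<nu>' X"
      using eq by (auto simp: \<nu>.emeasure_eq_measure \<nu>'.emeasure_eq_measure)
    show "range (\<lambda>_ :: nat. UNIV) \<subseteq> ?C"
      by (auto intro!: exI[of _ "{}"])
  qed (use assms gen in \<open>auto simp: prob_measures_def\<close>)
qed

section \<open>Continuous functions on the compact configuration space and local functions\<close>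

lemma apply_Bcontfun_continuous:
  fixes F :: "('d::finite, 'q::{finite,discrete_topology}) config \<Rightarrow> real"
  assumes "continuous_on UNIV F"
  shows "apply_bcontfun (Bcontfun F) = F"
proof -
  have "bounded (range F)"
    using compact_continuous_image[OF assms compact_UNIV_config] by (rule compact_imp_bounded)
  with assms have "F \<in> bcontfun" by (simp add: bcontfun_def)
  then show ?thesis by (simp add: Bcontfun_inverse)
qed

lemma continuous_bounded_config:
  fixes F :: "('d::finite, 'q::{finite,discrete_topology}) config \<Rightarrow> real"
  assumes "continuous_on UNIV F"
  obtains B where "\<And>\<eta>. \<bar>F \<eta>\<bar> \<le> B"
proof -
  have "bounded (range F)"
    using compact_continuous_image[OF assms compact_UNIV_config] by (rule compact_imp_bounded)
  then show ?thesis using that by (auto simp: bounded_iff)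
qed

lemma continuous_local:
  fixes F :: "('d::finite, 'q::{finite,discrete_topology}) config \<Rightarrow> real"
  assumes "local_function F"
  shows "continuous_on UNIV F"
proof -
  obtain \<Lambda> where \<Lambda>: "finite \<Lambda>" "\<And>\<eta> \<zeta>. (\<forall>x\<in>\<Lambda>. \<eta> x = \<zeta> x) \<Longrightarrow> F \<eta> = F \<zeta>"
    using assms unfolding local_function_def by metis
  show ?thesis
    unfolding continuous_on_open_vimage[OF open_UNIV]
  proof safe
    fix B :: "real set"
    have "F -` B = (\<Union>\<eta>\<in>F -` B. cyl \<Lambda> \<eta>)"
      using \<Lambda>(2) by (fastforce simp: cyl_def)
    then show "open (F -` B \<inter> UNIV)"
      using cyl_clopen(1)[OF \<Lambda>(1)] by (metis (no_types, lifting) Int_UNIV_right open_UN)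
  qed
qed

lemma local_indicator_cyl: "finite \<Lambda> \<Longrightarrow> local_function (indicator (cyl \<Lambda> \<eta>))"
  unfolding local_function_def cyl_def by (intro exI[of _ \<Lambda>]) (auto simp: indicator_def)

text \<open>Uniform continuity by compactness: finitely many cylinders, on each of which F stays
  within \<epsilon>/2 of its value at the centre, cover the space, and the union of their windows
  serves for all configurations.\<close>

lemma continuous_uniform_local:
  fixes F :: "('d::finite, 'q::{finite,discrete_topology}) config \<Rightarrow> real"
  assumes "continuous_on UNIV F" "\<epsilon> > 0"
  obtains \<Lambda> where "finite \<Lambda>" "\<And>\<eta> \<zeta>. (\<forall>x\<in>\<Lambda>. \<eta> x = \<zeta> x) \<Longrightarrow> \<bar>F \<eta> - F \<zeta>\<bar> < \<epsilon>"
proof -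
  have "\<exists>\<Lambda>. finite \<Lambda> \<and> (\<forall>\<zeta>\<in>cyl \<Lambda> \<eta>. \<bar>F \<zeta> - F \<eta>\<bar> < \<epsilon>/2)" for \<eta>
  proof -
    have "open (F -` ball (F \<eta>) (\<epsilon>/2))"
      using assms by (intro open_vimage) auto
    from open_contains_cyl[OF this, of \<eta>] assms(2) show ?thesis
      by (auto simp: dist_real_def abs_minus_commute subset_iff)
  qed
  then obtain N where N: "\<And>\<eta>. finite (N \<eta>)"
    "\<And>\<eta> \<zeta>. \<zeta> \<in> cyl (N \<eta>) \<eta> \<Longrightarrow> \<bar>F \<zeta> - F \<eta>\<bar> < \<epsilon>/2" by metis
  have "UNIV \<subseteq> (\<Union>\<eta>\<in>UNIV. cyl (N \<eta>) \<eta>)" using cyl_self by blast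
  then obtain D where D: "finite D" "UNIV \<subseteq> (\<Union>\<eta>\<in>D. cyl (N \<eta>) \<eta>)"
    by (rule compactE_image[OF compact_UNIV_config cyl_clopen(1)[OF N(1)]])
  show ?thesis
  proof
    show "finite (\<Union>\<eta>\<in>D. N \<eta>)" using D N by blast
    fix \<eta> \<zeta> :: "('d, 'q) config" assume eq: "\<forall>x\<in>\<Union>\<eta>\<in>D. N \<eta>. \<eta> x = \<zeta> x"
    obtain \<omega> where \<omega>: "\<omega> \<in> D" "\<eta> \<in> cyl (N \<omega>) \<omega>" using D by blast
    then have "\<zeta> \<in> cyl (N \<omega>) \<omega>" using eq by (auto simp: cyl_def)
    with N(2)[OF \<omega>(2)] N(2)[OF this] show "\<bar>F \<eta> - F \<zeta>\<bar> < \<epsilon>" by linarith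
  qed
qed

section \<open>States on continuous functions and probability measures\<close>

lemma continuous_integrable:
  fixes F :: "('d::finite, 'q::{finite,discrete_topology}) config \<Rightarrow> real"
  assumes "\<nu> \<in> prob_measures" "continuous_on UNIV F"
  shows "integrable \<nu> F"
proof -
  interpret prob_space \<nu> using assms by (simp add: prob_measures_def)
  obtain B where "\<And>\<eta>. \<bar>F \<eta>\<bar> \<le> B" using continuous_bounded_config[OF assms(2)] by blast
  moreover have "F \<in> borel_measurable \<nu>"
    using borel_measurable_continuous_onI[OF assms(2)] assms(1)
    by (simp add: prob_measures_def cong: measurable_cong_sets)
  ultimately show ?thesis by (intro integrable_const_bound[of _ B]) auto
qed

text \<open>States in the sense of operator algebras: positive normalised linear functionals. Time
  evolution and mixtures are constructed as states first and turned into measures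
  afterwards.\<close>

definition state :: "((('d::finite, 'q::{finite,discrete_topology}) config \<Rightarrow>\<^sub>C real) \<Rightarrow> real) \<Rightarrow> bool" where
  "state E \<longleftrightarrow> linear E \<and> (\<forall>f. (\<forall>\<eta>. 0 \<le> apply_bcontfun f \<eta>) \<longrightarrow> 0 \<le> E f) \<and> E (const_bcontfun 1) = 1"

lemma state_integral:
  fixes \<nu> :: "('d::finite, 'q::{finite,discrete_topology}) config measure"
  assumes "\<nu> \<in> prob_measures"
  shows "state (\<lambda>f. \<integral>\<omega>. apply_bcontfun f \<omega> \<partial>\<nu>)"
proof -
  interpret prob_space \<nu> using assms by (simp add: prob_measures_def)
  have "integrable \<nu> (apply_bcontfun f)" for f :: "('d, 'q) config \<Rightarrow>\<^sub>C real"
    by (rule continuous_integrable[OF assms]) simp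
  then show ?thesis
    unfolding state_def
    by (auto intro!: linearI simp: plus_bcontfun.rep_eq scaleR_bcontfun.rep_eq prob_space)
qed

lemma state_mono:
  assumes "state E" "\<And>\<eta>. apply_bcontfun f \<eta> \<le> apply_bcontfun g \<eta>"
  shows "E f \<le> E g"
proof -
  have "0 \<le> E (g - f)"
    using assms by (simp add: state_def minus_bcontfun.rep_eq)
  then show ?thesis using assms(1) by (simp add: state_def linear_diff)
qed

lemma state_abs_le:
  assumes "state E" shows "\<bar>E f\<bar> \<le> norm f"
proof -
  have lin: "linear E" "E (const_bcontfun 1) = 1" using assms by (auto simp: state_def)
  have bound: "\<bar>apply_bcontfun f \<eta>\<bar> \<le> norm f" for \<eta>
    using norm_bounded[of f \<eta>] by simp
  have "E f \<le> E (norm f *\<^sub>R const_bcontfun 1)" "E ((- norm f) *\<^sub>R const_bcontfun 1) \<le> E f"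
    using bound by (auto intro!: state_mono[OF assms] simp: scaleR_bcontfun.rep_eq abs_le_iff minus_le_iff)
  then show ?thesis
    using lin by (simp add: linear_scale linear_neg abs_le_iff)
qed

lemma local_expansion:
  fixes F :: "('d::finite, 'q::{finite,discrete_topology}) config \<Rightarrow> real"
  assumes "finite \<Lambda>" "\<And>\<eta> \<zeta>. (\<forall>x\<in>\<Lambda>. \<eta> x = \<zeta> x) \<Longrightarrow> F \<eta> = F \<zeta>"
  shows "F \<eta> = (\<Sum>\<omega> \<in> \<Lambda> \<rightarrow>\<^sub>E UNIV. F \<omega> * indicator (cyl \<Lambda> \<omega>) \<eta>)"
proof -
  have fin: "finite (\<Lambda> \<rightarrow>\<^sub>E (UNIV :: 'q set))" using assms(1) by (simp add: finite_PiE)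
  have "F \<omega> * indicator (cyl \<Lambda> \<omega>) \<eta> = (if \<omega> = restrict \<eta> \<Lambda> then F \<eta> else 0)"
    if "\<omega> \<in> \<Lambda> \<rightarrow>\<^sub>E UNIV" for \<omega>
  proof (cases "\<omega> = restrict \<eta> \<Lambda>")
    case True
    then show ?thesis using assms(2)[of \<omega> \<eta>] by (auto simp: cyl_def)
  next
    case False
    then have "\<eta> \<notin> cyl \<Lambda> \<omega>" using that by (fastforce simp: cyl_def PiE_def extensional_def restrict_def)
    with False show ?thesis by simp
  qed
  then have "(\<Sum>\<omega> \<in> \<Lambda> \<rightarrow>\<^sub>E UNIV. F \<omega> * indicator (cyl \<Lambda> \<omega>) \<eta>)
      = (\<Sum>\<omega> \<in> \<Lambda> \<rightarrow>\<^sub>E UNIV. if \<omega> = restrict \<eta> \<Lambda> then F \<eta> else 0)"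
    by (rule sum.cong[OF refl])
  also have "\<dots> = F \<eta>" using fin by (subst sum.delta) auto
  finally show ?thesis by simp
qed

lemma bcontfun_sum_apply:
  "apply_bcontfun (\<Sum>i\<in>I. f i) \<eta> = (\<Sum>i\<in>I. apply_bcontfun (f i :: _ \<Rightarrow>\<^sub>C real) \<eta>)"
  by (induction I rule: infinite_finite_induct) (auto simp: plus_bcontfun.rep_eq)

text \<open>Local functions are dense in the supremum norm and are finite combinations of cylinder
  indicators, while states are contractions.\<close>

lemma state_eqI:
  fixes E E' :: "(('d::finite, 'q::{finite,discrete_topology}) config \<Rightarrow>\<^sub>C real) \<Rightarrow> real"
  assumes "state E" "state E'"
    and eq: "\<And>\<Lambda> \<eta>. finite \<Lambda> \<Longrightarrow>
      E (Bcontfun (indicator (cyl \<Lambda> \<eta>))) = E' (Bcontfun (indicator (cyl \<Lambda> \<eta>)))"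
  shows "E f = E' f"
proof (rule ccontr)
  have lin: "linear E" "linear E'" using assms by (auto simp: state_def)
  assume "E f \<noteq> E' f"
  \<comment> \<open>A quarter of the gap: replacing f by a local function costs \<epsilon> in each
    state, so the gap is at most 2\<epsilon>, although it equals 4\<epsilon>.\<close>
  define \<epsilon> where "\<epsilon> = \<bar>E f - E' f\<bar> / 4"
  have "\<epsilon> > 0" using \<open>E f \<noteq> E' f\<close> by (simp add: \<epsilon>_def)
  obtain \<Lambda> where \<Lambda>: "finite \<Lambda>"
    "\<And>\<eta> \<zeta>. (\<forall>x\<in>\<Lambda>. \<eta> x = \<zeta> x) \<Longrightarrow> \<bar>apply_bcontfun f \<eta> - apply_bcontfun f \<zeta>\<bar> < \<epsilon>"
    using continuous_uniform_local[OF continuous_on_apply_bcontfun \<open>\<epsilon> > 0\<close>] by blast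
  \<comment> \<open>Evaluating f at \<open>restrict \<eta> \<Lambda>\<close>, with the default value
    \<open>undefined\<close> off \<Lambda>, gives a local function within \<epsilon> of f.\<close>
  define F where "F \<eta> = apply_bcontfun f (restrict \<eta> \<Lambda>)" for \<eta>
  have F: "F \<eta> = F \<zeta>" if "\<forall>x\<in>\<Lambda>. \<eta> x = \<zeta> x" for \<eta> \<zeta>
    unfolding F_def using that by (metis restrict_ext)
  define g where "g = (\<Sum>\<omega> \<in> \<Lambda> \<rightarrow>\<^sub>E UNIV. F \<omega> *\<^sub>R Bcontfun (indicator (cyl \<Lambda> \<omega>)) :: ('d, 'q) config \<Rightarrow>\<^sub>C real)"
  have "apply_bcontfun (Bcontfun (indicator (cyl \<Lambda> \<omega>))) = (indicator (cyl \<Lambda> \<omega>) :: ('d, 'q) config \<Rightarrow> real)" for \<omega>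
    by (intro apply_Bcontfun_continuous continuous_local local_indicator_cyl \<Lambda>)
  then have "apply_bcontfun g \<eta> = F \<eta>" for \<eta>
    using local_expansion[where F = F and \<eta> = \<eta>, OF \<Lambda>(1) F]
    by (simp add: g_def bcontfun_sum_apply scaleR_bcontfun.rep_eq)
  then have "norm (f - g) \<le> \<epsilon>"
    using \<Lambda>(2) by (intro norm_bound) (auto simp: minus_bcontfun.rep_eq F_def intro!: less_imp_le)
  then have "\<bar>E f - E g\<bar> \<le> \<epsilon>" "\<bar>E' f - E' g\<bar> \<le> \<epsilon>"
    using state_abs_le[OF assms(1), of "f - g"] state_abs_le[OF assms(2), of "f - g"] lin
    by (auto simp: linear_diff)
  moreover have "E g = E' g"
    unfolding g_def using lin eq[OF \<Lambda>(1)] by (simp add: linear_sum linear_scale)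
  ultimately have "\<bar>E f - E' f\<bar> \<le> 2 * \<epsilon>" by linarith
  moreover have "\<bar>E f - E' f\<bar> = 4 * \<epsilon>" by (simp add: \<epsilon>_def)
  ultimately show False using \<open>\<epsilon> > 0\<close> by linarith
qed

lemma local_event:
  fixes A :: "('d::finite, 'q::{finite,discrete_topology}) config set"
  assumes "finite \<Lambda>" "\<And>\<eta>. \<eta> \<in> A \<Longrightarrow> cyl \<Lambda> \<eta> \<subseteq> A"
  shows "local_function (indicator A :: _ \<Rightarrow> real)" "open A" "closed A"
proof -
  have iff: "\<eta> \<in> A \<longleftrightarrow> \<zeta> \<in> A" if "\<forall>x\<in>\<Lambda>. \<eta> x = \<zeta> x" for \<eta> \<zeta>
    using assms(2)[of \<eta>] assms(2)[of \<zeta>] that by (auto simp: cyl_def)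
  then show loc: "local_function (indicator A :: _ \<Rightarrow> real)"
    unfolding local_function_def using assms(1) by (auto simp: indicator_def)
  have "(indicator A :: _ \<Rightarrow> real) -` {0<..} = A" "(indicator A :: _ \<Rightarrow> real) -` {1} = A"
    by (auto simp: indicator_def)
  then show "open A" "closed A"
    using open_vimage[OF open_greaterThan continuous_local[OF loc], of 0]
      closed_vimage[OF closed_singleton continuous_local[OF loc], of 1] by simp_all
qed

text \<open>The case of the Riesz representation theorem needed here: by compactness, finite additivity on
  the algebra of local events already implies continuity at the empty set.\<close>

lemma state_measure:
  fixes E :: "(('d::finite, 'q::{finite,discrete_topology}) config \<Rightarrow>\<^sub>C real) \<Rightarrow> real"
  assumes "state E"
  shows "\<exists>\<nu>\<in>prob_measures. \<forall>f. (\<integral>\<omega>. apply_bcontfun f \<omega> \<partial>\<nu>) = E f"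
proof -
  define M :: "('d, 'q) config set set" where
    "M = {A. \<exists>\<Lambda>. finite \<Lambda> \<and> (\<forall>\<eta>\<in>A. cyl \<Lambda> \<eta> \<subseteq> A)}"
  define m where "m A = ennreal (E (Bcontfun (indicator A)))" for A
  have lin: "linear E" "E (const_bcontfun 1) = 1" using assms by (auto simp: state_def)
  have M_local: "local_function (indicator A :: _ \<Rightarrow> real)" "closed A" "open A" if A: "A \<in> M" for A
  proof -
    obtain \<Lambda> where \<Lambda>: "finite \<Lambda>" "\<And>\<eta>. \<eta> \<in> A \<Longrightarrow> cyl \<Lambda> \<eta> \<subseteq> A" using A by (auto simp: M_def)
    show "local_function (indicator A :: _ \<Rightarrow> real)" "closed A" "open A"
      using local_event[OF \<Lambda>] by auto
  qed
  have ind: "apply_bcontfun (Bcontfun (indicator A)) = (indicator A :: _ \<Rightarrow> real)" if "A \<in> M" for A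
    by (intro apply_Bcontfun_continuous continuous_local M_local that)
  have pos: "0 \<le> E (Bcontfun (indicator A))" if "A \<in> M" for A
    using assms ind[OF that] by (simp add: state_def)
  have cyl_M: "cyl \<Lambda> \<eta> \<in> M" if "finite \<Lambda>" for \<Lambda> \<eta>
    unfolding M_def using that by (auto simp: cyl_def)
  have Un: "A \<union> B \<in> M" and Diff: "A - B \<in> M" if AB: "A \<in> M" "B \<in> M" for A B
  proof -
    obtain \<Lambda> where \<Lambda>: "finite \<Lambda>" "\<And>\<eta>. \<eta> \<in> A \<Longrightarrow> cyl \<Lambda> \<eta> \<subseteq> A" using AB by (auto simp: M_def)
    obtain \<Delta> where \<Delta>: "finite \<Delta>" "\<And>\<eta>. \<eta> \<in> B \<Longrightarrow> cyl \<Delta> \<eta> \<subseteq> B" using AB by (auto simp: M_def)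
    have "\<eta> \<in> A \<union> B \<Longrightarrow> cyl (\<Lambda> \<union> \<Delta>) \<eta> \<subseteq> A \<union> B" for \<eta>
      using \<Lambda>(2) \<Delta>(2) cyl_antimono[of \<Lambda> "\<Lambda> \<union> \<Delta>"] cyl_antimono[of \<Delta> "\<Lambda> \<union> \<Delta>"] by blast
    then show "A \<union> B \<in> M" unfolding M_def using \<Lambda>(1) \<Delta>(1) by (intro CollectI exI[of _ "\<Lambda> \<union> \<Delta>"]) auto
    have "cyl (\<Lambda> \<union> \<Delta>) \<eta> \<subseteq> A - B" if "\<eta> \<in> A - B" for \<eta>
    proof
      fix \<zeta> assume \<zeta>: "\<zeta> \<in> cyl (\<Lambda> \<union> \<Delta>) \<eta>"
      then have "\<zeta> \<in> A" using \<Lambda>(2)[of \<eta>] that by (auto simp: cyl_def)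
      moreover have "\<eta> \<in> cyl \<Delta> \<zeta>" using \<zeta> by (auto simp: cyl_def)
      ultimately show "\<zeta> \<in> A - B" using \<Delta>(2)[of \<zeta>] that by blast
    qed
    then show "A - B \<in> M" unfolding M_def using \<Lambda>(1) \<Delta>(1) by (intro CollectI exI[of _ "\<Lambda> \<union> \<Delta>"]) auto
  qed
  interpret ring_of_sets UNIV M
  proof (rule ring_of_setsI)
    show "{} \<in> M" unfolding M_def by blast
  qed (use Un Diff in auto)
  have m_add: "E (Bcontfun (indicator (A \<union> B))) = E (Bcontfun (indicator A)) + E (Bcontfun (indicator B))"
    if "A \<in> M" "B \<in> M" "A \<inter> B = {}" for A B
  proof -
    have "Bcontfun (indicator (A \<union> B)) = Bcontfun (indicator A) + (Bcontfun (indicator B) :: ('d, 'q) config \<Rightarrow>\<^sub>C real)"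
      using that by (intro bcontfun_eqI) (auto simp: ind Un plus_bcontfun.rep_eq indicator_def)
    then show ?thesis using lin by (simp add: linear_add)
  qed
  have zero: "E (Bcontfun (indicator {})) = 0"
    using m_add[of "{}" "{}"] by simp
  have "\<exists>\<mu>. (\<forall>s\<in>M. \<mu> s = m s) \<and> measure_space UNIV (sigma_sets UNIV M) \<mu>"
  proof (rule caratheodory_empty_continuous)
    show "positive M m" by (simp add: positive_def m_def zero)
    show "additive M m"
      by (auto simp: additive_def m_def m_add ennreal_plus[symmetric] pos simp del: ennreal_plus)
    show "m A \<noteq> \<infinity>" if "A \<in> M" for A by (simp add: m_def)
    fix A :: "nat \<Rightarrow> ('d, 'q) config set"
    assume A: "range A \<subseteq> M" "decseq A" "(\<Inter>i. A i) = {}"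
    have "\<exists>n. A n = {}"
    proof -
      have "UNIV \<subseteq> (\<Union>n\<in>UNIV. - A n)" using A(3) by auto
      moreover have "open (- A n)" for n using A(1) M_local(2)[of "A n"] by auto
      ultimately obtain D where D: "finite D" "UNIV \<subseteq> (\<Union>n\<in>D. - A n)"
        using compactE_image[OF compact_UNIV_config, of UNIV "\<lambda>n. - A n"] by metis
      obtain N where N: "\<And>n. n \<in> D \<Longrightarrow> n \<le> N"
        using D(1) by (meson finite_nat_set_iff_bounded_le)
      have "A N \<subseteq> A n" if "n \<in> D" for n using A(2) N[OF that] by (simp add: decseq_def)
      then have "A N = {}" using D(2) by blast
      then show ?thesis ..
    qed
    then obtain N where N: "A N = {}" ..
    have "m (A n) = 0" if "n \<ge> N" for n
    proof -
      have "A n = {}" using A(2) N that by (auto simp: decseq_def)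
      then show ?thesis by (simp only: m_def zero ennreal_0)
    qed
    then have "\<forall>\<^sub>F n in sequentially. m (A n) = 0"
      by (rule eventually_sequentiallyI)
    then show "(\<lambda>i. m (A i)) \<longlonglongrightarrow> 0" by (rule tendsto_eventually)
  qed
  then obtain \<mu> where \<mu>: "\<forall>s\<in>M. \<mu> s = m s" "measure_space UNIV (sigma_sets UNIV M) \<mu>"
    by (elim exE conjE)
  have sets_M: "sigma_sets UNIV M = sets (borel :: ('d, 'q) config measure)"
  proof (rule antisym)
    have "M \<subseteq> sets borel" using M_local(3) by (auto intro: borel_open)
    then show "sigma_sets UNIV M \<subseteq> sets borel" using sets.sigma_sets_subset[of M borel] by simp
    show "sets borel \<subseteq> sigma_sets UNIV M"
      unfolding sets_borel_eq_cyl using cyl_M by (intro sigma_sets_mono) auto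
  qed
  define \<nu> where "\<nu> = measure_of UNIV M \<mu>"
  have sets_\<nu>: "sets \<nu> = sets borel" unfolding \<nu>_def by (simp add: sets_M)
  have em: "emeasure \<nu> A = m A" if "A \<in> M" for A
    using emeasure_measure_of[OF \<nu>_def, of A] \<mu> that sets_\<nu> sets_M
    by (auto simp: measure_space_def)
  have UNIV_M: "UNIV \<in> M" using cyl_M[of "{}"] by simp
  have "Bcontfun (indicator UNIV) = (const_bcontfun 1 :: ('d, 'q) config \<Rightarrow>\<^sub>C real)"
    by (rule bcontfun_eqI) (simp only: ind[OF UNIV_M], simp)
  then have "m UNIV = 1" by (simp only: m_def lin ennreal_1)
  moreover have space_\<nu>: "space \<nu> = UNIV" using sets_eq_imp_space_eq[OF sets_\<nu>] by simp
  ultimately have "prob_space \<nu>"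
    using em[OF UNIV_M] by (intro prob_spaceI) simp
  with sets_\<nu> have \<nu>: "\<nu> \<in> prob_measures" by (simp add: prob_measures_def)
  have "(\<integral>\<omega>. apply_bcontfun f \<omega> \<partial>\<nu>) = E f" for f
  proof (rule state_eqI[OF state_integral[OF \<nu>] assms])
    fix \<Lambda> :: "'d site set" and \<eta> :: "('d, 'q) config" assume "finite \<Lambda>"
    note C = cyl_M[OF this, of \<eta>]
    have "(\<integral>\<omega>. apply_bcontfun (Bcontfun (indicator (cyl \<Lambda> \<eta>))) \<omega> \<partial>\<nu>) = measure \<nu> (cyl \<Lambda> \<eta>)"
      by (simp only: ind[OF C] Bochner_Integration.integral_indicator space_\<nu> Int_UNIV_right)
    also have "\<dots> = E (Bcontfun (indicator (cyl \<Lambda> \<eta>)))"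
      using pos[OF C] by (simp only: measure_def em[OF C] m_def enn2real_ennreal)
    finally show "(\<integral>\<omega>. apply_bcontfun (Bcontfun (indicator (cyl \<Lambda> \<eta>))) \<omega> \<partial>\<nu>)
      = E (Bcontfun (indicator (cyl \<Lambda> \<eta>)))" .
  qed
  with \<nu> show ?thesis by blast
qed

lemma integral_cyl:
  assumes "\<nu> \<in> prob_measures" "finite \<Lambda>"
  shows "(\<integral>\<omega>. indicator (cyl \<Lambda> \<eta>) \<omega> \<partial>\<nu>) = measure \<nu> (cyl \<Lambda> \<eta>)"
proof -
  have "sets \<nu> = sets borel" using assms(1) by (simp add: prob_measures_def)
  then show ?thesis using sets_eq_imp_space_eq[of \<nu> borel] by simp
qed

section \<open>Time evolution\<close>

text \<open>This justifies the definite description in \<open>evolve\<close>: the measure exists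
  because f \<mapsto> \<nu>(P_t f) is a state, and it is unique because cylinder indicators are
  continuous.\<close>

lemma evolve:
  fixes P :: "('d::finite, 'q::{finite,discrete_topology}) semigroup"
  assumes "feller_semigroup P" "0 \<le> t" "\<nu> \<in> prob_measures"
  shows evolve_prob: "evolve P t \<nu> \<in> prob_measures"
    and integral_evolve:
      "(\<integral>\<omega>. apply_bcontfun f \<omega> \<partial>(evolve P t \<nu>)) = (\<integral>\<omega>. apply_bcontfun (P t f) \<omega> \<partial>\<nu>)"
proof -
  have P: "linear (P t)" "P t (const_bcontfun 1) = const_bcontfun 1"
    "\<And>f. (\<forall>\<eta>. 0 \<le> apply_bcontfun f \<eta>) \<Longrightarrow> (\<forall>\<eta>. 0 \<le> apply_bcontfun (P t f) \<eta>)"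
    using assms(1,2) unfolding feller_semigroup_def by blast+
  have st: "state (\<lambda>f. \<integral>\<omega>. apply_bcontfun f \<omega> \<partial>\<nu>)" by (rule state_integral[OF assms(3)])
  have "state (\<lambda>f. \<integral>\<omega>. apply_bcontfun (P t f) \<omega> \<partial>\<nu>)"
    using st P linear_compose[OF P(1), of "\<lambda>f. \<integral>\<omega>. apply_bcontfun f \<omega> \<partial>\<nu>"]
    unfolding state_def o_def by auto
  from state_measure[OF this] obtain \<nu>' where \<nu>': "\<nu>' \<in> prob_measures"
    "\<forall>f. (\<integral>\<omega>. apply_bcontfun f \<omega> \<partial>\<nu>') = (\<integral>\<omega>. apply_bcontfun (P t f) \<omega> \<partial>\<nu>)" by blast
  have uniq: "\<nu>'' = \<nu>'" if "\<nu>'' \<in> prob_measures \<and>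
    (\<forall>f. (\<integral>\<omega>. apply_bcontfun f \<omega> \<partial>\<nu>'') = (\<integral>\<omega>. apply_bcontfun (P t f) \<omega> \<partial>\<nu>))" for \<nu>''
  proof (rule measure_eqI_cyl)
    fix \<Lambda> :: "'d site set" and \<eta> :: "('d, 'q) config" assume fin: "finite \<Lambda>"
    have "apply_bcontfun (Bcontfun (indicator (cyl \<Lambda> \<eta>))) = (indicator (cyl \<Lambda> \<eta>) :: _ \<Rightarrow> real)"
      by (intro apply_Bcontfun_continuous continuous_local local_indicator_cyl fin)
    then show "measure \<nu>'' (cyl \<Lambda> \<eta>) = measure \<nu>' (cyl \<Lambda> \<eta>)"
      using that \<nu>' integral_cyl[OF _ fin, of \<nu>'' \<eta>] integral_cyl[OF _ fin, of \<nu>' \<eta>] by metis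
  qed (use that \<nu>' in auto)
  then have "evolve P t \<nu> = \<nu>'"
    unfolding evolve_def by (intro the_equality conjI \<nu>') (rule uniq)
  with \<nu>' show "evolve P t \<nu> \<in> prob_measures"
    "(\<integral>\<omega>. apply_bcontfun f \<omega> \<partial>(evolve P t \<nu>)) = (\<integral>\<omega>. apply_bcontfun (P t f) \<omega> \<partial>\<nu>)" by auto
qed

text \<open>Applying P_t and then evaluating at a point is a state, and states are bounded by the
  norm.\<close>

lemma feller_norm_le:
  fixes P :: "('d::finite, 'q::{finite,discrete_topology}) semigroup"
  assumes "feller_semigroup P" "0 \<le> t"
  shows "norm (P t f) \<le> norm f"
proof (rule norm_bound)
  fix \<eta>
  have P: "linear (P t)" "P t (const_bcontfun 1) = const_bcontfun 1"
    "\<And>f. (\<forall>\<eta>. 0 \<le> apply_bcontfun f \<eta>) \<Longrightarrow> (\<forall>\<eta>. 0 \<le> apply_bcontfun (P t f) \<eta>)"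
    using assms(1,2) unfolding feller_semigroup_def by blast+
  have "linear (\<lambda>f :: ('d, 'q) config \<Rightarrow>\<^sub>C real. apply_bcontfun f \<eta>)"
    by (intro linearI) (auto simp: plus_bcontfun.rep_eq scaleR_bcontfun.rep_eq)
  from linear_compose[OF P(1) this] P
  have "state (\<lambda>f. apply_bcontfun (P t f) \<eta>)" by (simp add: state_def o_def)
  from state_abs_le[OF this, of f] show "norm (apply_bcontfun (P t f) \<eta>) \<le> norm f" by simp
qed

text \<open>The generator is a right derivative at time zero only. The two-sided derivative at t
  follows by factoring out the contraction at the earlier of the two times; for left quotients the
  base point moves, which costs the second summand of \<open>e\<close>, a quantity tending to 0 by
  strong continuity.\<close>

lemma feller_derivative:
  fixes P :: "('d::finite, 'q::{finite,discrete_topology}) semigroup"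
  assumes F: "feller_semigroup P" and fg: "(f, g) \<in> infinitesimal_generator P" and t: "0 \<le> t"
  shows "((\<lambda>t. P t f) has_vector_derivative P t g) (at t within {0..})"
proof -
  have P0: "P 0 h = h" and Padd: "0 \<le> s \<Longrightarrow> 0 \<le> u \<Longrightarrow> P (s + u) h = P s (P u h)"
    and Plin: "0 \<le> s \<Longrightarrow> linear (P s)" and Pc: "((\<lambda>t. P t h) \<longlongrightarrow> h) (at_right 0)" for s u h
    using F unfolding feller_semigroup_def by blast+
  define e where "e h = norm ((P h f - f) /\<^sub>R h - g) + norm (P h g - g)" for h
  have "((\<lambda>t. (P t f - f) /\<^sub>R t) \<longlongrightarrow> g) (at_right 0)"
    using fg by (simp add: infinitesimal_generator_def)
  then have "(e \<longlongrightarrow> 0) (at_right 0)"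
    unfolding e_def using Pc[of g]
    by (auto intro!: tendsto_add_zero tendsto_norm_zero simp: LIM_zero)
  moreover have "filterlim (\<lambda>s. \<bar>s - t\<bar>) (at_right 0) (at t within {0..})"
    unfolding at_within_def[of 0] filterlim_inf filterlim_principal
  proof
    have "((\<lambda>s. \<bar>s - t\<bar>) \<longlongrightarrow> \<bar>t - t\<bar>) (at t within {0..})" by (intro tendsto_intros)
    then show "((\<lambda>s. \<bar>s - t\<bar>) \<longlongrightarrow> 0) (at t within {0..})" by simp
    show "\<forall>\<^sub>F s in at t within {0..}. \<bar>s - t\<bar> \<in> {0<..} - {0}"
      by (auto simp: eventually_at_filter)
  qed
  ultimately have lim: "((\<lambda>s. e \<bar>s - t\<bar>) \<longlongrightarrow> 0) (at t within {0..})"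
    by (rule filterlim_compose)
  have bound: "norm ((P s f - P t f) /\<^sub>R (s - t) - P t g) \<le> e \<bar>s - t\<bar>" if s: "0 \<le> s" "s \<noteq> t" for s
  proof -
    define u h where "u = min s t" and "h = \<bar>s - t\<bar>"
    \<comment> \<open>From here on \<open>u\<close> is the earlier time and \<open>h\<close> the
      gap, whichever of s and t comes first.\<close>
    have uh: "0 \<le> u" "0 < h" "max s t = u + h" using s t by (auto simp: u_def h_def)
    have quot: "(P s f - P t f) /\<^sub>R (s - t) = P u ((P h f - f) /\<^sub>R h)"
    proof (cases "s \<le> t")
      case True
      then have "t = u + h" "s = u" by (auto simp: u_def h_def)
      then show ?thesis using uh Padd[of u h f] Plin[of u]
        by (simp add: linear_diff linear_scale scaleR_diff_right)
    next
      case False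
      then have "s = u + h" "t = u" by (auto simp: u_def h_def)
      then show ?thesis using uh Padd[of u h f] Plin[of u]
        by (simp add: linear_diff linear_scale)
    qed
    have "norm (P u g - P t g) \<le> norm (P h g - g)"
    proof (cases "s \<le> t")
      case True
      then have "P u g - P t g = P u (g - P h g)"
        using uh Padd[of u h g] Plin[of u] by (simp add: u_def h_def linear_diff)
      then show ?thesis
        using feller_norm_le[OF F uh(1), of "g - P h g"] by (simp add: norm_minus_commute)
    next
      case False
      then show ?thesis by (simp add: u_def)
    qed
    moreover have "norm (P u ((P h f - f) /\<^sub>R h) - P u g) \<le> norm ((P h f - f) /\<^sub>R h - g)"
      using feller_norm_le[OF F uh(1), of "(P h f - f) /\<^sub>R h - g"] Plin[OF uh(1)] by (simp add: linear_diff)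
    ultimately show ?thesis
      unfolding quot e_def h_def[symmetric]
      using norm_triangle_ineq[of "P u ((P h f - f) /\<^sub>R h) - P u g" "P u g - P t g"] by simp
  qed
  show ?thesis
    unfolding has_vector_derivative_def
  proof (rule has_derivativeI_sandwich[OF zero_less_one bounded_linear_scaleR_left _ lim])
    fix s :: real assume s: "s \<in> {0..}" "s \<noteq> t"
    have "norm (P s f - P t f - (s - t) *\<^sub>R P t g) / norm (s - t)
        = norm ((P s f - P t f - (s - t) *\<^sub>R P t g) /\<^sub>R (s - t))"
      by (simp add: divide_inverse mult.commute)
    also have "\<dots> = norm ((P s f - P t f) /\<^sub>R (s - t) - P t g)"
      using s(2) by (simp add: scaleR_diff_right)
    finally show "norm (P s f - P t f - (s - t) *\<^sub>R P t g) / norm (s - t) \<le> e \<bar>s - t\<bar>"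
      using bound s by simp
  qed
qed

lemma evolve_derivative:
  fixes P :: "('d::finite, 'q::{finite,discrete_topology}) semigroup"
  assumes F: "feller_semigroup P" and fg: "(f, g) \<in> infinitesimal_generator P" and t: "0 \<le> t"
    and \<nu>: "\<nu> \<in> prob_measures"
  shows "((\<lambda>t. \<integral>\<omega>. apply_bcontfun f \<omega> \<partial>(evolve P t \<nu>)) has_real_derivative
    (\<integral>\<omega>. apply_bcontfun g \<omega> \<partial>(evolve P t \<nu>))) (at t within {0..})"
proof -
  let ?E = "\<lambda>f :: ('d, 'q) config \<Rightarrow>\<^sub>C real. \<integral>\<omega>. apply_bcontfun f \<omega> \<partial>\<nu>"
  have st: "state ?E" by (rule state_integral[OF \<nu>])
  have lin: "linear ?E" using st by (simp add: state_def)
  have "bounded_linear ?E"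
  proof (rule bounded_linear_intro[of _ 1])
    show "norm (?E f) \<le> norm f * 1" for f using state_abs_le[OF st, of f] by simp
  qed (use linear_add[OF lin] linear_scale[OF lin] in auto)
  from bounded_linear.has_vector_derivative[OF this feller_derivative[OF F fg t]]
  have "((\<lambda>t. ?E (P t f)) has_real_derivative ?E (P t g)) (at t within {0..})"
    by (simp add: has_real_derivative_iff_has_vector_derivative)
  then have "((\<lambda>t. ?E (P t f)) has_real_derivative (\<integral>\<omega>. apply_bcontfun g \<omega> \<partial>(evolve P t \<nu>))) (at t within {0..})"
    by (subst integral_evolve[OF F t \<nu>])
  then show ?thesis
    by (rule has_field_derivative_transform_within[OF _ zero_less_one])
       (use t in \<open>simp_all add: integral_evolve[OF F _ \<nu>]\<close>)
qed

section \<open>Cubes and translations\<close>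

lemma cube_eq_image:
  "(cube n :: ('d::finite) site set) = vec_lambda ` (UNIV \<rightarrow>\<^sub>E {- int n..int n})"
proof (intro equalityI subsetI)
  fix x :: "'d site" assume "x \<in> cube n"
  then have "vec_nth x \<in> UNIV \<rightarrow>\<^sub>E {- int n..int n}"
    by (auto simp: cube_def PiE_iff abs_le_iff minus_le_iff)
  then show "x \<in> vec_lambda ` (UNIV \<rightarrow>\<^sub>E {- int n..int n})"
    by (metis image_eqI vec_nth_inverse)
qed (auto simp: cube_def PiE_iff abs_le_iff minus_le_iff)

lemma finite_cube [simp]: "finite (cube n :: ('d::finite) site set)"
  unfolding cube_eq_image by (intro finite_imageI finite_PiE) auto

lemma card_cube: "card (cube n :: ('d::finite) site set) = (2 * n + 1) ^ CARD('d)"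
proof -
  have "inj_on (vec_lambda :: _ \<Rightarrow> 'd site) (UNIV \<rightarrow>\<^sub>E {- int n..int n})"
    by (rule inj_onI) (simp add: vec_lambda_inject)
  then have "card (cube n :: 'd site set) = card ((UNIV :: 'd set) \<rightarrow>\<^sub>E {- int n..int n})"
    unfolding cube_eq_image by (rule card_image)
  moreover have "nat (2 * int n + 1) = 2 * n + 1" by simp
  ultimately show ?thesis by (simp add: card_PiE)
qed

lemma zero_in_cube [simp]: "0 \<in> cube n"
  by (simp add: cube_def)

lemma cube_mono: "m \<le> n \<Longrightarrow> cube m \<subseteq> cube n"
  unfolding cube_def by (auto intro: order_trans)

lemma cube_add: "x \<in> cube m \<Longrightarrow> y \<in> cube n \<Longrightarrow> x + y \<in> cube (m + n)"
  unfolding cube_def by (auto intro: order_trans[OF abs_triangle_ineq] add_mono)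

lemma cube_uminus: "- x \<in> cube n \<longleftrightarrow> x \<in> cube n"
  by (simp add: cube_def)

lemma finite_subset_cube:
  assumes "finite (\<Lambda> :: ('d::finite) site set)"
  shows "\<exists>n. \<Lambda> \<subseteq> cube n"
proof -
  have "\<exists>n. x \<in> cube n" for x :: "'d site"
  proof -
    have "\<bar>x $ k\<bar> \<le> int (nat (\<Sum>j\<in>UNIV. \<bar>x $ j\<bar>))" for k
      using member_le_sum[of k UNIV "\<lambda>j. \<bar>x $ j\<bar>"] by simp
    then show ?thesis unfolding cube_def by blast
  qed
  then obtain N where N: "\<And>x :: 'd site. x \<in> cube (N x)" by metis
  have "x \<in> cube (\<Sum>y\<in>\<Lambda>. N y)" if "x \<in> \<Lambda>" for x
    using cube_mono[OF member_le_sum[of x \<Lambda> N]] N assms that by auto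
  then show ?thesis by blast
qed

lemma translate_inj: "inj (\<lambda>x :: ('d::finite) site. x + i)"
  by (rule injI) simp

lemma mem_translate: "x \<in> translate i \<Lambda> \<longleftrightarrow> x - i \<in> \<Lambda>"
  by (auto intro: image_eqI[of _ _ "x - i"])

lemma fin_sets_translate: "translate i \<Lambda> \<in> fin_sets \<longleftrightarrow> \<Lambda> \<in> fin_sets"
  using finite_imageD[OF _ inj_on_subset[OF translate_inj]] by (auto simp: fin_sets_def)

lemma shift_shift: "shift i (shift j \<eta>) = shift (i + j) \<eta>"
  by (simp add: shift_def algebra_simps)

lemma shift_0: "shift 0 \<eta> = \<eta>"
  by (simp add: shift_def)

lemma shift_PiE: "shift i \<xi> \<in> translate i \<Delta> \<rightarrow>\<^sub>E UNIV \<longleftrightarrow> \<xi> \<in> \<Delta> \<rightarrow>\<^sub>E UNIV"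
proof
  assume *: "shift i \<xi> \<in> translate i \<Delta> \<rightarrow>\<^sub>E UNIV"
  have "\<xi> x = undefined" if "x \<notin> \<Delta>" for x
    using * that by (auto simp: PiE_iff extensional_def shift_def mem_translate dest: spec[of _ "x + i"])
  then show "\<xi> \<in> \<Delta> \<rightarrow>\<^sub>E UNIV" by (auto simp: PiE_iff extensional_def)
qed (auto simp: PiE_iff extensional_def shift_def mem_translate)

lemma bij_shift_PiE:
  fixes \<Delta> :: "('a::finite) site set"
  shows "bij_betw (shift i :: ('a::finite, 'b) config \<Rightarrow> _) (\<Delta> \<rightarrow>\<^sub>E UNIV) (translate i \<Delta> \<rightarrow>\<^sub>E UNIV)"
proof (rule bij_betw_byWitness[of _ "shift (- i)"])
  show "shift (- i) ` (translate i \<Delta> \<rightarrow>\<^sub>E UNIV) \<subseteq> \<Delta> \<rightarrow>\<^sub>E UNIV"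
    by (auto simp: PiE_iff extensional_def shift_def mem_translate)
qed (auto simp: shift_shift shift_0 PiE_iff extensional_def shift_def mem_translate)

lemma override_on_shift:
  "override_on (shift i \<eta>) (shift i \<xi>) (translate i \<Delta>) = shift i (override_on \<eta> \<xi> \<Delta>)"
  by (auto simp: override_on_def shift_def mem_translate)

lemma cyl_shift: "cyl (translate i \<Lambda>) (shift i \<eta>) = shift (- i) -` cyl \<Lambda> \<eta>"
  by (auto simp: cyl_def shift_def)

lemma measurable_shift:
  "shift i \<in> borel_measurable (borel :: ('d::finite, 'q::{finite,discrete_topology}) config measure)"
proof -
  have "continuous_on UNIV (shift i :: ('d, 'q) config \<Rightarrow> _)"
    unfolding shift_def by (intro continuous_on_coordinatewise_then_product continuous_coordinate)
  then show ?thesis by (rule borel_measurable_continuous_onI)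
qed

lemma ti_measure_cyl:
  fixes \<nu> :: "('d::finite, 'q::{finite,discrete_topology}) config measure"
  assumes "\<nu> \<in> ti_measures" "finite \<Lambda>"
  shows "measure \<nu> (cyl (translate i \<Lambda>) (shift i \<eta>)) = measure \<nu> (cyl \<Lambda> \<eta>)"
proof -
  have \<nu>: "distr \<nu> borel (shift (- i)) = \<nu>" "sets \<nu> = sets borel"
    using assms(1) by (auto simp: ti_measures_def prob_measures_def)
  have "measure \<nu> (cyl \<Lambda> \<eta>) = measure (distr \<nu> borel (shift (- i))) (cyl \<Lambda> \<eta>)"
    by (simp add: \<nu>)
  also have "\<dots> = measure \<nu> (shift (- i) -` cyl \<Lambda> \<eta> \<inter> space \<nu>)"
    using \<nu>(2) measurable_shift assms(2)
    by (intro measure_distr) (auto cong: measurable_cong_sets)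
  finally show ?thesis
    using sets_eq_imp_space_eq[OF \<nu>(2)] by (simp add: cyl_shift)
qed

section \<open>Uniform bounds on the rates\<close>

locale ips =
  fixes c :: "('d::finite, 'q::{finite,discrete_topology}) rates"
    and P :: "('d, 'q) semigroup"
  assumes wd: "well_defined_ips c" and sg: "ips_semigroup c P" and ti: "ti_rates c"
    and types: "finitely_many_types c" and uc: "uniformly_continuous_rates c"
    and pos_min: "positive_min_rate c"
begin

lemma feller: "feller_semigroup P"
  using sg by (simp add: ips_semigroup_def)

lemma rate_nonneg: "\<Delta> \<in> fin_sets \<Longrightarrow> \<xi> \<in> \<Delta> \<rightarrow>\<^sub>E UNIV \<Longrightarrow> 0 \<le> c \<Delta> \<eta> \<xi>"
  using wd by (auto simp: well_defined_ips_def is_rates_def)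

lemma rate_continuous: "\<Delta> \<in> fin_sets \<Longrightarrow> \<xi> \<in> \<Delta> \<rightarrow>\<^sub>E UNIV \<Longrightarrow> continuous_on UNIV (\<lambda>\<eta>. c \<Delta> \<eta> \<xi>)"
  using wd by (auto simp: well_defined_ips_def is_rates_def)

lemma rate_shift:
  "\<Delta> \<in> fin_sets \<Longrightarrow> \<xi> \<in> \<Delta> \<rightarrow>\<^sub>E UNIV \<Longrightarrow> c (translate i \<Delta>) (shift i \<eta>) (shift i \<xi>) = c \<Delta> \<eta> \<xi>"
  using ti by (auto simp: ti_rates_def)

lemma rate_translate:
  assumes "\<Delta> \<in> fin_sets" "\<xi> \<in> translate i \<Delta> \<rightarrow>\<^sub>E UNIV"
  shows "shift (- i) \<xi> \<in> \<Delta> \<rightarrow>\<^sub>E UNIV"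
    and "c (translate i \<Delta>) \<eta> \<xi> = c \<Delta> (shift (- i) \<eta>) (shift (- i) \<xi>)"
proof -
  show 1: "shift (- i) \<xi> \<in> \<Delta> \<rightarrow>\<^sub>E UNIV"
    using assms(2) shift_PiE[of i "shift (- i) \<xi>" \<Delta>] by (simp add: shift_shift shift_0)
  show "c (translate i \<Delta>) \<eta> \<xi> = c \<Delta> (shift (- i) \<eta>) (shift (- i) \<xi>)"
    using rate_shift[OF assms(1) 1, of i "shift (- i) \<eta>"] by (simp add: shift_shift shift_0)
qed

section \<open>Active sets, their finitely many types, and uniform constants\<close>

definition active :: "'d site set \<Rightarrow> bool" where
  "active \<Delta> \<longleftrightarrow> \<Delta> \<in> fin_sets \<and> max_rate c \<Delta> > 0"

lemma active_fin: "active \<Delta> \<Longrightarrow> \<Delta> \<in> fin_sets" "active \<Delta> \<Longrightarrow> finite \<Delta>" "active \<Delta> \<Longrightarrow> \<Delta> \<noteq> {}"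
  by (auto simp: active_def fin_sets_def)

lemma finite_configs: "finite \<Delta> \<Longrightarrow> finite (\<Delta> \<rightarrow>\<^sub>E (UNIV :: 'q set))"
  by (simp add: finite_PiE)

text \<open>\<open>max_rate\<close> is a real supremum and bounds the total rate only if that is
  bounded above, which continuity on a compact space provides. The idle transition
  \<open>\<xi> = restrict \<eta> \<Delta>\<close> is excluded because \<open>total_rate\<close> does
  not count it.\<close>

lemma rate_inactive:
  assumes "\<Delta> \<in> fin_sets" "\<not> active \<Delta>" "\<xi> \<in> \<Delta> \<rightarrow>\<^sub>E UNIV" "\<xi> \<noteq> restrict \<eta> \<Delta>"
  shows "c \<Delta> \<eta> \<xi> = 0"
proof -
  have fin: "finite (\<Delta> \<rightarrow>\<^sub>E (UNIV :: 'q set))"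
    using assms(1) by (auto simp: fin_sets_def intro: finite_configs)
  have "continuous_on UNIV (\<lambda>\<eta>. \<Sum>\<xi>\<in>\<Delta> \<rightarrow>\<^sub>E UNIV. c \<Delta> \<eta> \<xi>)"
    using assms(1) by (intro continuous_on_sum rate_continuous)
  then obtain B where B: "\<bar>\<Sum>\<xi>\<in>\<Delta> \<rightarrow>\<^sub>E UNIV. c \<Delta> \<eta> \<xi>\<bar> \<le> B" for \<eta>
    using continuous_bounded_config by blast
  have "total_rate c \<Delta> \<eta> \<le> B" for \<eta>
  proof -
    have "total_rate c \<Delta> \<eta> \<le> (\<Sum>\<xi>\<in>\<Delta> \<rightarrow>\<^sub>E UNIV. c \<Delta> \<eta> \<xi>)"
      unfolding total_rate_def using fin assms(1) by (intro sum_mono2) (auto intro: rate_nonneg)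
    then show ?thesis using B[of \<eta>] by linarith
  qed
  then have bdd: "bdd_above (range (total_rate c \<Delta>))" by (rule bdd_aboveI2)
  have "c \<Delta> \<eta> \<xi> \<le> total_rate c \<Delta> \<eta>"
    unfolding total_rate_def using fin assms by (intro member_le_sum) (auto intro: rate_nonneg)
  also have "\<dots> \<le> max_rate c \<Delta>"
    unfolding max_rate_def using bdd by (rule cSUP_upper[OF UNIV_I])
  also have "\<dots> \<le> 0" using assms(1,2) by (simp add: active_def)
  finally show ?thesis using rate_nonneg[OF assms(1,3), of \<eta>] by linarith
qed

lemma total_rate_shift:
  assumes "\<Delta> \<in> fin_sets"
  shows "total_rate c (translate i \<Delta>) (shift i \<eta>) = total_rate c \<Delta> \<eta>"
proof -
  have r: "restrict (shift i \<eta>) (translate i \<Delta>) = shift i (restrict \<eta> \<Delta>)"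
    by (auto simp: restrict_def shift_def mem_translate)
  have inj: "inj (shift i :: ('d, 'q) config \<Rightarrow> _)"
    by (rule injI) (metis add.left_inverse shift_0 shift_shift)
  have "(translate i \<Delta> \<rightarrow>\<^sub>E UNIV) - {shift i (restrict \<eta> \<Delta>)} = shift i ` ((\<Delta> \<rightarrow>\<^sub>E UNIV) - {restrict \<eta> \<Delta>})"
    using bij_betw_imp_surj_on[OF bij_shift_PiE[of i \<Delta>, where 'b = 'q]] inj by (simp add: image_set_diff)
  then show ?thesis
    unfolding total_rate_def r
    using assms by (simp add: sum.reindex[OF inj_on_subset[OF inj subset_UNIV]] rate_shift)
qed

lemma active_translate: "active (translate i \<Delta>) \<longleftrightarrow> active \<Delta>"
proof (cases "\<Delta> \<in> fin_sets")
  case True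
  have "range (\<lambda>\<eta>. total_rate c (translate i \<Delta>) \<eta>) = range (\<lambda>\<eta>. total_rate c \<Delta> \<eta>)"
  proof (intro equalityI subsetI; clarify)
    fix \<eta>
    show "total_rate c (translate i \<Delta>) \<eta> \<in> range (\<lambda>\<eta>. total_rate c \<Delta> \<eta>)"
      using total_rate_shift[OF True, of i "shift (- i) \<eta>"] by (simp add: shift_shift shift_0)
    show "total_rate c \<Delta> \<eta> \<in> range (\<lambda>\<eta>. total_rate c (translate i \<Delta>) \<eta>)"
      using total_rate_shift[OF True, of i \<eta>] by (metis rangeI)
  qed
  then show ?thesis by (simp add: active_def fin_sets_translate max_rate_def)
qed (simp add: active_def fin_sets_translate)

text \<open>By translation invariance every uniform statement about active sets reduces to this
  finite family. Inactive members of the family given by the hypothesis are dropped, so that the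
  representatives are themselves finite, nonempty and of positive rate.\<close>

definition orbit_reps :: "'d site set set" where
  "orbit_reps = (SOME D. finite D \<and> (\<forall>\<Delta>\<in>D. active \<Delta>) \<and>
    (\<forall>\<Delta>. active \<Delta> \<longrightarrow> (\<exists>\<Delta>\<^sub>0\<in>D. \<exists>i. \<Delta> = translate i \<Delta>\<^sub>0)))"

lemma orbit_reps:
  "finite orbit_reps \<and> (\<forall>\<Delta>\<in>orbit_reps. active \<Delta>) \<and>
    (\<forall>\<Delta>. active \<Delta> \<longrightarrow> (\<exists>\<Delta>\<^sub>0\<in>orbit_reps. \<exists>i. \<Delta> = translate i \<Delta>\<^sub>0))"
proof -
  obtain D where D: "finite D"
    "\<forall>\<Delta>\<in>fin_sets. max_rate c \<Delta> > 0 \<longrightarrow> (\<exists>\<Delta>\<^sub>0\<in>D. \<exists>i. \<Delta> = translate i \<Delta>\<^sub>0)"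
    using types unfolding finitely_many_types_def by (elim exE conjE)
  have reps: "\<exists>\<Delta>\<^sub>0\<in>{\<Delta> \<in> D. active \<Delta>}. \<exists>i. \<Delta> = translate i \<Delta>\<^sub>0" if \<Delta>: "active \<Delta>" for \<Delta>
  proof -
    have "\<Delta> \<in> fin_sets" "max_rate c \<Delta> > 0" using \<Delta> by (auto simp: active_def)
    from D(2)[THEN bspec, OF this(1), THEN mp, OF this(2)]
    obtain \<Delta>\<^sub>0 i where \<Delta>\<^sub>0: "\<Delta>\<^sub>0 \<in> D" "\<Delta> = translate i \<Delta>\<^sub>0"
      by (elim bexE exE)
    moreover have "active \<Delta>\<^sub>0" using \<Delta> unfolding \<Delta>\<^sub>0(2) active_translate .
    ultimately show ?thesis by (intro bexI[of _ \<Delta>\<^sub>0] exI[of _ i]) simp_all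
  qed
  show ?thesis
    unfolding orbit_reps_def
    by (rule someI[of _ "{\<Delta> \<in> D. active \<Delta>}"], intro conjI allI impI ballI reps)
      (use D(1) in simp_all)
qed

lemmas finite_orbit_reps = orbit_reps[THEN conjunct1]
  and orbit_reps_active = orbit_reps[THEN conjunct2, THEN conjunct1, THEN bspec]

lemma active_cases:
  assumes "active \<Delta>"
  obtains \<Delta>\<^sub>0 i where "\<Delta>\<^sub>0 \<in> orbit_reps" "\<Delta> = translate i \<Delta>\<^sub>0"
  using orbit_reps[THEN conjunct2, THEN conjunct2, THEN spec, THEN mp, OF assms]
  by (elim bexE exE)

text \<open>Differences of points of a set do not change under translation, so only the differences
  within the representatives have to be enclosed.\<close>

lemma range_bound: "\<exists>R. \<forall>\<Delta> x y. active \<Delta> \<longrightarrow> x \<in> \<Delta> \<longrightarrow> y \<in> \<Delta> \<longrightarrow> y - x \<in> cube R"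
proof -
  have "finite (\<Union>\<Delta>\<in>orbit_reps. (\<lambda>(x, y). y - x) ` (\<Delta> \<times> \<Delta>))"
    using finite_orbit_reps orbit_reps_active active_fin(2) by auto
  then obtain R where R: "(\<Union>\<Delta>\<in>orbit_reps. (\<lambda>(x, y). y - x) ` (\<Delta> \<times> \<Delta>)) \<subseteq> cube R"
    using finite_subset_cube by blast
  have "y - x \<in> cube R" if xy: "active \<Delta>" "x \<in> \<Delta>" "y \<in> \<Delta>" for \<Delta> x y
  proof -
    obtain \<Delta>\<^sub>0 i where \<Delta>\<^sub>0: "\<Delta>\<^sub>0 \<in> orbit_reps" "\<Delta> = translate i \<Delta>\<^sub>0" by (rule active_cases[OF xy(1)])
    then have "x - i \<in> \<Delta>\<^sub>0" "y - i \<in> \<Delta>\<^sub>0" using xy by (simp_all add: mem_translate)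
    then have "(y - i) - (x - i) \<in> cube R" using R \<Delta>\<^sub>0(1) by blast
    then show ?thesis by simp
  qed
  then show ?thesis by blast
qed

text \<open>A translate of a representative \<open>\<Delta>\<^sub>0\<close> contains x only if the
  translation carries some z of \<open>\<Delta>\<^sub>0\<close> to x, which leaves as many choices
  as \<open>\<Delta>\<^sub>0\<close> has points.\<close>

lemma active_count:
  "\<exists>N. \<forall>x. finite {\<Delta>. active \<Delta> \<and> x \<in> \<Delta>} \<and> card {\<Delta>. active \<Delta> \<and> x \<in> \<Delta>} \<le> N"
proof -
  define S where "S x = (\<Union>\<Delta>\<in>orbit_reps. (\<lambda>z. translate (x - z) \<Delta>) ` \<Delta>)" for x
  have sub: "{\<Delta>. active \<Delta> \<and> x \<in> \<Delta>} \<subseteq> S x" for x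
  proof clarify
    fix \<Delta> assume act: "active \<Delta>" and "x \<in> \<Delta>"
    obtain \<Delta>\<^sub>0 i where \<Delta>\<^sub>0: "\<Delta>\<^sub>0 \<in> orbit_reps" "\<Delta> = translate i \<Delta>\<^sub>0" by (rule active_cases[OF act])
    then have "x - i \<in> \<Delta>\<^sub>0" "\<Delta> = translate (x - (x - i)) \<Delta>\<^sub>0"
      using \<open>x \<in> \<Delta>\<close> by (simp_all add: mem_translate)
    with \<Delta>\<^sub>0(1) show "\<Delta> \<in> S x" unfolding S_def by blast
  qed
  have fin: "finite (S x)" for x unfolding S_def using finite_orbit_reps orbit_reps_active active_fin(2) by auto
  have "card (S x) \<le> (\<Sum>\<Delta>\<in>orbit_reps. card \<Delta>)" for x
    unfolding S_def using finite_orbit_reps orbit_reps_active active_fin(2)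
    by (intro order_trans[OF card_UN_le] sum_mono card_image_le) auto
  with card_mono[OF fin sub] finite_subset[OF sub fin] show ?thesis by (meson order_trans)
qed

lemma rate_bound:
  "\<exists>K>0. \<forall>\<Delta> \<eta>. active \<Delta> \<longrightarrow> (\<forall>\<xi> \<in> \<Delta> \<rightarrow>\<^sub>E UNIV. c \<Delta> \<eta> \<xi> \<le> K)"
proof -
  have "\<exists>B. \<forall>\<eta>. \<bar>c \<Delta> \<eta> \<xi>\<bar> \<le> B" if "active \<Delta>" "\<xi> \<in> \<Delta> \<rightarrow>\<^sub>E UNIV" for \<Delta> \<xi>
    using continuous_bounded_config[OF rate_continuous[OF active_fin(1)[OF that(1)] that(2)]] by metis
  then obtain B where B: "\<And>\<Delta> \<xi> \<eta>. active \<Delta> \<Longrightarrow> \<xi> \<in> \<Delta> \<rightarrow>\<^sub>E UNIV \<Longrightarrow> \<bar>c \<Delta> \<eta> \<xi>\<bar> \<le> B \<Delta> \<xi>"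
    by metis
  \<comment> \<open>Sums replace maxima over the representatives; the summand 1 keeps K positive
    even if there are none.\<close>
  define K where "K = (\<Sum>\<Delta>\<in>orbit_reps. \<Sum>\<xi> \<in> \<Delta> \<rightarrow>\<^sub>E UNIV. \<bar>B \<Delta> \<xi>\<bar>) + 1"
  have "c \<Delta> \<eta> \<xi> \<le> K" if act: "active \<Delta>" and \<xi>: "\<xi> \<in> \<Delta> \<rightarrow>\<^sub>E UNIV" for \<Delta> \<eta> \<xi>
  proof -
    obtain \<Delta>\<^sub>0 i where \<Delta>\<^sub>0: "\<Delta>\<^sub>0 \<in> orbit_reps" "\<Delta> = translate i \<Delta>\<^sub>0" by (rule active_cases[OF act])
    note * = orbit_reps_active[OF \<Delta>\<^sub>0(1)] rate_translate[OF active_fin(1)[OF orbit_reps_active[OF \<Delta>\<^sub>0(1)]] \<xi>[unfolded \<Delta>\<^sub>0(2)]]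
    have "c \<Delta> \<eta> \<xi> \<le> \<bar>B \<Delta>\<^sub>0 (shift (- i) \<xi>)\<bar>"
      using B[OF *(1,2), of "shift (- i) \<eta>"] *(3)[of \<eta>] \<Delta>\<^sub>0(2) by simp
    also have "\<dots> \<le> (\<Sum>\<xi> \<in> \<Delta>\<^sub>0 \<rightarrow>\<^sub>E UNIV. \<bar>B \<Delta>\<^sub>0 \<xi>\<bar>)"
      using *(2) finite_configs[OF active_fin(2)[OF *(1)]] by (intro member_le_sum) auto
    also have "\<dots> \<le> (\<Sum>\<Delta>\<in>orbit_reps. \<Sum>\<xi> \<in> \<Delta> \<rightarrow>\<^sub>E UNIV. \<bar>B \<Delta> \<xi>\<bar>)"
      using finite_orbit_reps \<Delta>\<^sub>0(1) by (intro member_le_sum[of _ _ "\<lambda>\<Delta>. \<Sum>\<xi> \<in> \<Delta> \<rightarrow>\<^sub>E UNIV. \<bar>B \<Delta> \<xi>\<bar>"]) (auto intro: sum_nonneg)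
    finally show ?thesis by (simp add: K_def)
  qed
  moreover have "K > 0" unfolding K_def by (smt (verit) sum_nonneg abs_ge_zero)
  ultimately show ?thesis by blast
qed

lemma rate_min:
  "\<exists>\<kappa>>0. \<forall>\<Delta> \<eta>. active \<Delta> \<longrightarrow> (\<forall>\<xi> \<in> \<Delta> \<rightarrow>\<^sub>E UNIV. c \<Delta> \<eta> \<xi> > 0 \<longrightarrow> \<kappa> \<le> c \<Delta> \<eta> \<xi>)"
proof -
  define m where "m \<Delta> = (INF (\<eta>, \<xi>)\<in>{(\<eta>, \<xi>). \<xi> \<in> \<Delta> \<rightarrow>\<^sub>E UNIV \<and> c \<Delta> \<eta> \<xi> > 0}. c \<Delta> \<eta> \<xi>)" for \<Delta>
  have m_pos: "m \<Delta> > 0" if "active \<Delta>" for \<Delta>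
    using pos_min that unfolding positive_min_rate_def m_def active_def by blast
  have m_le: "m \<Delta> \<le> c \<Delta> \<eta> \<xi>" if "\<xi> \<in> \<Delta> \<rightarrow>\<^sub>E UNIV" "c \<Delta> \<eta> \<xi> > 0" for \<Delta> \<eta> \<xi>
  proof -
    let ?S = "{(\<eta>, \<xi>). \<xi> \<in> \<Delta> \<rightarrow>\<^sub>E UNIV \<and> c \<Delta> \<eta> \<xi> > 0}"
    have "bdd_below ((\<lambda>(\<eta>, \<xi>). c \<Delta> \<eta> \<xi>) ` ?S)"
      by (rule bdd_belowI[of _ 0]) auto
    moreover have "(\<eta>, \<xi>) \<in> ?S" using that by simp
    ultimately show ?thesis unfolding m_def by (metis (no_types, lifting) cINF_lower case_prod_conv)
  qed
  \<comment> \<open>The inserted 1 keeps the minimum well defined if there is no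
    representative.\<close>
  define \<kappa> where "\<kappa> = Min (insert 1 (m ` orbit_reps))"
  have \<kappa>: "\<kappa> > 0" unfolding \<kappa>_def using finite_orbit_reps orbit_reps_active m_pos by (subst Min_gr_iff) auto
  have "\<kappa> \<le> c \<Delta> \<eta> \<xi>" if act: "active \<Delta>" and \<xi>: "\<xi> \<in> \<Delta> \<rightarrow>\<^sub>E UNIV" and pos: "c \<Delta> \<eta> \<xi> > 0" for \<Delta> \<eta> \<xi>
  proof -
    obtain \<Delta>\<^sub>0 i where \<Delta>\<^sub>0: "\<Delta>\<^sub>0 \<in> orbit_reps" "\<Delta> = translate i \<Delta>\<^sub>0" by (rule active_cases[OF act])
    note * = rate_translate[OF active_fin(1)[OF orbit_reps_active[OF \<Delta>\<^sub>0(1)]] \<xi>[unfolded \<Delta>\<^sub>0(2)]]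
    have "\<kappa> \<le> m \<Delta>\<^sub>0" unfolding \<kappa>_def using finite_orbit_reps \<Delta>\<^sub>0(1) by (intro Min_le) auto
    also have "\<dots> \<le> c \<Delta>\<^sub>0 (shift (- i) \<eta>) (shift (- i) \<xi>)"
      using *(1) pos *(2)[of \<eta>] \<Delta>\<^sub>0(2) by (intro m_le) auto
    finally show ?thesis using *(2)[of \<eta>] \<Delta>\<^sub>0(2) by simp
  qed
  with \<kappa> show ?thesis by blast
qed

text \<open>The continuity hypothesis concerns sets containing the origin. Translating by any point
  x of \<Delta> moves its window to x, with one radius r for all sets and all their points.\<close>

lemma rate_local:
  assumes "\<epsilon> > 0"
  shows "\<exists>r. \<forall>\<Delta>\<in>fin_sets. \<forall>x\<in>\<Delta>. \<forall>\<xi> \<in> \<Delta> \<rightarrow>\<^sub>E UNIV. \<forall>\<eta> \<eta>'.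
    (\<forall>y. y - x \<in> cube r \<longrightarrow> \<eta> y = \<eta>' y) \<longrightarrow> \<bar>c \<Delta> \<eta> \<xi> - c \<Delta> \<eta>' \<xi>\<bar> \<le> \<epsilon>"
proof -
  let ?F = "\<lambda>\<Lambda>. SUP \<Delta>\<in>{\<Delta>\<in>fin_sets. 0 \<in> \<Delta>}. SUP (\<eta>, \<xi>, \<sigma>)\<in>UNIV \<times> (\<Delta> \<rightarrow>\<^sub>E UNIV) \<times> UNIV.
         ennreal \<bar>c \<Delta> (override_on \<sigma> \<eta> \<Lambda>) \<xi> - c \<Delta> \<eta> \<xi>\<bar>"
  have "eventually (\<lambda>\<Lambda>. ?F \<Lambda> < ennreal \<epsilon>) (finite_subsets_at_top UNIV)"
    using uc assms unfolding uniformly_continuous_rates_def by (intro order_tendstoD(2)) auto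
  then obtain X where X: "finite X" "\<And>Y. finite Y \<Longrightarrow> X \<subseteq> Y \<Longrightarrow> ?F Y < ennreal \<epsilon>"
    unfolding eventually_finite_subsets_at_top by auto
  obtain r where "X \<subseteq> cube r" using finite_subset_cube[OF X(1)] by blast
  then have r: "?F (cube r) < ennreal \<epsilon>" using X(2) by simp
  have main: "\<bar>c \<Delta> \<eta>' \<xi> - c \<Delta> \<eta> \<xi>\<bar> \<le> \<epsilon>"
    if "\<Delta> \<in> fin_sets" "0 \<in> \<Delta>" "\<xi> \<in> \<Delta> \<rightarrow>\<^sub>E UNIV" "\<forall>y\<in>cube r. \<eta> y = \<eta>' y" for \<Delta> \<xi> \<eta> \<eta>'
  proof -
    \<comment> \<open>Taking \<eta>' itself as the boundary configuration \<sigma> turns the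
      hypothesis into a comparison of two configurations agreeing on the cube.\<close>
    have eq: "override_on \<eta>' \<eta> (cube r) = \<eta>'" using that(4) by (auto simp: override_on_def)
    have "ennreal \<bar>c \<Delta> \<eta>' \<xi> - c \<Delta> \<eta> \<xi>\<bar>
      \<le> (SUP (\<eta>, \<xi>, \<sigma>)\<in>UNIV \<times> (\<Delta> \<rightarrow>\<^sub>E UNIV) \<times> UNIV.
         ennreal \<bar>c \<Delta> (override_on \<sigma> \<eta> (cube r)) \<xi> - c \<Delta> \<eta> \<xi>\<bar>)"
      using that(3) by (intro SUP_upper2[of "(\<eta>, \<xi>, \<eta>')"]) (auto simp: eq)
    also have "\<dots> \<le> ?F (cube r)"
      using that(1,2) by (intro SUP_upper) auto
    also note r
    finally show ?thesis using assms by (simp add: ennreal_less_iff)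
  qed
  have "\<bar>c \<Delta> \<eta> \<xi> - c \<Delta> \<eta>' \<xi>\<bar> \<le> \<epsilon>"
    if \<Delta>: "\<Delta> \<in> fin_sets" and x: "x \<in> \<Delta>" and \<xi>: "\<xi> \<in> \<Delta> \<rightarrow>\<^sub>E UNIV"
      and eq: "\<forall>y. y - x \<in> cube r \<longrightarrow> \<eta> y = \<eta>' y" for \<Delta> x \<xi> \<eta> \<eta>'
  proof -
    have "\<bar>c (translate (- x) \<Delta>) (shift (- x) \<eta>) (shift (- x) \<xi>)
        - c (translate (- x) \<Delta>) (shift (- x) \<eta>') (shift (- x) \<xi>)\<bar> \<le> \<epsilon>"
    proof (rule main)
      show "translate (- x) \<Delta> \<in> fin_sets" by (rule fin_sets_translate[THEN iffD2, OF \<Delta>])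
      show "0 \<in> translate (- x) \<Delta>" using x by (simp add: mem_translate)
      show "shift (- x) \<xi> \<in> translate (- x) \<Delta> \<rightarrow>\<^sub>E UNIV" by (rule shift_PiE[THEN iffD2, OF \<xi>])
      show "\<forall>y\<in>cube r. shift (- x) \<eta>' y = shift (- x) \<eta> y" using eq by (simp add: shift_def)
    qed
    then show ?thesis by (simp only: rate_shift[OF \<Delta> \<xi>])
  qed
  then show ?thesis by blast
qed

section \<open>The generator on local functions\<close>

definition act :: "'d site set \<Rightarrow> 'd site set set" where
  "act \<Lambda> = {\<Delta>. active \<Delta> \<and> \<Delta> \<inter> \<Lambda> \<noteq> {}}"

lemma finite_act: "finite \<Lambda> \<Longrightarrow> finite (act \<Lambda>)"
proof -
  assume "finite \<Lambda>"
  moreover have "act \<Lambda> = (\<Union>x\<in>\<Lambda>. {\<Delta>. active \<Delta> \<and> x \<in> \<Delta>})" by (auto simp: act_def)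
  ultimately show ?thesis using active_count by auto
qed

text \<open>Sets disjoint from \<Lambda> do not change f, and inactive sets allow at most the idle
  transition; what remains of the infinite sum is finite.\<close>

lemma generator_local:
  assumes \<Lambda>: "finite \<Lambda>" "\<And>\<eta> \<zeta>. (\<forall>x\<in>\<Lambda>. \<eta> x = \<zeta> x) \<Longrightarrow> f \<eta> = f \<zeta>"
  shows "ips_generator c f \<eta> =
    (\<Sum>\<Delta>\<in>act \<Lambda>. \<Sum>\<xi> \<in> \<Delta> \<rightarrow>\<^sub>E UNIV. c \<Delta> \<eta> \<xi> * (f (override_on \<eta> \<xi> \<Delta>) - f \<eta>))"
proof -
  let ?T = "\<lambda>\<Delta>. \<Sum>\<xi> \<in> \<Delta> \<rightarrow>\<^sub>E UNIV. c \<Delta> \<eta> \<xi> * (f (override_on \<eta> \<xi> \<Delta>) - f \<eta>)"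
  have "?T \<Delta> = 0" if "\<Delta> \<in> fin_sets" "\<Delta> \<notin> act \<Lambda>" for \<Delta>
  proof (rule sum.neutral, rule ballI)
    fix \<xi> :: "('d, 'q) config" assume \<xi>: "\<xi> \<in> \<Delta> \<rightarrow>\<^sub>E UNIV"
    show "c \<Delta> \<eta> \<xi> * (f (override_on \<eta> \<xi> \<Delta>) - f \<eta>) = 0"
    proof (cases "active \<Delta> \<and> \<xi> \<noteq> restrict \<eta> \<Delta>")
      case True
      then have "f (override_on \<eta> \<xi> \<Delta>) = f \<eta>"
        using that by (intro \<Lambda>(2)) (auto simp: act_def override_on_def)
      then show ?thesis by simp
    next
      case False
      moreover have "override_on \<eta> \<xi> \<Delta> = \<eta>" if "\<xi> = restrict \<eta> \<Delta>"
        using that by (auto simp: override_on_def)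
      ultimately show ?thesis
        using rate_inactive[OF that(1) _ \<xi>, of \<eta>] by (cases "\<xi> = restrict \<eta> \<Delta>") simp_all
    qed
  qed
  then have "ips_generator c f \<eta> = (\<Sum>\<^sub>\<infinity>\<Delta>\<in>act \<Lambda>. ?T \<Delta>)"
    unfolding ips_generator_def
    by (intro infsum_cong_neutral) (auto simp: act_def active_fin)
  then show ?thesis using finite_act[OF \<Lambda>(1)] by simp
qed

lemma continuous_override:
  "continuous_on UNIV (\<lambda>\<eta> :: ('d, 'q) config. override_on \<eta> \<xi> \<Delta>)"
  unfolding override_on_def
proof (rule continuous_on_coordinatewise_then_product)
  show "continuous_on UNIV (\<lambda>\<eta> :: ('d, 'q) config. if x \<in> \<Delta> then \<xi> x else \<eta> x)" for x
    by (cases "x \<in> \<Delta>") (simp_all add: continuous_coordinate)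
qed

lemma continuous_generator_local:
  assumes "local_function f"
  shows "continuous_on UNIV (ips_generator c f)"
proof -
  obtain \<Lambda> where \<Lambda>: "finite \<Lambda>" "\<And>\<eta> \<zeta>. (\<forall>x\<in>\<Lambda>. \<eta> x = \<zeta> x) \<Longrightarrow> f \<eta> = f \<zeta>"
    using assms unfolding local_function_def by metis
  note [continuous_intros] = continuous_on_compose2[OF continuous_local[OF assms] continuous_override]
    continuous_local[OF assms]
  have "ips_generator c f = (\<lambda>\<eta>.
      \<Sum>\<Delta>\<in>act \<Lambda>. \<Sum>\<xi> \<in> \<Delta> \<rightarrow>\<^sub>E UNIV. c \<Delta> \<eta> \<xi> * (f (override_on \<eta> \<xi> \<Delta>) - f \<eta>))"
    by (rule ext, rule generator_local) (fact \<Lambda>)+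
  then show ?thesis
    by (simp only:) (intro continuous_intros rate_continuous; simp add: act_def active_fin)
qed

text \<open>Local functions lie in the pregenerator, hence in its closure, which is the generator of
  the semigroup.\<close>

lemma generator_derivative:
  assumes f: "local_function f" and \<nu>: "\<nu> \<in> prob_measures" and t: "0 \<le> t"
  shows "((\<lambda>t. \<integral>\<omega>. f \<omega> \<partial>(evolve P t \<nu>)) has_real_derivative
    (\<integral>\<omega>. ips_generator c f \<omega> \<partial>(evolve P t \<nu>))) (at t within {0..})"
proof -
  have eq: "apply_bcontfun (Bcontfun f) = f" "apply_bcontfun (Bcontfun (ips_generator c f)) = ips_generator c f"
    using f by (auto intro!: apply_Bcontfun_continuous continuous_local continuous_generator_local)
  then have "(Bcontfun f, Bcontfun (ips_generator c f)) \<in> pregenerator_graph c"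
    using f by (simp add: pregenerator_graph_def)
  then have "(Bcontfun f, Bcontfun (ips_generator c f)) \<in> infinitesimal_generator P"
    using sg closure_subset unfolding ips_semigroup_def by blast
  from evolve_derivative[OF feller this t \<nu>] show ?thesis by (simp add: eq)
qed

end

section \<open>Cylinder probabilities\<close>

text \<open>Sets that do not separate configurations agreeing on S are closed under complements and
  countable unions, so induction over the generated \<sigma>-algebra applies.\<close>

lemma coord_algebra_determined:
  fixes A :: "('d::finite, 'q) config set"
  assumes "A \<in> sets (coord_algebra S)" "\<And>x. x \<in> S \<Longrightarrow> \<omega> x = \<omega>' x"
  shows "\<omega> \<in> A \<longleftrightarrow> \<omega>' \<in> A"
proof -
  have "A \<in> sigma_sets UNIV {{\<omega>. \<omega> x = a} |x a. x \<in> S}"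
    using assms(1) by (simp add: coord_algebra_def)
  then show ?thesis by induction (use assms(2) in auto)
qed

lemma space_coord_algebra [simp]: "space (coord_algebra S) = UNIV"
  by (simp add: coord_algebra_def space_measure_of_conv)

lemma cyl_in_coord_algebra:
  assumes "finite \<Lambda>" "\<Lambda> \<subseteq> S"
  shows "cyl \<Lambda> \<eta> \<in> sets (coord_algebra S)"
proof -
  have "cyl \<Lambda> \<eta> = (\<Inter>x\<in>\<Lambda>. {\<omega>. \<omega> x = \<eta> x}) \<inter> space (coord_algebra S)" by (auto simp: cyl_def)
  moreover have "{\<omega>. \<omega> x = \<eta> x} \<in> sets (coord_algebra S)" if "x \<in> \<Lambda>" for x
    using that assms(2) unfolding coord_algebra_def by (subst sets_measure_of) auto
  ultimately show ?thesis
    using assms(1) sets.finite_INT[of \<Lambda> "\<lambda>x. {\<omega>. \<omega> x = \<eta> x}" "coord_algebra S"]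
      sets.top[of "coord_algebra S"]
    by (cases "\<Lambda> = {}") auto
qed

lemma coord_algebra_subalgebra:
  fixes \<nu> :: "('d::finite, 'q::{finite,discrete_topology}) config measure"
  assumes "sets \<nu> = sets borel"
  shows "subalgebra \<nu> (coord_algebra S)"
proof -
  have "{{\<omega> :: ('d, 'q) config. \<omega> x = a} |x a. x \<in> S} \<subseteq> sets borel"
  proof clarify
    fix x :: "'d site" and a :: 'q
    have "{\<omega>. \<omega> x = a} = cyl {x} (\<lambda>_. a)" by (auto simp: cyl_def)
    then show "{\<omega>. \<omega> x = a} \<in> sets borel" by simp
  qed
  from sets.sigma_sets_subset[OF this]
  have "sets (coord_algebra S) \<subseteq> sets (borel :: ('d, 'q) config measure)"
    by (simp add: coord_algebra_def)
  then show ?thesis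
    using assms sets_eq_imp_space_eq[OF assms] by (simp add: subalgebra_def)
qed

lemma prob_measuresD:
  assumes "\<nu> \<in> prob_measures"
  shows "prob_space \<nu>" "sets \<nu> = sets borel" "space \<nu> = UNIV"
  using assms sets_eq_imp_space_eq[of \<nu> borel] by (auto simp: prob_measures_def)

lemma override_on_inj_PiE:
  assumes "\<Delta> \<subseteq> \<Lambda>" "\<sigma> \<in> \<Delta> \<rightarrow>\<^sub>E UNIV" "\<tau> \<in> \<Delta> \<rightarrow>\<^sub>E UNIV" "\<omega> \<in> cyl \<Lambda> (override_on \<eta> \<sigma> \<Delta>)"
    "\<omega> \<in> cyl \<Lambda> (override_on \<eta> \<tau> \<Delta>)"
  shows "\<sigma> = \<tau>"
proof (rule PiE_ext[OF assms(2,3)])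
  fix x assume "x \<in> \<Delta>"
  with assms(1) have "x \<in> \<Lambda>" by blast
  then have "\<omega> x = override_on \<eta> \<sigma> \<Delta> x" "\<omega> x = override_on \<eta> \<tau> \<Delta> x"
    using assms(4,5) unfolding cyl_def by blast+
  with \<open>x \<in> \<Delta>\<close> show "\<sigma> x = \<tau> x" by simp
qed

lemma measure_cyl_split:
  fixes \<nu> :: "('d::finite, 'q::{finite,discrete_topology}) config measure"
  assumes "\<nu> \<in> prob_measures" "finite \<Lambda>" "\<Delta> \<subseteq> \<Lambda>"
  shows "measure \<nu> (cyl (\<Lambda> - \<Delta>) \<eta>)
    = (\<Sum>\<sigma> \<in> \<Delta> \<rightarrow>\<^sub>E UNIV. measure \<nu> (cyl \<Lambda> (override_on \<eta> \<sigma> \<Delta>)))"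
proof -
  interpret prob_space \<nu> using assms by (simp add: prob_measures_def)
  have fin: "finite (\<Delta> \<rightarrow>\<^sub>E (UNIV :: 'q set))"
    by (intro finite_PiE finite_subset[OF assms(3,2)]) simp
  have "cyl (\<Lambda> - \<Delta>) \<eta> = (\<Union>\<sigma> \<in> \<Delta> \<rightarrow>\<^sub>E UNIV. cyl \<Lambda> (override_on \<eta> \<sigma> \<Delta>))"
  proof (intro equalityI subsetI)
    fix \<omega> assume "\<omega> \<in> cyl (\<Lambda> - \<Delta>) \<eta>"
    then have "\<omega> \<in> cyl \<Lambda> (override_on \<eta> (restrict \<omega> \<Delta>) \<Delta>)"
      by (auto simp: cyl_def override_on_def)
    then show "\<omega> \<in> (\<Union>\<sigma> \<in> \<Delta> \<rightarrow>\<^sub>E UNIV. cyl \<Lambda> (override_on \<eta> \<sigma> \<Delta>))"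
      by (intro UN_I[of "restrict \<omega> \<Delta>"]) auto
  qed (auto simp: cyl_def override_on_def)
  moreover have "disjoint_family_on (\<lambda>\<sigma>. cyl \<Lambda> (override_on \<eta> \<sigma> \<Delta>)) (\<Delta> \<rightarrow>\<^sub>E UNIV)"
    unfolding disjoint_family_on_def
  proof (intro ballI impI)
    fix \<sigma> \<tau> :: "('d, 'q) config"
    assume "\<sigma> \<in> \<Delta> \<rightarrow>\<^sub>E UNIV" "\<tau> \<in> \<Delta> \<rightarrow>\<^sub>E UNIV" "\<sigma> \<noteq> \<tau>"
    with override_on_inj_PiE[OF assms(3) this(1,2)]
    show "cyl \<Lambda> (override_on \<eta> \<sigma> \<Delta>) \<inter> cyl \<Lambda> (override_on \<eta> \<tau> \<Delta>) = {}" by blast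
  qed
  moreover have "(\<lambda>\<sigma>. cyl \<Lambda> (override_on \<eta> \<sigma> \<Delta>)) ` (\<Delta> \<rightarrow>\<^sub>E UNIV) \<subseteq> events"
    using assms(2) prob_measuresD(2)[OF assms(1)] by auto
  ultimately show ?thesis
    using finite_measure_finite_Union[OF fin] by simp
qed

lemma sum_configs_split:
  fixes F :: "('d::finite, 'q::finite) config \<Rightarrow> real"
  assumes "\<Delta> \<subseteq> \<Lambda>"
  shows "(\<Sum>\<omega> \<in> \<Lambda> \<rightarrow>\<^sub>E UNIV. F \<omega>)
    = (\<Sum>\<omega> \<in> (\<Lambda> - \<Delta>) \<rightarrow>\<^sub>E UNIV. \<Sum>\<sigma> \<in> \<Delta> \<rightarrow>\<^sub>E UNIV. F (override_on \<omega> \<sigma> \<Delta>))"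
proof -
  have "(\<Sum>\<omega> \<in> \<Lambda> \<rightarrow>\<^sub>E UNIV. F \<omega>)
      = (\<Sum>(\<omega>, \<sigma>) \<in> ((\<Lambda> - \<Delta>) \<rightarrow>\<^sub>E UNIV) \<times> (\<Delta> \<rightarrow>\<^sub>E UNIV). F (override_on \<omega> \<sigma> \<Delta>))"
  proof (rule sum.reindex_bij_witness[of _ "\<lambda>p. override_on (fst p) (snd p) \<Delta>"
        "\<lambda>\<omega>. (restrict \<omega> (\<Lambda> - \<Delta>), restrict \<omega> \<Delta>)"])
    fix \<omega> :: "('d, 'q) config" assume \<omega>: "\<omega> \<in> \<Lambda> \<rightarrow>\<^sub>E UNIV"
    have *: "override_on (restrict \<omega> (\<Lambda> - \<Delta>)) (restrict \<omega> \<Delta>) \<Delta> = \<omega>"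
    proof
      fix x show "override_on (restrict \<omega> (\<Lambda> - \<Delta>)) (restrict \<omega> \<Delta>) \<Delta> x = \<omega> x"
        using PiE_arb[OF \<omega>, of x] by (simp add: override_on_def)
    qed
    then show "override_on (fst (restrict \<omega> (\<Lambda> - \<Delta>), restrict \<omega> \<Delta>)) (snd (restrict \<omega> (\<Lambda> - \<Delta>), restrict \<omega> \<Delta>)) \<Delta> = \<omega>"
      by simp
    from * show "(case (restrict \<omega> (\<Lambda> - \<Delta>), restrict \<omega> \<Delta>) of (\<omega>, \<sigma>) \<Rightarrow> F (override_on \<omega> \<sigma> \<Delta>)) = F \<omega>"
      by simp
  next
    fix b :: "('d, 'q) config \<times> ('d, 'q) config"
    assume b: "b \<in> ((\<Lambda> - \<Delta>) \<rightarrow>\<^sub>E UNIV) \<times> (\<Delta> \<rightarrow>\<^sub>E UNIV)"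
    have *: "fst b x = undefined" if "x \<notin> \<Lambda> - \<Delta>" for x
      using b that by (intro PiE_arb[of "fst b" "\<Lambda> - \<Delta>" "\<lambda>_. UNIV"]) auto
    have **: "snd b x = undefined" if "x \<notin> \<Delta>" for x
      using b that by (intro PiE_arb[of "snd b" "\<Delta>" "\<lambda>_. UNIV"]) auto
    show "(restrict (override_on (fst b) (snd b) \<Delta>) (\<Lambda> - \<Delta>), restrict (override_on (fst b) (snd b) \<Delta>) \<Delta>) = b"
    proof (rule prod_eqI; rule ext)
      fix x
      show "fst (restrict (override_on (fst b) (snd b) \<Delta>) (\<Lambda> - \<Delta>), restrict (override_on (fst b) (snd b) \<Delta>) \<Delta>) x = fst b x"
        using *[of x] by (auto simp: override_on_def)
      show "snd (restrict (override_on (fst b) (snd b) \<Delta>) (\<Lambda> - \<Delta>), restrict (override_on (fst b) (snd b) \<Delta>) \<Delta>) x = snd b x"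
        using **[of x] by (auto simp: override_on_def)
    qed
    show "override_on (fst b) (snd b) \<Delta> \<in> \<Lambda> \<rightarrow>\<^sub>E UNIV"
      using assms * by (auto simp: override_on_def PiE_iff extensional_def)
  qed (auto simp: PiE_iff)
  then show ?thesis by (simp add: sum.cartesian_product)
qed

lemma sum_measure_cyl:
  fixes \<nu> :: "('d::finite, 'q::{finite,discrete_topology}) config measure"
  assumes "\<nu> \<in> prob_measures" "finite \<Lambda>"
  shows "(\<Sum>\<sigma> \<in> \<Lambda> \<rightarrow>\<^sub>E UNIV. measure \<nu> (cyl \<Lambda> \<sigma>)) = 1"
proof -
  interpret prob_space \<nu> using assms by (simp add: prob_measures_def)
  have "(\<Sum>\<sigma> \<in> \<Lambda> \<rightarrow>\<^sub>E UNIV. measure \<nu> (cyl \<Lambda> \<sigma>))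
      = (\<Sum>\<sigma> \<in> \<Lambda> \<rightarrow>\<^sub>E UNIV. measure \<nu> (cyl \<Lambda> (override_on undefined \<sigma> \<Lambda>)))"
    by (intro sum.cong refl arg_cong[where f = "measure \<nu>"] cyl_cong) (simp add: override_on_def)
  also have "\<dots> = 1"
    using measure_cyl_split[OF assms(1,2) order_refl, of undefined] prob_space
      prob_measuresD(3)[OF assms(1)] by simp
  finally show ?thesis .
qed

lemma measure_cyl_mono:
  fixes \<nu> :: "('d::finite, 'q::{finite,discrete_topology}) config measure"
  assumes "\<nu> \<in> prob_measures" "finite \<Lambda>" "\<Lambda>' \<subseteq> \<Lambda>"
  shows "measure \<nu> (cyl \<Lambda> \<eta>) \<le> measure \<nu> (cyl \<Lambda>' \<eta>)"
proof -
  interpret prob_space \<nu> using assms by (simp add: prob_measures_def)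
  have "finite \<Lambda>'" using assms finite_subset by blast
  then show ?thesis
    using assms prob_measuresD(2)[OF assms(1)]
    by (intro finite_measure_mono cyl_antimono) auto
qed

text \<open>Finite-volume non-nullness: given finitely many other spins, each spin value has
  conditional probability at least \<delta>. Multiplying out avoids conditioning on null
  events.\<close>

definition site_nonnull :: "real \<Rightarrow> ('d::finite, 'q::{finite,discrete_topology}) config measure \<Rightarrow> bool" where
  "site_nonnull \<delta> \<nu> \<longleftrightarrow> (\<forall>\<Lambda> x \<omega>. finite \<Lambda> \<longrightarrow> x \<in> \<Lambda> \<longrightarrow>
    \<delta> * measure \<nu> (cyl (\<Lambda> - {x}) \<omega>) \<le> measure \<nu> (cyl \<Lambda> \<omega>))"

lemma site_nonnull_iterate:
  assumes nn: "site_nonnull \<delta> \<nu>" and "0 \<le> \<delta>" "finite \<Lambda>" "\<Delta> \<subseteq> \<Lambda>"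
  shows "\<delta> ^ card \<Delta> * measure \<nu> (cyl (\<Lambda> - \<Delta>) \<omega>) \<le> measure \<nu> (cyl \<Lambda> \<omega>)"
proof -
  have "finite \<Delta>" using assms finite_subset by blast
  then show ?thesis using assms(4)
  proof (induction \<Delta>)
    case (insert x \<Delta>)
    have "\<delta> * measure \<nu> (cyl (\<Lambda> - \<Delta> - {x}) \<omega>) \<le> measure \<nu> (cyl (\<Lambda> - \<Delta>) \<omega>)"
      using nn insert \<open>finite \<Lambda>\<close> unfolding site_nonnull_def by blast
    moreover have "\<Lambda> - \<Delta> - {x} = \<Lambda> - insert x \<Delta>" by blast
    ultimately have "\<delta> ^ card \<Delta> * (\<delta> * measure \<nu> (cyl (\<Lambda> - insert x \<Delta>) \<omega>))
        \<le> \<delta> ^ card \<Delta> * measure \<nu> (cyl (\<Lambda> - \<Delta>) \<omega>)"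
      using \<open>0 \<le> \<delta>\<close> by (intro mult_left_mono) simp_all
    also have "\<dots> \<le> measure \<nu> (cyl \<Lambda> \<omega>)" using insert by blast
    finally show ?case
      unfolding card_insert_disjoint[OF insert.hyps] power_Suc by (simp only: mult_ac)
  qed simp
qed

lemma site_nonnull_lower:
  assumes "site_nonnull \<delta> \<nu>" "0 \<le> \<delta>" "finite \<Lambda>" "\<nu> \<in> prob_measures"
  shows "\<delta> ^ card \<Lambda> \<le> measure \<nu> (cyl \<Lambda> \<omega>)"
  using site_nonnull_iterate[OF assms(1-3) order_refl, of \<omega>] prob_measuresD[OF assms(4)]
    prob_space.prob_space by fastforce

lemma site_nonnull_pos:
  assumes "site_nonnull \<delta> \<nu>" "0 < \<delta>" "finite \<Lambda>" "\<nu> \<in> prob_measures"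
  shows "0 < measure \<nu> (cyl \<Lambda> \<omega>)"
  using site_nonnull_lower[OF assms(1) less_imp_le[OF assms(2)] assms(3,4), of \<omega>] assms(2)
  by (meson less_le_trans zero_less_power)

lemma site_nonnull_le_1:
  fixes \<nu> :: "('d::finite, 'q::{finite,discrete_topology}) config measure"
  assumes "site_nonnull \<delta> \<nu>" "\<nu> \<in> prob_measures"
  shows "\<delta> \<le> 1"
proof -
  interpret prob_space \<nu> using assms by (simp add: prob_measures_def)
  have "\<delta> * measure \<nu> (cyl ({0} - {0}) undefined) \<le> measure \<nu> (cyl {0} undefined)"
    using assms(1) unfolding site_nonnull_def by blast
  also have "\<dots> \<le> 1" by simp
  finally show ?thesis using prob_space prob_measuresD(3)[OF assms(2)] by simp
qed

text \<open>Both cylinders lie in the coarser one that forgets the spins in \<Delta>; going back to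
  a given one costs a factor \<delta> per forgotten site. As \<delta> \<le> 1, the exponent may be
  enlarged from the size of \<Lambda> \<inter> \<Delta> to that of \<Delta>.\<close>

lemma site_nonnull_compare:
  assumes nn: "site_nonnull \<delta> \<nu>" "0 < \<delta>" and "finite \<Lambda>" "finite \<Delta>" "\<nu> \<in> prob_measures"
    and eq: "\<And>x. x \<in> \<Lambda> - \<Delta> \<Longrightarrow> \<omega> x = \<omega>' x"
  shows "\<delta> ^ card \<Delta> * measure \<nu> (cyl \<Lambda> \<omega>') \<le> measure \<nu> (cyl \<Lambda> \<omega>)"
proof -
  have "\<delta> ^ card \<Delta> \<le> \<delta> ^ card (\<Lambda> \<inter> \<Delta>)"
    using site_nonnull_le_1[OF nn(1) assms(5)] nn(2) card_mono[OF assms(4), of "\<Lambda> \<inter> \<Delta>"]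
    by (intro power_decreasing) auto
  moreover have "measure \<nu> (cyl \<Lambda> \<omega>') \<le> measure \<nu> (cyl (\<Lambda> - \<Lambda> \<inter> \<Delta>) \<omega>')"
    by (intro measure_cyl_mono assms) auto
  ultimately have "\<delta> ^ card \<Delta> * measure \<nu> (cyl \<Lambda> \<omega>') \<le> \<delta> ^ card (\<Lambda> \<inter> \<Delta>) * measure \<nu> (cyl (\<Lambda> - \<Lambda> \<inter> \<Delta>) \<omega>')"
    using nn(2) by (intro mult_mono) auto
  also have "cyl (\<Lambda> - \<Lambda> \<inter> \<Delta>) \<omega>' = cyl (\<Lambda> - \<Lambda> \<inter> \<Delta>) \<omega>"
    using eq by (intro cyl_cong) auto
  also have "\<delta> ^ card (\<Lambda> \<inter> \<Delta>) * measure \<nu> (cyl (\<Lambda> - \<Lambda> \<inter> \<Delta>) \<omega>) \<le> measure \<nu> (cyl \<Lambda> \<omega>)"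
    using nn by (intro site_nonnull_iterate assms) auto
  finally show ?thesis .
qed

text \<open>Integrating the bound on the conditional expectation over a cylinder that does not
  involve the origin gives the finite-volume bound at the origin; translation invariance carries it
  to the other sites.\<close>

lemma nonnull_measure_site_nonnull:
  fixes \<nu> :: "('d::finite, 'q::{finite,discrete_topology}) config measure"
  assumes "nonnull_measure \<nu>" and ti: "\<nu> \<in> ti_measures"
  shows "\<exists>\<delta>>0. site_nonnull \<delta> \<nu>"
proof -
  obtain \<delta> where \<delta>: "\<delta> > 0" and AE: "\<And>a. AE \<omega> in \<nu>.
     \<delta> \<le> real_cond_exp \<nu> (coord_algebra (- {0})) (indicator {\<omega>. \<omega> 0 = a}) \<omega>"
    using assms(1) unfolding nonnull_measure_def by blast
  have \<nu>: "\<nu> \<in> prob_measures" using ti by (simp add: ti_measures_def)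
  interpret prob_space \<nu> using \<nu> by (simp add: prob_measures_def)
  note sets_\<nu> [simp] = prob_measuresD(2)[OF \<nu>] and space_\<nu> [simp] = prob_measuresD(3)[OF \<nu>]
  interpret sub: finite_measure_subalgebra \<nu> "coord_algebra (- {0})"
    using coord_algebra_subalgebra[OF sets_\<nu>]
    by (simp add: finite_measure_subalgebra_def finite_measure_subalgebra_axioms_def finite_measure_axioms)
  have at_0: "\<delta> * measure \<nu> (cyl (\<Lambda> - {0}) \<eta>) \<le> measure \<nu> (cyl \<Lambda> \<eta>)"
    if "finite \<Lambda>" "0 \<in> \<Lambda>" for \<Lambda> \<eta>
  proof -
    let ?B = "cyl (\<Lambda> - {0}) \<eta>" and ?A = "{\<omega> :: ('d, 'q) config. \<omega> 0 = \<eta> 0}"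
    have B: "?B \<in> sets (coord_algebra (- {0}))" using that by (intro cyl_in_coord_algebra) auto
    have Bs: "?B \<in> sets \<nu>" using that by simp
    have "?A = cyl {0} \<eta>" by (auto simp: cyl_def)
    then have A: "?A \<in> sets \<nu>" by simp
    have int: "integrable \<nu> (indicator ?A :: _ \<Rightarrow> real)" using A by (simp add: emeasure_eq_measure)
    have "\<delta> * measure \<nu> ?B = (\<integral>\<omega>. indicator ?B \<omega> * \<delta> \<partial>\<nu>)"
      using Bs by simp
    also have "\<dots> \<le> (\<integral>\<omega>. indicator ?B \<omega> * real_cond_exp \<nu> (coord_algebra (- {0})) (indicator ?A) \<omega> \<partial>\<nu>)"
    proof (rule integral_mono_AE)
      show "integrable \<nu> (\<lambda>\<omega>. indicator ?B \<omega> * \<delta>)" using Bs by (simp add: emeasure_eq_measure)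
      show "integrable \<nu> (\<lambda>\<omega>. indicator ?B \<omega> * real_cond_exp \<nu> (coord_algebra (- {0})) (indicator ?A) \<omega>)"
        using integrable_mult_indicator[OF Bs sub.real_cond_exp_int(1)[OF int]] by simp
      show "AE \<omega> in \<nu>. indicator ?B \<omega> * \<delta>
          \<le> indicator ?B \<omega> * real_cond_exp \<nu> (coord_algebra (- {0})) (indicator ?A) \<omega>"
        using AE[of "\<eta> 0"] by eventually_elim (auto simp: indicator_def)
    qed
    also have "\<dots> = (\<integral>\<omega>. indicator ?B \<omega> * indicator ?A \<omega> \<partial>\<nu>)"
      using sub.real_cond_exp_intA[OF int B] by (simp add: set_lebesgue_integral_def)
    also have "\<dots> = measure \<nu> (?B \<inter> ?A)"
      using A Bs by (simp add: indicator_inter_arith[symmetric])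
    also have "?B \<inter> ?A = cyl \<Lambda> \<eta>" using that by (auto simp: cyl_def)
    finally show ?thesis .
  qed
  have "\<delta> * measure \<nu> (cyl (\<Lambda> - {x}) \<eta>) \<le> measure \<nu> (cyl \<Lambda> \<eta>)"
    if fin: "finite \<Lambda>" and x: "x \<in> \<Lambda>" for \<Lambda> x \<eta>
  proof -
    have "translate (- x) \<Lambda> - {0} = translate (- x) (\<Lambda> - {x})" by auto
    moreover have "0 \<in> translate (- x) \<Lambda>" by (rule mem_translate[THEN iffD2]) (use x in simp)
    ultimately have "\<delta> * measure \<nu> (cyl (translate (- x) (\<Lambda> - {x})) (shift (- x) \<eta>))
        \<le> measure \<nu> (cyl (translate (- x) \<Lambda>) (shift (- x) \<eta>))"
      using at_0[of "translate (- x) \<Lambda>" "shift (- x) \<eta>"] fin by (simp only: finite_imageI)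
    then show ?thesis
      using fin by (simp only: ti_measure_cyl[OF ti] finite_Diff)
  qed
  with \<delta> show ?thesis unfolding site_nonnull_def by blast
qed

section \<open>Gibbs measures\<close>

lemma kernel_prob:
  assumes "is_specification \<gamma>" "\<Lambda> \<in> fin_sets"
  shows "\<gamma> \<Lambda> \<eta> \<in> prob_measures"
proof -
  have "\<gamma> \<Lambda> \<in> coord_algebra (- \<Lambda>) \<rightarrow>\<^sub>M prob_algebra borel"
    using assms by (auto simp: is_specification_def)
  from measurable_space[OF this, of \<eta>] show ?thesis
    by (simp add: space_prob_algebra prob_measures_def)
qed

lemma kernel_measurable:
  fixes \<gamma> :: "('d::finite, 'q::{finite,discrete_topology}) kernels"
  assumes "is_specification \<gamma>" "\<Lambda> \<in> fin_sets" "sets \<nu> = sets borel"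
  shows "\<gamma> \<Lambda> \<in> \<nu> \<rightarrow>\<^sub>M prob_algebra borel"
proof -
  have "\<gamma> \<Lambda> \<in> coord_algebra (- \<Lambda>) \<rightarrow>\<^sub>M prob_algebra borel"
    using assms by (auto simp: is_specification_def)
  from measurable_from_subalg[OF coord_algebra_subalgebra[OF assms(3)] this] show ?thesis .
qed

lemma kernel_integrable:
  fixes \<gamma> :: "('d::finite, 'q::{finite,discrete_topology}) kernels"
  assumes "is_specification \<gamma>" "\<Lambda> \<in> fin_sets" "\<nu> \<in> prob_measures" "A \<in> sets borel"
  shows "integrable \<nu> (\<lambda>\<zeta>. measure (\<gamma> \<Lambda> \<zeta>) A)"
proof -
  interpret prob_space \<nu> using assms by (simp add: prob_measures_def)
  have "(\<lambda>\<zeta>. measure (\<gamma> \<Lambda> \<zeta>) A) \<in> borel_measurable \<nu>"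
    using measurable_compose[OF kernel_measurable[OF assms(1,2) prob_measuresD(2)[OF assms(3)]]
        measurable_measure_prob_algebra[OF assms(4)]] .
  moreover have "measure (\<gamma> \<Lambda> \<zeta>) A \<le> 1" for \<zeta>
    using kernel_prob[OF assms(1,2), of \<zeta>] by (simp add: prob_measures_def prob_space.prob_le_1)
  ultimately show ?thesis by (intro integrable_const_bound[of _ 1]) auto
qed

text \<open>A level set of the kernel probability is measurable with respect to the coordinates off
  \<Lambda> and so cannot separate the two boundary conditions.\<close>

lemma kernel_cong:
  fixes \<gamma> :: "('d::finite, 'q::{finite,discrete_topology}) kernels"
  assumes "is_specification \<gamma>" "\<Lambda> \<in> fin_sets" "A \<in> sets borel"
    and eq: "\<And>x. x \<notin> \<Lambda> \<Longrightarrow> \<zeta> x = \<zeta>' x"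
  shows "measure (\<gamma> \<Lambda> \<zeta>) A = measure (\<gamma> \<Lambda> \<zeta>') A"
proof -
  have "\<gamma> \<Lambda> \<in> coord_algebra (- \<Lambda>) \<rightarrow>\<^sub>M prob_algebra borel"
    using assms by (auto simp: is_specification_def)
  from measurable_compose[OF this measurable_measure_prob_algebra[OF assms(3)]]
  have "(\<lambda>\<zeta>. measure (\<gamma> \<Lambda> \<zeta>) A) -` {measure (\<gamma> \<Lambda> \<zeta>) A} \<inter> space (coord_algebra (- \<Lambda>)) \<in> sets (coord_algebra (- \<Lambda>))"
    by (rule measurable_sets) simp
  then have "\<zeta> \<in> (\<lambda>\<zeta>. measure (\<gamma> \<Lambda> \<zeta>) A) -` {measure (\<gamma> \<Lambda> \<zeta>) A} \<inter> space (coord_algebra (- \<Lambda>))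
    \<longleftrightarrow> \<zeta>' \<in> (\<lambda>\<zeta>. measure (\<gamma> \<Lambda> \<zeta>) A) -` {measure (\<gamma> \<Lambda> \<zeta>) A} \<inter> space (coord_algebra (- \<Lambda>))"
    by (rule coord_algebra_determined) (use eq in auto)
  then show ?thesis by simp
qed

text \<open>Bounds on \<open>\<gamma>\<^sub>\<Delta>\<close> turn into bounds on the conditional probabilities of \<open>\<mu>\<close> in finite
  volumes, by consistency and the DLR equation for the larger set \<open>\<Lambda>\<close>.\<close>

lemma gibbs_sandwich:
  fixes \<gamma> :: "('d::finite, 'q::{finite,discrete_topology}) kernels"
  assumes spec: "is_specification \<gamma>" and gibbs: "\<mu> \<in> gibbs_measures \<gamma>"
    and \<Delta>: "\<Delta> \<in> fin_sets" and \<Lambda>: "finite \<Lambda>" and sub: "\<Delta> \<subseteq> \<Lambda>"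
    and bnd: "\<And>\<zeta>. \<zeta> \<in> cyl (\<Lambda> - \<Delta>) \<omega> \<Longrightarrow>
      lo \<le> measure (\<gamma> \<Delta> \<zeta>) (cyl \<Delta> \<omega>) \<and> measure (\<gamma> \<Delta> \<zeta>) (cyl \<Delta> \<omega>) \<le> hi"
  shows "lo * measure \<mu> (cyl (\<Lambda> - \<Delta>) \<omega>) \<le> measure \<mu> (cyl \<Lambda> \<omega>)"
    and "measure \<mu> (cyl \<Lambda> \<omega>) \<le> hi * measure \<mu> (cyl (\<Lambda> - \<Delta>) \<omega>)"
proof -
  let ?C = "cyl \<Lambda> \<omega>" and ?B = "cyl (\<Lambda> - \<Delta>) \<omega>"
  have \<Lambda>f: "\<Lambda> \<in> fin_sets" using \<Delta> \<Lambda> sub by (auto simp: fin_sets_def)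
  have \<mu>: "\<mu> \<in> prob_measures" and DLR: "(\<integral>\<zeta>. measure (\<gamma> \<Lambda> \<zeta>) (cyl \<Lambda> \<eta>) \<partial>\<mu>) = measure \<mu> (cyl \<Lambda> \<eta>)" for \<eta>
    using gibbs \<Lambda>f by (auto simp: gibbs_measures_def)
  have C: "?C \<in> sets borel" and B: "?B \<in> sets borel" using \<Lambda> by auto
  have fin: "finite (\<Delta> \<rightarrow>\<^sub>E (UNIV :: 'q set))"
    using \<Delta> by (auto simp: fin_sets_def intro: finite_PiE)
  have step: "lo * measure (\<gamma> \<Lambda> \<eta>) ?B \<le> measure (\<gamma> \<Lambda> \<eta>) ?C \<and> measure (\<gamma> \<Lambda> \<eta>) ?C \<le> hi * measure (\<gamma> \<Lambda> \<eta>) ?B" for \<eta>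
  proof -
    have \<gamma>: "\<gamma> \<Lambda> \<eta> \<in> prob_measures" by (rule kernel_prob[OF spec \<Lambda>f])
    interpret prob_space "\<gamma> \<Lambda> \<eta>" using \<gamma> by (simp add: prob_measures_def)
    have "\<gamma> \<Lambda> \<eta> = \<gamma> \<Lambda> \<eta> \<bind> \<gamma> \<Delta>"
      using spec \<Lambda>f \<Delta> sub unfolding is_specification_def by metis
    then have "measure (\<gamma> \<Lambda> \<eta>) ?C = (\<integral>\<zeta>. measure (\<gamma> \<Delta> \<zeta>) ?C \<partial>(\<gamma> \<Lambda> \<eta>))"
      using measure_bind[OF measurable_prob_algebraD[OF kernel_measurable[OF spec \<Delta> prob_measuresD(2)[OF \<gamma>]]] C]
      by metis
    \<comment> \<open>Properness: the spins in \<Lambda> - \<Delta> are frozen by the boundary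
      condition of \<gamma>_\<Delta>.\<close>
    moreover have "measure (\<gamma> \<Delta> \<zeta>) ?C = measure (\<gamma> \<Delta> \<zeta>) (cyl \<Delta> \<omega>) * indicator ?B \<zeta>" for \<zeta>
    proof -
      have "?C = cyl \<Delta> \<omega> \<inter> ?B" using sub by (auto simp: cyl_def)
      moreover have "\<Lambda> - \<Delta> \<subseteq> - \<Delta>" by auto
      ultimately show ?thesis using spec \<Delta> unfolding is_specification_def by metis
    qed
    then have "lo * indicator ?B \<zeta> \<le> measure (\<gamma> \<Delta> \<zeta>) ?C" "measure (\<gamma> \<Delta> \<zeta>) ?C \<le> hi * indicator ?B \<zeta>" for \<zeta>
      using bnd[of \<zeta>] by (auto simp: indicator_def)
    moreover have "integrable (\<gamma> \<Lambda> \<eta>) (\<lambda>\<zeta>. a * indicator ?B \<zeta>)" "(\<integral>\<zeta>. a * indicator ?B \<zeta> \<partial>(\<gamma> \<Lambda> \<eta>)) = a * measure (\<gamma> \<Lambda> \<eta>) ?B" for a :: real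
      using B prob_measuresD[OF \<gamma>] by (auto simp: emeasure_eq_measure)
    ultimately show ?thesis
      using integral_mono[OF _ kernel_integrable[OF spec \<Delta> \<gamma> C]]
        integral_mono[OF kernel_integrable[OF spec \<Delta> \<gamma> C]] by metis
  qed
  interpret prob_space \<mu> using \<mu> by (simp add: prob_measures_def)
  \<comment> \<open>The DLR equation for \<gamma>_\<Lambda> is available for cylinders over
    \<Lambda> itself, so the coarser cylinder is decomposed into those.\<close>
  have "(\<integral>\<eta>. measure (\<gamma> \<Lambda> \<eta>) ?B \<partial>\<mu>) = measure \<mu> ?B"
  proof -
    have "(\<integral>\<eta>. measure (\<gamma> \<Lambda> \<eta>) ?B \<partial>\<mu>)
        = (\<integral>\<eta>. (\<Sum>\<sigma> \<in> \<Delta> \<rightarrow>\<^sub>E UNIV. measure (\<gamma> \<Lambda> \<eta>) (cyl \<Lambda> (override_on \<omega> \<sigma> \<Delta>))) \<partial>\<mu>)"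
      using measure_cyl_split[OF kernel_prob[OF spec \<Lambda>f] \<Lambda> sub] by simp
    also have "\<dots> = (\<Sum>\<sigma> \<in> \<Delta> \<rightarrow>\<^sub>E UNIV. \<integral>\<eta>. measure (\<gamma> \<Lambda> \<eta>) (cyl \<Lambda> (override_on \<omega> \<sigma> \<Delta>)) \<partial>\<mu>)"
      using \<Lambda> by (intro Bochner_Integration.integral_sum kernel_integrable[OF spec \<Lambda>f \<mu>]) auto
    also have "\<dots> = measure \<mu> ?B"
      unfolding DLR using measure_cyl_split[OF \<mu> \<Lambda> sub] by simp
    finally show ?thesis .
  qed
  moreover have "(\<integral>\<eta>. lo * measure (\<gamma> \<Lambda> \<eta>) ?B \<partial>\<mu>) \<le> (\<integral>\<eta>. measure (\<gamma> \<Lambda> \<eta>) ?C \<partial>\<mu>)"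
    "(\<integral>\<eta>. measure (\<gamma> \<Lambda> \<eta>) ?C \<partial>\<mu>) \<le> (\<integral>\<eta>. hi * measure (\<gamma> \<Lambda> \<eta>) ?B \<partial>\<mu>)"
    using step
    by (intro integral_mono[OF integrable_mult_right[OF kernel_integrable[OF spec \<Lambda>f \<mu> B]]
          kernel_integrable[OF spec \<Lambda>f \<mu> C]]
        integral_mono[OF kernel_integrable[OF spec \<Lambda>f \<mu> C]
          integrable_mult_right[OF kernel_integrable[OF spec \<Lambda>f \<mu> B]]]; blast)+
  ultimately show "lo * measure \<mu> ?B \<le> measure \<mu> ?C" "measure \<mu> ?C \<le> hi * measure \<mu> ?B"
    using DLR[of \<omega>] by simp_all
qed

lemma gibbs_site_nonnull:
  fixes \<gamma> :: "('d::finite, 'q::{finite,discrete_topology}) kernels"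
  assumes spec: "is_specification \<gamma>" and ti: "ti_specification \<gamma>" and nn: "nonnull_specification \<gamma>"
    and gibbs: "\<mu> \<in> gibbs_measures \<gamma>"
  shows "\<exists>\<delta>>0. site_nonnull \<delta> \<mu>"
proof -
  obtain \<delta> where \<delta>: "\<delta> > 0" "\<delta> \<le> (INF \<eta>. measure (\<gamma> {0} \<eta>) (cyl {0} \<eta>))"
    using nn by (auto simp: nonnull_specification_def)
  have single: "{x} \<in> fin_sets" for x :: "'d site" by (simp add: fin_sets_def)
  have at_0: "\<delta> \<le> measure (\<gamma> {0} \<eta>) (cyl {0} \<eta>)" for \<eta>
    using \<delta>(2) by (rule order_trans) (intro cINF_lower bdd_belowI2[of _ 0]; simp)
  have at_x: "\<delta> \<le> measure (\<gamma> {x} \<eta>) (cyl {x} \<eta>)" for x \<eta>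
  proof -
    have "measure (\<gamma> (translate x {0}) (shift x (shift (- x) \<eta>))) (cyl (translate x {0}) (shift x (shift (- x) \<eta>)))
        = measure (\<gamma> {0} (shift (- x) \<eta>)) (cyl {0} (shift (- x) \<eta>))"
      using ti single unfolding ti_specification_def by blast
    then show ?thesis using at_0[of "shift (- x) \<eta>"] by (simp add: shift_shift shift_0)
  qed
  have "\<delta> * measure \<mu> (cyl (\<Lambda> - {x}) \<omega>) \<le> measure \<mu> (cyl \<Lambda> \<omega>)"
    if \<Lambda>: "finite \<Lambda>" and x: "x \<in> \<Lambda>" for \<Lambda> x \<omega>
  proof (rule gibbs_sandwich(1)[OF spec gibbs single \<Lambda>])
    show "{x} \<subseteq> \<Lambda>" using x by simp
    fix \<zeta> :: "('d, 'q) config"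
    \<comment> \<open>Non-nullness bounds the probability of the spin already present in the
      boundary condition. As the kernel ignores that spin, it may be overwritten by the one
      wanted.\<close>
    let ?\<zeta> = "override_on \<zeta> \<omega> {x}"
    have "cyl {x} \<omega> = cyl {x} ?\<zeta>" by (rule cyl_cong) auto
    moreover have "measure (\<gamma> {x} \<zeta>) (cyl {x} \<omega>) = measure (\<gamma> {x} ?\<zeta>) (cyl {x} \<omega>)"
      by (rule kernel_cong[OF spec single]) auto
    ultimately have "\<delta> \<le> measure (\<gamma> {x} \<zeta>) (cyl {x} \<omega>)"
      using at_x[of x ?\<zeta>] by metis
    then show "\<delta> \<le> measure (\<gamma> {x} \<zeta>) (cyl {x} \<omega>) \<and> measure (\<gamma> {x} \<zeta>) (cyl {x} \<omega>) \<le> 1"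
      using kernel_prob[OF spec single, of x \<zeta>]
      by (simp add: prob_measures_def prob_space.prob_le_1)
  qed
  with \<delta>(1) show ?thesis unfolding site_nonnull_def by blast
qed

text \<open>Configurations agreeing off \<Delta> have the same cylinder off \<Delta>, so the ratio
  is one of conditional probabilities given the spins off \<Delta>. In every volume containing a
  large cube these are close to \<gamma>_\<Delta>, hence the two volumes agree up to a relative
  error.\<close>

lemma gibbs_ratio_quasilocal:
  fixes \<gamma> :: "('d::finite, 'q::{finite,discrete_topology}) kernels"
  assumes spec: "is_specification \<gamma>" and ql: "quasilocal \<gamma>" and gibbs: "\<mu> \<in> gibbs_measures \<gamma>"
    and nn: "site_nonnull \<delta> \<mu>" "0 < \<delta>" and \<Delta>: "\<Delta> \<in> fin_sets" and \<epsilon>: "\<epsilon> > 0"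
  shows "\<exists>r. \<forall>\<Lambda> \<Lambda>' \<omega> \<omega>'. finite \<Lambda> \<longrightarrow> \<Lambda>' \<subseteq> \<Lambda> \<longrightarrow> \<Delta> \<subseteq> \<Lambda>' \<longrightarrow> cube r \<subseteq> \<Lambda>' \<longrightarrow>
    (\<forall>x. x \<notin> \<Delta> \<longrightarrow> \<omega> x = \<omega>' x) \<longrightarrow>
    \<bar>measure \<mu> (cyl \<Lambda> \<omega>) / measure \<mu> (cyl \<Lambda> \<omega>') - measure \<mu> (cyl \<Lambda>' \<omega>) / measure \<mu> (cyl \<Lambda>' \<omega>')\<bar>
    \<le> \<epsilon> * (measure \<mu> (cyl \<Lambda>' \<omega>) / measure \<mu> (cyl \<Lambda>' \<omega>'))"
proof -
  have \<mu>: "\<mu> \<in> prob_measures" using gibbs by (simp add: gibbs_measures_def)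
  define a where "a = \<delta> ^ card \<Delta>"
  have a: "a > 0" using nn by (simp add: a_def)
  \<comment> \<open>Each conditional probability changes by at most 2\<epsilon>' between the
    volumes, so the cross-multiplied difference is at most 4\<epsilon>' =
    \<open>\<epsilon> * a\<^sup>2\<close>; the factor a twice is the lower bound for the conditional
    probabilities.\<close>
  define \<epsilon>' where "\<epsilon>' = \<epsilon> * a\<^sup>2 / 4"
  have \<epsilon>': "\<epsilon>' > 0" using \<epsilon> a by (simp add: \<epsilon>'_def)
  have le1: "measure (\<gamma> \<Delta> \<zeta>) A \<le> 1" for \<zeta> A
    using kernel_prob[OF spec \<Delta>, of \<zeta>] by (simp add: prob_measures_def prob_space.prob_le_1)
  let ?D = "\<lambda>X \<eta> \<xi>. \<bar>measure (\<gamma> \<Delta> (override_on \<xi> \<eta> (X - \<Delta>))) (cyl \<Delta> \<eta>) - measure (\<gamma> \<Delta> \<eta>) (cyl \<Delta> \<eta>)\<bar>"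
  have "eventually (\<lambda>X. (SUP (\<eta>, \<xi>)\<in>UNIV. ?D X \<eta> \<xi>) < \<epsilon>') (finite_subsets_at_top UNIV)"
    using ql \<Delta> \<epsilon>' unfolding quasilocal_def by (intro order_tendstoD(2)) auto
  then obtain X where X: "finite X" "\<And>Y. finite Y \<Longrightarrow> X \<subseteq> Y \<Longrightarrow> (SUP (\<eta>, \<xi>)\<in>UNIV. ?D Y \<eta> \<xi>) < \<epsilon>'"
    unfolding eventually_finite_subsets_at_top by auto
  obtain r where r: "X \<subseteq> cube r" using finite_subset_cube[OF X(1)] by blast
  have D: "?D Y \<eta> \<xi> \<le> \<epsilon>'" if Y: "finite Y" "cube r \<subseteq> Y" for Y \<eta> \<xi>
  proof -
    have "bdd_above (range (\<lambda>(\<eta>, \<xi>). ?D Y \<eta> \<xi>))"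
    proof (rule bdd_aboveI2)
      fix p :: "('d, 'q) config \<times> ('d, 'q) config"
      show "(case p of (\<eta>, \<xi>) \<Rightarrow> ?D Y \<eta> \<xi>) \<le> 1"
        using le1 by (auto simp: abs_le_iff split: prod.split intro: order_trans[OF _ le1]
            intro!: diff_le_eq[THEN iffD2] add_increasing2)
    qed
    from cSUP_upper[OF UNIV_I this, of "(\<eta>, \<xi>)"] show ?thesis
      using X(2)[OF Y(1)] r Y(2) by (simp add: order.strict_implies_order[OF le_less_trans])
  qed
  define q where "q \<Lambda> \<omega> = measure \<mu> (cyl \<Lambda> \<omega>) / measure \<mu> (cyl (\<Lambda> - \<Delta>) \<omega>)" for \<Lambda> \<omega>
  have pos: "0 < measure \<mu> (cyl \<Lambda> \<omega>)" if "finite \<Lambda>" for \<Lambda> \<omega>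
    by (rule site_nonnull_pos[OF nn that \<mu>])
  have q: "\<bar>q \<Lambda> \<omega> - measure (\<gamma> \<Delta> \<omega>) (cyl \<Delta> \<omega>)\<bar> \<le> \<epsilon>'" "a \<le> q \<Lambda> \<omega>" "q \<Lambda> \<omega> \<le> 1"
    if \<Lambda>: "finite \<Lambda>" "\<Delta> \<subseteq> \<Lambda>" "cube r \<subseteq> \<Lambda>" for \<Lambda> \<omega>
  proof -
    let ?g = "measure (\<gamma> \<Delta> \<omega>) (cyl \<Delta> \<omega>)"
    have b: "?g - \<epsilon>' \<le> measure (\<gamma> \<Delta> \<zeta>) (cyl \<Delta> \<omega>) \<and> measure (\<gamma> \<Delta> \<zeta>) (cyl \<Delta> \<omega>) \<le> ?g + \<epsilon>'"
      if "\<zeta> \<in> cyl (\<Lambda> - \<Delta>) \<omega>" for \<zeta>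
    proof -
      have "override_on \<zeta> \<omega> (\<Lambda> - \<Delta>) = \<zeta>" using that by (auto simp: cyl_def override_on_def)
      then show ?thesis using D[OF \<Lambda>(1,3), of \<zeta> \<omega>] by (simp add: abs_le_iff algebra_simps)
    qed
    note s = gibbs_sandwich[OF spec gibbs \<Delta> \<Lambda>(1,2) b]
    have p: "0 < measure \<mu> (cyl (\<Lambda> - \<Delta>) \<omega>)" using pos \<Lambda>(1) by blast
    show "\<bar>q \<Lambda> \<omega> - ?g\<bar> \<le> \<epsilon>'"
      unfolding q_def abs_le_iff using s p by (auto simp: field_simps)
    show "a \<le> q \<Lambda> \<omega>"
      unfolding q_def a_def using p site_nonnull_iterate[OF nn(1) _ \<Lambda>(1,2), of \<omega>] nn(2)
      by (simp add: pos_le_divide_eq)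
    show "q \<Lambda> \<omega> \<le> 1"
      unfolding q_def using p measure_cyl_mono[OF \<mu> \<Lambda>(1), of "\<Lambda> - \<Delta>" \<omega>] by simp
  qed
  show ?thesis
  proof (intro exI[of _ r] allI impI)
    fix \<Lambda> \<Lambda>' :: "'d site set" and \<omega> \<omega>' :: "('d, 'q) config"
    assume \<Lambda>: "finite \<Lambda>" "\<Lambda>' \<subseteq> \<Lambda>" "\<Delta> \<subseteq> \<Lambda>'" "cube r \<subseteq> \<Lambda>'" and eq: "\<forall>x. x \<notin> \<Delta> \<longrightarrow> \<omega> x = \<omega>' x"
    have fin': "finite \<Lambda>'" using \<Lambda> finite_subset by blast
    have sub: "\<Delta> \<subseteq> \<Lambda>" "cube r \<subseteq> \<Lambda>" using \<Lambda> by auto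
    have ratio: "measure \<mu> (cyl L \<omega>) / measure \<mu> (cyl L \<omega>') = q L \<omega> / q L \<omega>'" if "finite L" for L
    proof -
      have "cyl (L - \<Delta>) \<omega> = cyl (L - \<Delta>) \<omega>'" using eq by (intro cyl_cong) auto
      moreover have "0 < measure \<mu> (cyl (L - \<Delta>) \<omega>')" using pos that by blast
      ultimately show ?thesis by (simp add: q_def)
    qed
    let ?x = "q \<Lambda> \<omega>" and ?y = "q \<Lambda> \<omega>'" and ?x' = "q \<Lambda>' \<omega>" and ?y' = "q \<Lambda>' \<omega>'"
    have b: "\<bar>?x - ?x'\<bar> \<le> 2 * \<epsilon>'" "\<bar>?y' - ?y\<bar> \<le> 2 * \<epsilon>'"
      using q(1)[OF \<Lambda>(1) sub, of \<omega>] q(1)[OF fin' \<Lambda>(3,4), of \<omega>]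
        q(1)[OF \<Lambda>(1) sub, of \<omega>'] q(1)[OF fin' \<Lambda>(3,4), of \<omega>'] by linarith+
    note l = q(2)[OF \<Lambda>(1) sub] q(2)[OF fin' \<Lambda>(3,4)] and u = q(3)[OF \<Lambda>(1) sub] q(3)[OF fin' \<Lambda>(3,4)]
    have p: "0 < ?x'" "0 < ?y'" "0 < ?y" "0 < ?x" using l a by (smt (verit))+
    have "?x * ?y' - ?x' * ?y = (?x - ?x') * ?y' + ?x' * (?y' - ?y)" by (simp add: algebra_simps)
    then have "\<bar>?x * ?y' - ?x' * ?y\<bar> \<le> \<bar>?x - ?x'\<bar> * ?y' + ?x' * \<bar>?y' - ?y\<bar>"
      using p abs_triangle_ineq[of "(?x - ?x') * ?y'" "?x' * (?y' - ?y)"] by (simp add: abs_mult)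
    also have "\<dots> \<le> 2 * \<epsilon>' * 1 + 1 * (2 * \<epsilon>')"
      using b p u \<epsilon>' by (intro add_mono mult_mono) auto
    also have "\<dots> = \<epsilon> * (a * a)" by (simp add: \<epsilon>'_def power2_eq_square)
    also have "\<dots> \<le> \<epsilon> * (?x' * ?y)"
      using l a \<epsilon> p by (intro mult_left_mono mult_mono) auto
    finally have "\<bar>?x * ?y' - ?x' * ?y\<bar> / (?y * ?y') \<le> \<epsilon> * (?x' * ?y) / (?y * ?y')"
      using p by (intro divide_right_mono) auto
    moreover have "?x / ?y - ?x' / ?y' = (?x * ?y' - ?x' * ?y) / (?y * ?y')"
      using p by (simp add: field_simps)
    ultimately have "\<bar>?x / ?y - ?x' / ?y'\<bar> \<le> \<epsilon> * (?x' / ?y')"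
      using p by (simp add: abs_mult)
    then show "\<bar>measure \<mu> (cyl \<Lambda> \<omega>) / measure \<mu> (cyl \<Lambda> \<omega>') - measure \<mu> (cyl \<Lambda>' \<omega>) / measure \<mu> (cyl \<Lambda>' \<omega>')\<bar>
      \<le> \<epsilon> * (measure \<mu> (cyl \<Lambda>' \<omega>) / measure \<mu> (cyl \<Lambda>' \<omega>'))"
      unfolding ratio[OF \<Lambda>(1)] ratio[OF fin'] .
  qed
qed

section \<open>The function \<open>a ln (a / b) - a + b\<close>\<close>

text \<open>The summand of the Kullback-Leibler divergence for unnormalised weights, equal to b (u
  ln u - u + 1) with u = a / b; the linear terms make each summand nonnegative by itself.\<close>

definition rel_ent_fun :: "real \<Rightarrow> real \<Rightarrow> real" where
  "rel_ent_fun a b = a * ln (a / b) - a + b"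

lemma mult_ln_div_ge:
  fixes a b :: real
  assumes "a > 0" "b > 0"
  shows "a - b \<le> a * ln (a / b)"
proof -
  have "ln (b / a) \<le> b / a - 1" using assms by (intro ln_le_minus_one) auto
  then have "a * (1 - b / a) \<le> a * ln (a / b)"
    using assms by (intro mult_left_mono) (auto simp: ln_div)
  then show ?thesis using assms by (simp add: algebra_simps)
qed

lemma rel_ent_fun_nonneg: "a > 0 \<Longrightarrow> b > 0 \<Longrightarrow> 0 \<le> rel_ent_fun a b"
  using mult_ln_div_ge[of a b] by (simp add: rel_ent_fun_def)

lemma rel_ent_fun_scale: "m > 0 \<Longrightarrow> rel_ent_fun (m * a) (m * b) = m * rel_ent_fun a b"
  by (simp add: rel_ent_fun_def algebra_simps)

text \<open>The log-sum inequality: each summand is bounded below by its tangent at the common ratio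
  r of the two sums, where the total has equality.\<close>

lemma rel_ent_fun_sum:
  assumes "finite I" "I \<noteq> {}" "\<And>i. i \<in> I \<Longrightarrow> 0 < a i" "\<And>i. i \<in> I \<Longrightarrow> 0 < b i"
  shows "rel_ent_fun (\<Sum>i\<in>I. a i) (\<Sum>i\<in>I. b i) \<le> (\<Sum>i\<in>I. rel_ent_fun (a i) (b i))"
proof -
  let ?A = "\<Sum>i\<in>I. a i" and ?B = "\<Sum>i\<in>I. b i"
  have pos: "0 < ?A" "0 < ?B" using assms by (auto intro!: sum_pos)
  define r where "r = ?A / ?B"
  have r: "0 < r" using pos by (simp add: r_def)
  have "a i * ln r - r * b i + b i \<le> rel_ent_fun (a i) (b i)" if "i \<in> I" for i
  proof -
    have ab: "0 < a i" "0 < b i" using assms that by auto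
    have "a i - r * b i \<le> a i * ln (a i / (r * b i))"
      using ab r by (intro mult_ln_div_ge) auto
    also have "ln (a i / (r * b i)) = ln (a i / b i) - ln r"
      using ab r by (simp add: ln_div ln_mult)
    finally show ?thesis by (simp add: rel_ent_fun_def algebra_simps)
  qed
  then have "(\<Sum>i\<in>I. a i * ln r - r * b i + b i) \<le> (\<Sum>i\<in>I. rel_ent_fun (a i) (b i))"
    by (rule sum_mono)
  also have "(\<Sum>i\<in>I. a i * ln r - r * b i + b i) = ?A * ln r - r * ?B + ?B"
    by (simp add: sum.distrib sum_subtractf sum_distrib_left sum_distrib_right)
  finally show ?thesis using pos by (simp add: rel_ent_fun_def r_def)
qed

text \<open>Only a lower bound is sought, for which ln y \<le> y - 1 \<le> \<epsilon> suffices, so y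
  may come arbitrarily close to 0.\<close>

lemma rel_ent_fun_perturb:
  assumes "a > 0" "b > 0" "y > 0" "\<bar>y - 1\<bar> \<le> \<epsilon>"
  shows "rel_ent_fun a b - \<epsilon> * (a + b) \<le> rel_ent_fun a (y * b)"
proof -
  have "ln y \<le> \<epsilon>" using ln_le_minus_one[of y] assms by linarith
  then have "a * ln y \<le> a * \<epsilon>" using assms by simp
  moreover have "- (\<epsilon> * b) \<le> (y - 1) * b"
    using assms mult_right_mono[of "- \<epsilon>" "y - 1" b] by simp
  moreover have "a * ln (a / (y * b)) = a * ln (a / b) - a * ln y"
    using assms by (simp add: ln_div ln_mult algebra_simps)
  ultimately show ?thesis
    unfolding rel_ent_fun_def by (simp only: left_diff_distrib distrib_left mult_1 mult.commute[of \<epsilon>])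
qed

text \<open>Here a and b are the densities before and after a transition, m is the \<mu>-mass, x and
  y are the fluxes under \<rho> and \<mu>, and k is a reference rate. For x = k a m and y = k m the
  expression is exactly k m \<Phi>(a, b). The error of x meets an unbounded logarithm, but |a (ln a
  - ln b)| \<le> \<Phi>(a, b) + a + b.\<close>

lemma flux_term_approx:
  fixes a b m x y k e :: real
  assumes "a > 0" "b > 0" "m > 0" and x: "\<bar>x - k * (a * m)\<bar> \<le> e * (a * m)" and y: "\<bar>y - k * m\<bar> \<le> e * m"
  shows "\<bar>x * (ln a - ln b) + y * (b - a) - m * (k * rel_ent_fun a b)\<bar>
    \<le> e * (m * rel_ent_fun a b) + 2 * e * (m * (a + b))"
proof -
  have nn: "0 \<le> rel_ent_fun a b" using assms by (intro rel_ent_fun_nonneg)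
  have e: "0 \<le> e * m" using y by linarith
  have eq: "a * (ln a - ln b) = rel_ent_fun a b + a - b"
    using assms by (simp add: rel_ent_fun_def ln_div)
  then have "\<bar>a * (ln a - ln b)\<bar> \<le> rel_ent_fun a b + (a + b)"
    using nn assms by linarith
  then have "e * m * \<bar>a * (ln a - ln b)\<bar> \<le> e * m * (rel_ent_fun a b + (a + b))"
    using e by (rule mult_left_mono)
  moreover have "\<bar>(x - k * (a * m)) * (ln a - ln b)\<bar> \<le> e * m * \<bar>a * (ln a - ln b)\<bar>"
    using mult_right_mono[OF x, of "\<bar>ln a - ln b\<bar>"] assms by (simp add: abs_mult mult_ac)
  moreover have "\<bar>(y - k * m) * (b - a)\<bar> \<le> e * m * (a + b)"
    unfolding abs_mult using y assms e by (intro mult_mono) auto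
  moreover have "x * (ln a - ln b) + y * (b - a) - m * (k * rel_ent_fun a b)
      = (x - k * (a * m)) * (ln a - ln b) + (y - k * m) * (b - a)"
  proof -
    have "m * (k * rel_ent_fun a b) = k * m * (a * (ln a - ln b)) + k * m * (b - a)"
      unfolding eq by (simp add: algebra_simps)
    then show ?thesis by (simp add: algebra_simps)
  qed
  ultimately show ?thesis
    using abs_triangle_ineq[of "(x - k * (a * m)) * (ln a - ln b)" "(y - k * m) * (b - a)"]
    by (simp add: algebra_simps)
qed

text \<open>The logarithm is dangerous only if b is much larger than a, and then x \<le> K a m
  compensates: x ln(b / a) \<le> x b / a \<le> K m b. No bound on the ratio of the densities
  enters.\<close>

lemma flux_term_lower:
  fixes a b m x y K :: real
  assumes "a > 0" "b > 0" "m > 0" "0 \<le> x" "x \<le> K * (a * m)" "0 \<le> y" "y \<le> K * m"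
  shows "- K * (m * (a + b)) \<le> x * (ln a - ln b) + y * (b - a)"
proof -
  have "ln (b / a) \<le> b / a - 1" using assms by (intro ln_le_minus_one) auto
  then have "- (b / a) \<le> ln a - ln b" using assms by (simp add: ln_div)
  then have "x * (- (b / a)) \<le> x * (ln a - ln b)" using assms by (intro mult_left_mono)
  moreover have "x * (b / a) \<le> K * (a * m) * (b / a)" using assms by (intro mult_right_mono) auto
  moreover have "K * (a * m) * (b / a) = K * m * b" using assms by simp
  ultimately have "- (K * m * b) \<le> x * (ln a - ln b)" by linarith
  moreover have "y * a \<le> K * m * a" "0 \<le> y * b" using assms by (auto intro: mult_right_mono)
  then have "- (K * m * a) \<le> y * (b - a)" by (simp add: right_diff_distrib)
  moreover have "- K * (m * (a + b)) = - (K * m * b) + - (K * m * a)" by (simp add: algebra_simps)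
  ultimately show ?thesis by linarith
qed

text \<open>In the favourable direction the logarithm can be large, so the two-sided estimate
  carries a bound l on the log-ratio.\<close>

lemma flux_term_abs:
  fixes a b m x y K l :: real
  assumes "a > 0" "b > 0" "m > 0" "0 \<le> x" "x \<le> K * (a * m)" "0 \<le> y" "y \<le> K * m"
    and l: "\<bar>ln a - ln b\<bar> \<le> l"
  shows "\<bar>x * (ln a - ln b) + y * (b - a)\<bar> \<le> K * (l + 1) * (m * (a + b))"
proof -
  have K: "0 \<le> K * m" using assms by linarith
  have Kab: "0 \<le> K * (a * m)" using assms by linarith
  have "\<bar>x * (ln a - ln b)\<bar> \<le> K * (a * m) * l"
    unfolding abs_mult using assms Kab by (intro mult_mono) linarith+
  moreover have "\<bar>y * (b - a)\<bar> \<le> K * m * (a + b)"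
    unfolding abs_mult using assms K by (intro mult_mono) linarith+
  moreover have "0 \<le> (K * m) * (l * b)" using l assms by (intro mult_nonneg_nonneg[OF K mult_nonneg_nonneg]) linarith+
  ultimately show ?thesis
    using abs_triangle_ineq[of "x * (ln a - ln b)" "y * (b - a)"] by (simp add: algebra_simps)
qed

section \<open>Entropy production\<close>

definition positive_measure :: "('d::finite, 'q::{finite,discrete_topology}) config measure \<Rightarrow> bool" where
  "positive_measure \<rho> \<longleftrightarrow> \<rho> \<in> prob_measures \<and> (\<forall>\<Lambda> \<omega>. finite \<Lambda> \<longrightarrow> 0 < measure \<rho> (cyl \<Lambda> \<omega>))"

locale ips_gibbs = ips +
  fixes \<gamma> :: "('a, 'b) kernels" and \<mu> :: "('a, 'b) config measure"
  assumes spec: "is_specification \<gamma>" and ti_spec: "ti_specification \<gamma>"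
    and nn_spec: "nonnull_specification \<gamma>" and ql: "quasilocal \<gamma>"
    and gibbs: "\<mu> \<in> gibbs_measures \<gamma>" and ti_\<mu>: "\<mu> \<in> ti_measures"
    and stationary: "\<forall>s\<ge>0. evolve P s \<mu> = \<mu>"
begin

lemma \<mu>_prob: "\<mu> \<in> prob_measures"
  using ti_\<mu> by (simp add: ti_measures_def)

definition \<delta> :: real where "\<delta> = (SOME \<delta>. \<delta> > 0 \<and> site_nonnull \<delta> \<mu>)"

lemma \<delta>: "\<delta> > 0" "site_nonnull \<delta> \<mu>"
  using someI_ex[OF gibbs_site_nonnull[OF spec ti_spec nn_spec gibbs, unfolded bex_simps]]
  by (auto simp: \<delta>_def)

lemma \<mu>_pos: "finite \<Lambda> \<Longrightarrow> 0 < measure \<mu> (cyl \<Lambda> \<omega>)"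
  by (rule site_nonnull_pos[OF \<delta>(2,1) _ \<mu>_prob])

abbreviation m :: "'a site set \<Rightarrow> ('a, 'b) config \<Rightarrow> real" where
  "m \<Lambda> \<omega> \<equiv> measure \<mu> (cyl \<Lambda> \<omega>)"

definition dens :: "('a, 'b) config measure \<Rightarrow> 'a site set \<Rightarrow> ('a, 'b) config \<Rightarrow> real" where
  "dens \<rho> \<Lambda> \<omega> = measure \<rho> (cyl \<Lambda> \<omega>) / m \<Lambda> \<omega>"

text \<open>The expected rate of the transition on the event that \<omega> is seen in \<Lambda>. The
  rate depends on spins outside \<Lambda>, hence the integral instead of a product.\<close>

definition flux :: "('a, 'b) config measure \<Rightarrow> 'a site set \<Rightarrow> 'a site set \<Rightarrow> ('a, 'b) config \<Rightarrow> ('a, 'b) config \<Rightarrow> real" where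
  "flux \<rho> \<Lambda> \<Delta> \<xi> \<omega> = (\<integral>\<eta>. c \<Delta> \<eta> \<xi> * indicator (cyl \<Lambda> \<omega>) \<eta> \<partial>\<rho>)"

text \<open>The time derivative of the relative entropy. Differentiating the logarithm contributes
  the sum of the derivatives of the cylinder probabilities, which is zero and therefore
  absent.\<close>

definition entropy_rate :: "('a, 'b) config measure \<Rightarrow> 'a site set \<Rightarrow> real" where
  "entropy_rate \<rho> \<Lambda> = (\<Sum>\<omega> \<in> \<Lambda> \<rightarrow>\<^sub>E UNIV.
     (\<integral>\<eta>. ips_generator c (indicator (cyl \<Lambda> \<omega>)) \<eta> \<partial>\<rho>) * ln (dens \<rho> \<Lambda> \<omega>))"

definition prod_term :: "('a, 'b) config measure \<Rightarrow> 'a site set \<Rightarrow> 'a site set \<Rightarrow> ('a, 'b) config \<Rightarrow> real" where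
  "prod_term \<rho> \<Lambda> \<Delta> \<xi> = (\<Sum>\<omega> \<in> \<Lambda> \<rightarrow>\<^sub>E UNIV.
     flux \<rho> \<Lambda> \<Delta> \<xi> \<omega> * (ln (dens \<rho> \<Lambda> \<omega>) - ln (dens \<rho> \<Lambda> (override_on \<omega> \<xi> \<Delta>)))
     + flux \<mu> \<Lambda> \<Delta> \<xi> \<omega> * (dens \<rho> \<Lambda> (override_on \<omega> \<xi> \<Delta>) - dens \<rho> \<Lambda> \<omega>))"

text \<open>The factor \<open>c \<Delta> \<omega> \<xi>\<close> is replaced by its sign, since
  positive rates lie between two positive constants. The sign is taken at the configuration with the
  default value \<open>undefined\<close> off \<Lambda>; for large \<Lambda> this choice has no
  influence.\<close>

definition local_prod :: "('a, 'b) config measure \<Rightarrow> 'a site set \<Rightarrow> 'a site set \<Rightarrow> ('a, 'b) config \<Rightarrow> real" where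
  "local_prod \<rho> \<Lambda> \<Delta> \<xi> = (\<Sum>\<omega> \<in> \<Lambda> \<rightarrow>\<^sub>E UNIV. if c \<Delta> \<omega> \<xi> > 0
     then m \<Lambda> \<omega> * rel_ent_fun (dens \<rho> \<Lambda> \<omega>) (dens \<rho> \<Lambda> (override_on \<omega> \<xi> \<Delta>)) else 0)"

lemma dens_local: "(\<And>x. x \<in> \<Lambda> \<Longrightarrow> \<omega> x = \<omega>' x) \<Longrightarrow> dens \<rho> \<Lambda> \<omega> = dens \<rho> \<Lambda> \<omega>'"
  unfolding dens_def using cyl_cong[of \<Lambda> \<omega> \<omega>'] by simp

lemma dens_pos: "positive_measure \<rho> \<Longrightarrow> finite \<Lambda> \<Longrightarrow> 0 < dens \<rho> \<Lambda> \<omega>"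
  by (simp add: dens_def positive_measure_def \<mu>_pos)

lemma flux_integrable:
  assumes "\<rho> \<in> prob_measures" "active \<Delta>" "\<xi> \<in> \<Delta> \<rightarrow>\<^sub>E UNIV" "finite \<Lambda>"
  shows "integrable \<rho> (\<lambda>\<eta>. c \<Delta> \<eta> \<xi> * indicator (cyl \<Lambda> \<omega>) \<eta>)"
  by (intro continuous_integrable assms(1) continuous_on_mult rate_continuous active_fin(1) assms
      continuous_local local_indicator_cyl)

lemma flux_bounds:
  assumes \<rho>: "\<rho> \<in> prob_measures" and \<Delta>: "active \<Delta>" "\<xi> \<in> \<Delta> \<rightarrow>\<^sub>E UNIV" and \<Lambda>: "finite \<Lambda>"
    and bnd: "\<And>\<eta>. \<eta> \<in> cyl \<Lambda> \<omega> \<Longrightarrow> lo \<le> c \<Delta> \<eta> \<xi> \<and> c \<Delta> \<eta> \<xi> \<le> hi"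
  shows "lo * measure \<rho> (cyl \<Lambda> \<omega>) \<le> flux \<rho> \<Lambda> \<Delta> \<xi> \<omega>" "flux \<rho> \<Lambda> \<Delta> \<xi> \<omega> \<le> hi * measure \<rho> (cyl \<Lambda> \<omega>)"
proof -
  have int: "integrable \<rho> (\<lambda>\<eta>. a * indicator (cyl \<Lambda> \<omega>) \<eta>)"
    and eq: "(\<integral>\<eta>. a * indicator (cyl \<Lambda> \<omega>) \<eta> \<partial>\<rho>) = a * measure \<rho> (cyl \<Lambda> \<omega>)" for a :: real
    using integral_cyl[OF \<rho> \<Lambda>, of \<omega>]
      continuous_integrable[OF \<rho> continuous_local[OF local_indicator_cyl[OF \<Lambda>, of \<omega>]]] by simp_all
  note fl = flux_integrable[OF \<rho> \<Delta> \<Lambda>, of \<omega>]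
  show "lo * measure \<rho> (cyl \<Lambda> \<omega>) \<le> flux \<rho> \<Lambda> \<Delta> \<xi> \<omega>"
    unfolding eq[symmetric] flux_def
    by (rule integral_mono[OF int fl]) (use bnd in \<open>auto simp: indicator_def\<close>)
  show "flux \<rho> \<Lambda> \<Delta> \<xi> \<omega> \<le> hi * measure \<rho> (cyl \<Lambda> \<omega>)"
    unfolding eq[symmetric] flux_def
    by (rule integral_mono[OF fl int]) (use bnd in \<open>auto simp: indicator_def\<close>)
qed

lemma integral_generator_local:
  assumes \<rho>: "\<rho> \<in> prob_measures" and \<Lambda>: "finite \<Lambda>"
    and F: "\<And>\<eta> \<zeta>. (\<forall>x\<in>\<Lambda>. \<eta> x = \<zeta> x) \<Longrightarrow> F \<eta> = F \<zeta>"
  shows "(\<integral>\<eta>. ips_generator c F \<eta> \<partial>\<rho>) = (\<Sum>\<Delta>\<in>act \<Lambda>. \<Sum>\<xi> \<in> \<Delta> \<rightarrow>\<^sub>E UNIV. \<Sum>\<omega> \<in> \<Lambda> \<rightarrow>\<^sub>E UNIV.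
    flux \<rho> \<Lambda> \<Delta> \<xi> \<omega> * (F (override_on \<omega> \<xi> \<Delta>) - F \<omega>))"
proof -
  have "ips_generator c F \<eta> = (\<Sum>\<Delta>\<in>act \<Lambda>. \<Sum>\<xi> \<in> \<Delta> \<rightarrow>\<^sub>E UNIV. \<Sum>\<omega> \<in> \<Lambda> \<rightarrow>\<^sub>E UNIV.
      c \<Delta> \<eta> \<xi> * indicator (cyl \<Lambda> \<omega>) \<eta> * (F (override_on \<omega> \<xi> \<Delta>) - F \<omega>))" for \<eta>
  proof -
    have "c \<Delta> \<eta> \<xi> * (F (override_on \<eta> \<xi> \<Delta>) - F \<eta>) = (\<Sum>\<omega> \<in> \<Lambda> \<rightarrow>\<^sub>E UNIV.
      c \<Delta> \<eta> \<xi> * indicator (cyl \<Lambda> \<omega>) \<eta> * (F (override_on \<omega> \<xi> \<Delta>) - F \<omega>))" for \<Delta> \<xi>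
    proof -
      have "F (override_on \<eta> \<xi> \<Delta>) - F \<eta>
          = (\<Sum>\<omega> \<in> \<Lambda> \<rightarrow>\<^sub>E UNIV. (F (override_on \<omega> \<xi> \<Delta>) - F \<omega>) * indicator (cyl \<Lambda> \<omega>) \<eta>)"
      proof (rule local_expansion[OF \<Lambda>])
        fix \<eta> \<zeta> :: "('a, 'b) config" assume eq: "\<forall>x\<in>\<Lambda>. \<eta> x = \<zeta> x"
        then have "F (override_on \<eta> \<xi> \<Delta>) = F (override_on \<zeta> \<xi> \<Delta>)"
          by (intro F) (auto simp: override_on_def)
        with F[OF eq] show "F (override_on \<eta> \<xi> \<Delta>) - F \<eta> = F (override_on \<zeta> \<xi> \<Delta>) - F \<zeta>" by simp
      qed
      then show ?thesis by (simp add: sum_distrib_left mult_ac)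
    qed
    then show ?thesis
      using generator_local[where f = F, OF \<Lambda> F] by simp
  qed
  then show ?thesis
    unfolding flux_def
    by (simp add: Bochner_Integration.integral_sum flux_integrable[OF \<rho> _ _ \<Lambda>] act_def)
qed

text \<open>The expectation of F is constant in time, and its one-sided derivative at 0 is
  unique.\<close>

lemma stationary_local:
  assumes "local_function F"
  shows "(\<integral>\<eta>. ips_generator c F \<eta> \<partial>\<mu>) = 0"
proof -
  have "((\<lambda>t. \<integral>\<omega>. F \<omega> \<partial>(evolve P t \<mu>)) has_real_derivative
      (\<integral>\<omega>. ips_generator c F \<omega> \<partial>(evolve P 0 \<mu>))) (at 0 within {0..})"
    by (rule generator_derivative[OF assms \<mu>_prob]) simp
  then have "((\<lambda>t. \<integral>\<omega>. F \<omega> \<partial>\<mu>) has_real_derivative (\<integral>\<omega>. ips_generator c F \<omega> \<partial>\<mu>)) (at 0 within {0..})"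
    using has_field_derivative_transform_within[of "\<lambda>t. \<integral>\<omega>. F \<omega> \<partial>(evolve P t \<mu>)" _ 0 "{0..}" 1 "\<lambda>t. \<integral>\<omega>. F \<omega> \<partial>\<mu>"]
      stationary by simp
  moreover have "((\<lambda>t. \<integral>\<omega>. F \<omega> \<partial>\<mu>) has_real_derivative 0) (at 0 within {0..})" by simp
  moreover have "at 0 within {0..} \<noteq> (bot :: real filter)"
    using at_within_Ici_at_right[of "0 :: real"] by simp
  ultimately show ?thesis
    unfolding has_real_derivative_iff_has_vector_derivative
    by (rule vector_derivative_unique_within[rotated])
qed

text \<open>Stationarity of \<open>\<mu>\<close> allows one to add the vanishing integral of the generator applied to the
  density, which makes each bulk term nonnegative up to a small error.\<close>

lemma entropy_rate_eq:
  assumes \<rho>: "\<rho> \<in> prob_measures" and \<Lambda>: "finite \<Lambda>"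
  shows "- entropy_rate \<rho> \<Lambda> = (\<Sum>\<Delta>\<in>act \<Lambda>. \<Sum>\<xi> \<in> \<Delta> \<rightarrow>\<^sub>E UNIV. prod_term \<rho> \<Lambda> \<Delta> \<xi>)"
proof -
  have ind: "indicator (cyl \<Lambda> \<omega>) \<eta> = (indicator (cyl \<Lambda> \<omega>) \<zeta> :: real)"
    if "\<forall>x\<in>\<Lambda>. \<eta> x = \<zeta> x" for \<omega> \<eta> \<zeta> :: "('a, 'b) config"
    using that by (simp add: indicator_def cyl_def)
  have l: "(\<Sum>\<omega>' \<in> \<Lambda> \<rightarrow>\<^sub>E UNIV. indicator (cyl \<Lambda> \<omega>') \<eta> * ln (dens \<rho> \<Lambda> \<omega>')) = ln (dens \<rho> \<Lambda> \<eta>)" for \<eta>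
  proof -
    have "ln (dens \<rho> \<Lambda> \<eta>) = (\<Sum>\<omega>' \<in> \<Lambda> \<rightarrow>\<^sub>E UNIV. ln (dens \<rho> \<Lambda> \<omega>') * indicator (cyl \<Lambda> \<omega>') \<eta>)"
      by (rule local_expansion[OF \<Lambda>]) (metis dens_local)
    then show ?thesis by (simp add: mult.commute)
  qed
  have "entropy_rate \<rho> \<Lambda> = (\<Sum>\<omega>' \<in> \<Lambda> \<rightarrow>\<^sub>E UNIV. (\<Sum>\<Delta>\<in>act \<Lambda>. \<Sum>\<xi> \<in> \<Delta> \<rightarrow>\<^sub>E UNIV. \<Sum>\<omega> \<in> \<Lambda> \<rightarrow>\<^sub>E UNIV.
      flux \<rho> \<Lambda> \<Delta> \<xi> \<omega> * (indicator (cyl \<Lambda> \<omega>') (override_on \<omega> \<xi> \<Delta>) - indicator (cyl \<Lambda> \<omega>') \<omega>)) * ln (dens \<rho> \<Lambda> \<omega>'))"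
    unfolding entropy_rate_def by (simp only: integral_generator_local[OF \<rho> \<Lambda> ind])
  also have "\<dots> = (\<Sum>\<Delta>\<in>act \<Lambda>. \<Sum>\<xi> \<in> \<Delta> \<rightarrow>\<^sub>E UNIV. \<Sum>\<omega> \<in> \<Lambda> \<rightarrow>\<^sub>E UNIV. \<Sum>\<omega>' \<in> \<Lambda> \<rightarrow>\<^sub>E UNIV.
      flux \<rho> \<Lambda> \<Delta> \<xi> \<omega> * (indicator (cyl \<Lambda> \<omega>') (override_on \<omega> \<xi> \<Delta>) * ln (dens \<rho> \<Lambda> \<omega>') - indicator (cyl \<Lambda> \<omega>') \<omega> * ln (dens \<rho> \<Lambda> \<omega>')))"
    unfolding sum_distrib_right
    apply (subst sum.swap, rule sum.cong[OF refl])
    apply (subst sum.swap, rule sum.cong[OF refl])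
    apply (subst sum.swap, rule sum.cong[OF refl])
    by (simp add: algebra_simps)
  also have "\<dots> = (\<Sum>\<Delta>\<in>act \<Lambda>. \<Sum>\<xi> \<in> \<Delta> \<rightarrow>\<^sub>E UNIV. \<Sum>\<omega> \<in> \<Lambda> \<rightarrow>\<^sub>E UNIV.
      flux \<rho> \<Lambda> \<Delta> \<xi> \<omega> * (ln (dens \<rho> \<Lambda> (override_on \<omega> \<xi> \<Delta>)) - ln (dens \<rho> \<Lambda> \<omega>)))"
    by (simp only: sum_distrib_left[symmetric] sum_subtractf l)
  finally have 1: "entropy_rate \<rho> \<Lambda> = \<dots>" .
  have loc: "local_function (dens \<rho> \<Lambda>)"
    unfolding local_function_def using \<Lambda> dens_local by metis
  have 2: "0 = (\<Sum>\<Delta>\<in>act \<Lambda>. \<Sum>\<xi> \<in> \<Delta> \<rightarrow>\<^sub>E UNIV. \<Sum>\<omega> \<in> \<Lambda> \<rightarrow>\<^sub>E UNIV.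
      flux \<mu> \<Lambda> \<Delta> \<xi> \<omega> * (dens \<rho> \<Lambda> (override_on \<omega> \<xi> \<Delta>) - dens \<rho> \<Lambda> \<omega>))"
    using stationary_local[OF loc] integral_generator_local[OF \<mu>_prob \<Lambda>, of "dens \<rho> \<Lambda>"]
      dens_local[of \<Lambda>] by metis
  have "- entropy_rate \<rho> \<Lambda> = 0 - entropy_rate \<rho> \<Lambda>" by simp
  also have "\<dots> = (\<Sum>\<Delta>\<in>act \<Lambda>. \<Sum>\<xi> \<in> \<Delta> \<rightarrow>\<^sub>E UNIV. prod_term \<rho> \<Lambda> \<Delta> \<xi>)"
    unfolding 1 by (subst 2) (simp add: prod_term_def sum_subtractf[symmetric] algebra_simps)
  finally show ?thesis .
qed

end

lemma abs_ratio_minus_one_le: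
  fixes z R e :: real
  assumes "0 < R" "\<bar>z - R\<bar> \<le> e * R"
  shows "\<bar>z / R - 1\<bar> \<le> e"
proof -
  have "z / R - 1 = (z - R) / R" using assms(1) by (simp add: diff_divide_distrib)
  then show ?thesis using assms by (simp add: pos_divide_le_eq)
qed

section \<open>Fixed constants for the range, the multiplicity and the size of transitions\<close>

context ips
begin

definition rng :: nat where
  "rng = (SOME R. \<forall>\<Delta> x y. active \<Delta> \<longrightarrow> x \<in> \<Delta> \<longrightarrow> y \<in> \<Delta> \<longrightarrow> y - x \<in> cube R)"

lemma rng: "active \<Delta> \<Longrightarrow> x \<in> \<Delta> \<Longrightarrow> y \<in> \<Delta> \<Longrightarrow> y - x \<in> cube rng"
  using someI_ex[OF range_bound, folded rng_def] by blast

definition mult_bd :: nat where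
  "mult_bd = (SOME N. \<forall>x. finite {\<Delta>. active \<Delta> \<and> x \<in> \<Delta>} \<and> card {\<Delta>. active \<Delta> \<and> x \<in> \<Delta>} \<le> N)"

lemma mult_bd: "finite {\<Delta>. active \<Delta> \<and> x \<in> \<Delta>}" "card {\<Delta>. active \<Delta> \<and> x \<in> \<Delta>} \<le> mult_bd"
  using someI_ex[OF active_count, folded mult_bd_def] by blast+

definition rate_sup :: real where
  "rate_sup = (SOME K. K > 0 \<and> (\<forall>\<Delta> \<eta>. active \<Delta> \<longrightarrow> (\<forall>\<xi> \<in> \<Delta> \<rightarrow>\<^sub>E UNIV. c \<Delta> \<eta> \<xi> \<le> K)))"

lemma rate_sup: "rate_sup > 0" "active \<Delta> \<Longrightarrow> \<xi> \<in> \<Delta> \<rightarrow>\<^sub>E UNIV \<Longrightarrow> c \<Delta> \<eta> \<xi> \<le> rate_sup"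
  using someI_ex[OF rate_bound, folded rate_sup_def] by blast+

definition rate_inf :: real where
  "rate_inf = (SOME \<kappa>. \<kappa> > 0 \<and>
    (\<forall>\<Delta> \<eta>. active \<Delta> \<longrightarrow> (\<forall>\<xi> \<in> \<Delta> \<rightarrow>\<^sub>E UNIV. c \<Delta> \<eta> \<xi> > 0 \<longrightarrow> \<kappa> \<le> c \<Delta> \<eta> \<xi>)))"

lemma rate_inf: "rate_inf > 0"
  "active \<Delta> \<Longrightarrow> \<xi> \<in> \<Delta> \<rightarrow>\<^sub>E UNIV \<Longrightarrow> c \<Delta> \<eta> \<xi> > 0 \<Longrightarrow> rate_inf \<le> c \<Delta> \<eta> \<xi>"
  using someI_ex[OF rate_min, folded rate_inf_def] by blast+

definition card_bd :: nat where
  "card_bd = card (cube rng :: 'd site set)"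

text \<open>Moved so that one of its points becomes the origin, an active set fits into the cube
  whose radius is the range.\<close>

lemma card_bd: "active \<Delta> \<Longrightarrow> card \<Delta> \<le> card_bd"
proof -
  assume act: "active \<Delta>"
  then obtain x where x: "x \<in> \<Delta>" using active_fin(3) by blast
  have "inj_on (\<lambda>y. y - x) \<Delta>" by (rule inj_onI) simp
  then have "card \<Delta> = card ((\<lambda>y. y - x) ` \<Delta>)" by (simp add: card_image)
  also have "\<dots> \<le> card (cube rng :: 'd site set)"
    using rng[OF act x] by (intro card_mono) auto
  finally show ?thesis by (simp add: card_bd_def)
qed

definition configs_bd :: real where
  "configs_bd = real (CARD('q) ^ card_bd)"

lemma configs_bd: "active \<Delta> \<Longrightarrow> \<Delta>' \<subseteq> \<Delta> \<Longrightarrow> real (card (\<Delta>' \<rightarrow>\<^sub>E (UNIV :: 'q set))) \<le> configs_bd"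
proof -
  assume act: "active \<Delta>" and "\<Delta>' \<subseteq> \<Delta>"
  then have "card \<Delta>' \<le> card_bd"
    using card_bd[OF act] card_mono[OF active_fin(2)[OF act], of \<Delta>'] by linarith
  moreover have "finite \<Delta>'" using active_fin(2)[OF act] \<open>\<Delta>' \<subseteq> \<Delta>\<close> finite_subset by blast
  ultimately show ?thesis
    unfolding configs_bd_def by (simp add: card_PiE power_increasing)
qed

lemma configs_bd_pos: "configs_bd > 0"
  by (simp add: configs_bd_def)

end

context ips_gibbs
begin

text \<open>The 1 is the total mass of \<rho>. In the fraction, \<open>configs_bd\<close> bounds how
  many configurations are sent to the same one by a transition, and the power of \<delta> is the
  price of comparing the \<mu>-mass before and after it.\<close>

definition weight_bd :: real where
  "weight_bd = 1 + configs_bd / \<delta> ^ card_bd"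

lemma weight_bd_pos: "weight_bd > 0"
  using configs_bd_pos \<delta>(1) by (auto simp: weight_bd_def intro: add_pos_pos)

lemma positive_measureD: "positive_measure \<rho> \<Longrightarrow> \<rho> \<in> prob_measures"
  "positive_measure \<rho> \<Longrightarrow> finite \<Lambda> \<Longrightarrow> 0 < measure \<rho> (cyl \<Lambda> \<omega>)"
  by (simp_all add: positive_measure_def)

lemma m_dens: "finite \<Lambda> \<Longrightarrow> m \<Lambda> \<omega> * dens \<rho> \<Lambda> \<omega> = measure \<rho> (cyl \<Lambda> \<omega>)"
  using \<mu>_pos[of \<Lambda> \<omega>] by (simp add: dens_def)

lemma power_card_bd:
  fixes d :: real
  assumes "active \<Delta>" "0 < d" "d \<le> 1"
  shows "d ^ card_bd \<le> d ^ card \<Delta>"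
  using card_bd[OF assms(1)] assms(2,3) by (intro power_decreasing) auto

lemma compare_cyl:
  assumes nn: "site_nonnull d \<rho>" "0 < d" and \<rho>: "\<rho> \<in> prob_measures" and "finite \<Lambda>" "active \<Delta>"
    and eq: "\<And>x. x \<in> \<Lambda> - \<Delta> \<Longrightarrow> \<omega> x = \<omega>' x"
  shows "d ^ card_bd * measure \<rho> (cyl \<Lambda> \<omega>') \<le> measure \<rho> (cyl \<Lambda> \<omega>)"
proof -
  have "d ^ card_bd * measure \<rho> (cyl \<Lambda> \<omega>') \<le> d ^ card \<Delta> * measure \<rho> (cyl \<Lambda> \<omega>')"
    using power_card_bd[OF assms(5) nn(2) site_nonnull_le_1[OF nn(1) \<rho>]]
    by (intro mult_right_mono) auto
  also have "\<dots> \<le> measure \<rho> (cyl \<Lambda> \<omega>)"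
    by (rule site_nonnull_compare[OF nn assms(4) active_fin(2)[OF assms(5)] \<rho> eq])
  finally show ?thesis .
qed

text \<open>The error terms are proportional to this sum. Non-nullness of \<mu> alone controls it,
  so the bound is the same for all probability measures \<rho>.\<close>

lemma sum_weight_le:
  assumes \<rho>: "\<rho> \<in> prob_measures" and \<Lambda>: "finite \<Lambda>" and \<Delta>: "active \<Delta>"
  shows "(\<Sum>\<omega> \<in> \<Lambda> \<rightarrow>\<^sub>E UNIV. m \<Lambda> \<omega> * (dens \<rho> \<Lambda> \<omega> + dens \<rho> \<Lambda> (override_on \<omega> \<xi> \<Delta>))) \<le> weight_bd"
proof -
  let ?p = "\<lambda>\<omega>. measure \<rho> (cyl \<Lambda> \<omega>)" and ?L = "\<Lambda> - \<Lambda> \<inter> \<Delta>"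
  have Dpos: "\<delta> ^ card_bd > 0" using \<delta>(1) by simp
  have "m \<Lambda> \<omega> * dens \<rho> \<Lambda> (override_on \<omega> \<xi> \<Delta>) \<le> ?p (override_on \<omega> \<xi> \<Delta>) / \<delta> ^ card_bd" for \<omega>
  proof -
    let ?\<omega> = "override_on \<omega> \<xi> \<Delta>"
    have "\<delta> ^ card_bd * m \<Lambda> \<omega> \<le> m \<Lambda> ?\<omega>"
      by (rule compare_cyl[OF \<delta>(2,1) \<mu>_prob \<Lambda> \<Delta>]) (simp add: override_on_def)
    then have "m \<Lambda> \<omega> \<le> m \<Lambda> ?\<omega> / \<delta> ^ card_bd" using Dpos by (simp add: pos_le_divide_eq mult.commute)
    then have "m \<Lambda> \<omega> * dens \<rho> \<Lambda> ?\<omega> \<le> m \<Lambda> ?\<omega> / \<delta> ^ card_bd * dens \<rho> \<Lambda> ?\<omega>"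
      by (intro mult_right_mono) (simp_all add: dens_def)
    then show ?thesis using m_dens[OF \<Lambda>, of ?\<omega> \<rho>] by (simp add: field_simps)
  qed
  then have "(\<Sum>\<omega> \<in> \<Lambda> \<rightarrow>\<^sub>E UNIV. m \<Lambda> \<omega> * (dens \<rho> \<Lambda> \<omega> + dens \<rho> \<Lambda> (override_on \<omega> \<xi> \<Delta>)))
      \<le> (\<Sum>\<omega> \<in> \<Lambda> \<rightarrow>\<^sub>E UNIV. ?p \<omega> + ?p (override_on \<omega> \<xi> \<Delta>) / \<delta> ^ card_bd)"
    by (intro sum_mono) (simp add: distrib_left m_dens[OF \<Lambda>])
  also have "\<dots> = 1 + (\<Sum>\<omega> \<in> \<Lambda> \<rightarrow>\<^sub>E UNIV. ?p (override_on \<omega> \<xi> \<Delta>)) / \<delta> ^ card_bd"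
    using sum_measure_cyl[OF \<rho> \<Lambda>] by (simp add: sum.distrib sum_divide_distrib)
  also have "(\<Sum>\<omega> \<in> \<Lambda> \<rightarrow>\<^sub>E UNIV. ?p (override_on \<omega> \<xi> \<Delta>)) \<le> configs_bd"
  proof -
    have "(\<Sum>\<omega> \<in> \<Lambda> \<rightarrow>\<^sub>E UNIV. ?p (override_on \<omega> \<xi> \<Delta>))
        = (\<Sum>\<omega> \<in> ?L \<rightarrow>\<^sub>E UNIV. \<Sum>\<sigma> \<in> (\<Lambda> \<inter> \<Delta>) \<rightarrow>\<^sub>E UNIV. ?p (override_on (override_on \<omega> \<sigma> (\<Lambda> \<inter> \<Delta>)) \<xi> \<Delta>))"
      by (rule sum_configs_split) simp
    \<comment> \<open>After forgetting the spins in \<Lambda> \<inter> \<Delta> the cylinder no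
      longer depends on \<sigma>, and the inner sum merely counts.\<close>
    also have "\<dots> \<le> (\<Sum>\<omega> \<in> ?L \<rightarrow>\<^sub>E UNIV. \<Sum>\<sigma> \<in> (\<Lambda> \<inter> \<Delta>) \<rightarrow>\<^sub>E (UNIV :: 'b set). measure \<rho> (cyl ?L \<omega>))"
    proof (intro sum_mono)
      fix \<omega> \<sigma> :: "('a, 'b) config"
      have "?p (override_on (override_on \<omega> \<sigma> (\<Lambda> \<inter> \<Delta>)) \<xi> \<Delta>)
          \<le> measure \<rho> (cyl ?L (override_on (override_on \<omega> \<sigma> (\<Lambda> \<inter> \<Delta>)) \<xi> \<Delta>))"
        by (rule measure_cyl_mono[OF \<rho> \<Lambda>]) auto
      also have "cyl ?L (override_on (override_on \<omega> \<sigma> (\<Lambda> \<inter> \<Delta>)) \<xi> \<Delta>) = cyl ?L \<omega>"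
        by (rule cyl_cong) auto
      finally show "?p (override_on (override_on \<omega> \<sigma> (\<Lambda> \<inter> \<Delta>)) \<xi> \<Delta>) \<le> measure \<rho> (cyl ?L \<omega>)" .
    qed
    also have "\<dots> = real (card ((\<Lambda> \<inter> \<Delta>) \<rightarrow>\<^sub>E (UNIV :: 'b set)))"
      using sum_measure_cyl[OF \<rho>, of ?L] \<Lambda> by (simp add: sum_distrib_left[symmetric])
    also have "\<dots> \<le> configs_bd" using configs_bd[OF \<Delta>, of "\<Lambda> \<inter> \<Delta>"] by simp
    finally show ?thesis .
  qed
  finally show ?thesis using Dpos by (simp add: weight_bd_def divide_right_mono)
qed

section \<open>Estimates for a single transition in the bulk and at the boundary\<close>

lemma local_prod_nonneg: "positive_measure \<rho> \<Longrightarrow> finite \<Lambda> \<Longrightarrow> 0 \<le> local_prod \<rho> \<Lambda> \<Delta> \<xi>"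
  unfolding local_prod_def by (intro sum_nonneg) (auto intro!: mult_nonneg_nonneg rel_ent_fun_nonneg dens_pos)

text \<open>In the bulk the rate is constant up to \<epsilon> on each cylinder over \<Lambda>, so
  each term is its rate times m \<Phi> up to errors. The lower bound produces entropy decay; the
  upper one shows that vanishing \<Phi>-terms force a vanishing entropy rate.\<close>

lemma prod_term_bulk:
  assumes \<rho>: "positive_measure \<rho>" and \<Lambda>: "finite \<Lambda>" and \<Delta>: "active \<Delta>" "\<xi> \<in> \<Delta> \<rightarrow>\<^sub>E UNIV"
    and \<epsilon>: "0 < \<epsilon>" "\<epsilon> \<le> rate_inf / 2"
    and near: "\<And>\<omega> \<eta>. \<eta> \<in> cyl \<Lambda> \<omega> \<Longrightarrow> \<bar>c \<Delta> \<eta> \<xi> - c \<Delta> \<omega> \<xi>\<bar> \<le> \<epsilon>"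
  shows "rate_inf / 2 * local_prod \<rho> \<Lambda> \<Delta> \<xi> - 2 * \<epsilon> * weight_bd \<le> prod_term \<rho> \<Lambda> \<Delta> \<xi>"
    and "\<bar>prod_term \<rho> \<Lambda> \<Delta> \<xi>\<bar> \<le> (rate_sup + rate_inf) * local_prod \<rho> \<Lambda> \<Delta> \<xi> + 2 * \<epsilon> * weight_bd"
proof -
  let ?t = "\<lambda>\<omega>. flux \<rho> \<Lambda> \<Delta> \<xi> \<omega> * (ln (dens \<rho> \<Lambda> \<omega>) - ln (dens \<rho> \<Lambda> (override_on \<omega> \<xi> \<Delta>)))
     + flux \<mu> \<Lambda> \<Delta> \<xi> \<omega> * (dens \<rho> \<Lambda> (override_on \<omega> \<xi> \<Delta>) - dens \<rho> \<Lambda> \<omega>)"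
  let ?s = "\<lambda>\<omega>. if c \<Delta> \<omega> \<xi> > 0
     then m \<Lambda> \<omega> * rel_ent_fun (dens \<rho> \<Lambda> \<omega>) (dens \<rho> \<Lambda> (override_on \<omega> \<xi> \<Delta>)) else 0"
  let ?w = "\<lambda>\<omega>. m \<Lambda> \<omega> * (dens \<rho> \<Lambda> \<omega> + dens \<rho> \<Lambda> (override_on \<omega> \<xi> \<Delta>))"
  note \<rho>p = positive_measureD(1)[OF \<rho>]
  have main: "rate_inf / 2 * ?s \<omega> - 2 * \<epsilon> * ?w \<omega> \<le> ?t \<omega> \<and>
    \<bar>?t \<omega>\<bar> \<le> (rate_sup + rate_inf) * ?s \<omega> + 2 * \<epsilon> * ?w \<omega>" for \<omega>
  proof -
    let ?k = "c \<Delta> \<omega> \<xi>" and ?a = "dens \<rho> \<Lambda> \<omega>" and ?b = "dens \<rho> \<Lambda> (override_on \<omega> \<xi> \<Delta>)"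
    have ab: "0 < ?a" "0 < ?b" using dens_pos[OF \<rho> \<Lambda>] by auto
    have mp: "0 < m \<Lambda> \<omega>" by (rule \<mu>_pos[OF \<Lambda>])
    have w: "0 \<le> ?w \<omega>" using ab mp by simp
    show ?thesis
    proof (cases "?k > 0")
      case False
      \<comment> \<open>Positive rates are at least \<open>rate_inf\<close> and the variation is at
        most half of that, so a rate vanishing at \<omega> vanishes on the whole cylinder.\<close>
      have z: "c \<Delta> \<eta> \<xi> = 0" if "\<eta> \<in> cyl \<Lambda> \<omega>" for \<eta>
      proof (rule ccontr)
        assume "c \<Delta> \<eta> \<xi> \<noteq> 0"
        then have "rate_inf \<le> c \<Delta> \<eta> \<xi>"
          using rate_nonneg[OF active_fin(1)[OF \<Delta>(1)] \<Delta>(2), of \<eta>] by (intro rate_inf(2) \<Delta>) auto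
        then show False using near[OF that] False \<epsilon> rate_inf(1) by linarith
      qed
      have "flux \<rho> \<Lambda> \<Delta> \<xi> \<omega> = 0" "flux \<mu> \<Lambda> \<Delta> \<xi> \<omega> = 0"
        using flux_bounds[OF \<rho>p \<Delta> \<Lambda>, of \<omega> 0 0] flux_bounds[OF \<mu>_prob \<Delta> \<Lambda>, of \<omega> 0 0] z by fastforce+
      then show ?thesis using False w \<epsilon> by simp
    next
      case True
      have b: "?k - \<epsilon> \<le> c \<Delta> \<eta> \<xi> \<and> c \<Delta> \<eta> \<xi> \<le> ?k + \<epsilon>" if "\<eta> \<in> cyl \<Lambda> \<omega>" for \<eta>
        using near[OF that] by (simp add: abs_le_iff)
      have x: "\<bar>flux \<rho> \<Lambda> \<Delta> \<xi> \<omega> - ?k * (?a * m \<Lambda> \<omega>)\<bar> \<le> \<epsilon> * (?a * m \<Lambda> \<omega>)"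
        using flux_bounds[OF \<rho>p \<Delta> \<Lambda> b] m_dens[OF \<Lambda>, of \<omega> \<rho>]
        by (simp add: abs_le_iff algebra_simps)
      have y: "\<bar>flux \<mu> \<Lambda> \<Delta> \<xi> \<omega> - ?k * m \<Lambda> \<omega>\<bar> \<le> \<epsilon> * m \<Lambda> \<omega>"
        using flux_bounds[OF \<mu>_prob \<Delta> \<Lambda> b] by (simp add: abs_le_iff algebra_simps)
      let ?r = "m \<Lambda> \<omega> * rel_ent_fun ?a ?b"
      have rn: "0 \<le> ?r" using ab mp rel_ent_fun_nonneg[of ?a ?b] by simp
      have est: "\<bar>?t \<omega> - ?k * ?r\<bar> \<le> \<epsilon> * ?r + 2 * \<epsilon> * ?w \<omega>"
        using flux_term_approx[OF ab mp x y] by (simp add: mult.left_commute)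
      have k: "rate_inf \<le> ?k" "?k \<le> rate_sup"
        using rate_inf(2)[OF \<Delta> True] rate_sup(2)[OF \<Delta>] by auto
      \<comment> \<open>The error proportional to \<Phi> is absorbed by the main term:
        \<open>?k - \<epsilon>\<close> stays above \<open>rate_inf / 2\<close>, and
        \<open>?k + \<epsilon>\<close> below \<open>rate_sup + rate_inf\<close>.\<close>
      have "rate_inf / 2 * ?r \<le> (?k - \<epsilon>) * ?r"
        using k \<epsilon> rn by (intro mult_right_mono) auto
      moreover have "(?k + \<epsilon>) * ?r \<le> (rate_sup + rate_inf) * ?r"
        using k \<epsilon> rn rate_inf(1) by (intro mult_right_mono) auto
      moreover have "0 \<le> ?k * ?r" using k rn rate_inf(1) by simp
      ultimately have "rate_inf / 2 * ?r - 2 * \<epsilon> * ?w \<omega> \<le> ?t \<omega> \<and>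
          \<bar>?t \<omega>\<bar> \<le> (rate_sup + rate_inf) * ?r + 2 * \<epsilon> * ?w \<omega>"
        using est unfolding left_diff_distrib[of ?k] distrib_right[of ?k] by linarith
      with True show ?thesis by simp
    qed
  qed
  have W: "2 * \<epsilon> * (\<Sum>\<omega> \<in> \<Lambda> \<rightarrow>\<^sub>E UNIV. ?w \<omega>) \<le> 2 * \<epsilon> * weight_bd"
    using sum_weight_le[OF \<rho>p \<Lambda> \<Delta>(1)] \<epsilon> by (intro mult_left_mono) auto
  have "(\<Sum>\<omega> \<in> \<Lambda> \<rightarrow>\<^sub>E UNIV. rate_inf / 2 * ?s \<omega> - 2 * \<epsilon> * ?w \<omega>) \<le> prod_term \<rho> \<Lambda> \<Delta> \<xi>"
    unfolding prod_term_def using main by (intro sum_mono) blast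
  then have "rate_inf / 2 * local_prod \<rho> \<Lambda> \<Delta> \<xi> - 2 * \<epsilon> * (\<Sum>\<omega> \<in> \<Lambda> \<rightarrow>\<^sub>E UNIV. ?w \<omega>) \<le> prod_term \<rho> \<Lambda> \<Delta> \<xi>"
    by (simp only: sum_subtractf sum_distrib_left[symmetric] local_prod_def)
  with W show "rate_inf / 2 * local_prod \<rho> \<Lambda> \<Delta> \<xi> - 2 * \<epsilon> * weight_bd \<le> prod_term \<rho> \<Lambda> \<Delta> \<xi>" by linarith
  have "\<bar>prod_term \<rho> \<Lambda> \<Delta> \<xi>\<bar> \<le> (\<Sum>\<omega> \<in> \<Lambda> \<rightarrow>\<^sub>E UNIV. (rate_sup + rate_inf) * ?s \<omega> + 2 * \<epsilon> * ?w \<omega>)"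
    unfolding prod_term_def using main by (intro order_trans[OF sum_abs] sum_mono) blast
  then have "\<bar>prod_term \<rho> \<Lambda> \<Delta> \<xi>\<bar> \<le> (rate_sup + rate_inf) * local_prod \<rho> \<Lambda> \<Delta> \<xi> + 2 * \<epsilon> * (\<Sum>\<omega> \<in> \<Lambda> \<rightarrow>\<^sub>E UNIV. ?w \<omega>)"
    by (simp only: sum.distrib sum_distrib_left[symmetric] local_prod_def)
  with W show "\<bar>prod_term \<rho> \<Lambda> \<Delta> \<xi>\<bar> \<le> (rate_sup + rate_inf) * local_prod \<rho> \<Lambda> \<Delta> \<xi> + 2 * \<epsilon> * weight_bd" by linarith
qed

lemma flux_crude:
  assumes "\<rho> \<in> prob_measures" "finite \<Lambda>" "active \<Delta>" "\<xi> \<in> \<Delta> \<rightarrow>\<^sub>E UNIV"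
  shows "0 \<le> flux \<rho> \<Lambda> \<Delta> \<xi> \<omega>" "flux \<rho> \<Lambda> \<Delta> \<xi> \<omega> \<le> rate_sup * measure \<rho> (cyl \<Lambda> \<omega>)"
  using flux_bounds[OF assms(1,3,4,2), of \<omega> 0 rate_sup] rate_sup(2)[OF assms(3,4)]
    rate_nonneg[OF active_fin(1)[OF assms(3)] assms(4)] by auto

text \<open>For transitions near the boundary, where the rate may vary freely over a cylinder; it is
  uniform in \<rho>.\<close>

lemma prod_term_lower:
  assumes \<rho>: "positive_measure \<rho>" and \<Lambda>: "finite \<Lambda>" and \<Delta>: "active \<Delta>" "\<xi> \<in> \<Delta> \<rightarrow>\<^sub>E UNIV"
  shows "- rate_sup * weight_bd \<le> prod_term \<rho> \<Lambda> \<Delta> \<xi>"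
proof -
  note \<rho>p = positive_measureD(1)[OF \<rho>]
  let ?w = "\<lambda>\<omega>. m \<Lambda> \<omega> * (dens \<rho> \<Lambda> \<omega> + dens \<rho> \<Lambda> (override_on \<omega> \<xi> \<Delta>))"
  have "(\<Sum>\<omega> \<in> \<Lambda> \<rightarrow>\<^sub>E UNIV. - rate_sup * ?w \<omega>) \<le> prod_term \<rho> \<Lambda> \<Delta> \<xi>"
    unfolding prod_term_def
    using flux_crude[OF \<rho>p \<Lambda> \<Delta>] flux_crude[OF \<mu>_prob \<Lambda> \<Delta>] m_dens[OF \<Lambda>, of _ \<rho>]
    by (intro sum_mono flux_term_lower dens_pos[OF \<rho> \<Lambda>] \<mu>_pos[OF \<Lambda>]) (simp_all add: mult.commute)
  moreover have "rate_sup * (\<Sum>\<omega> \<in> \<Lambda> \<rightarrow>\<^sub>E UNIV. ?w \<omega>) \<le> rate_sup * weight_bd"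
    using sum_weight_le[OF \<rho>p \<Lambda> \<Delta>(1)] rate_sup(1) by (intro mult_left_mono) auto
  ultimately show ?thesis by (simp add: sum_negf sum_distrib_left[symmetric])
qed

text \<open>Non-nullness of both measures bounds the ratio of densities before and after a
  transition, and hence the logarithm.\<close>

lemma prod_term_abs:
  assumes \<rho>: "positive_measure \<rho>" and nn: "site_nonnull d \<rho>" "0 < d"
    and \<Lambda>: "finite \<Lambda>" and \<Delta>: "active \<Delta>" "\<xi> \<in> \<Delta> \<rightarrow>\<^sub>E UNIV"
  shows "\<bar>prod_term \<rho> \<Lambda> \<Delta> \<xi>\<bar> \<le> rate_sup * (\<bar>ln (d ^ card_bd * \<delta> ^ card_bd)\<bar> + 1) * weight_bd"
proof -
  note \<rho>p = positive_measureD(1)[OF \<rho>]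
  let ?w = "\<lambda>\<omega>. m \<Lambda> \<omega> * (dens \<rho> \<Lambda> \<omega> + dens \<rho> \<Lambda> (override_on \<omega> \<xi> \<Delta>))"
  let ?e = "d ^ card_bd * \<delta> ^ card_bd"
  have e: "0 < ?e" using nn \<delta>(1) by simp
  \<comment> \<open>Changing spins within \<Delta> costs at most a power of d for \<rho> and of
    \<delta> for \<mu>; the hypothesis is symmetric, so this also bounds the opposite
    difference.\<close>
  have half: "ln (dens \<rho> \<Lambda> \<omega>) - ln (dens \<rho> \<Lambda> \<omega>') \<le> - ln ?e"
    if eq: "\<And>x. x \<in> \<Lambda> - \<Delta> \<Longrightarrow> \<omega> x = \<omega>' x" for \<omega> \<omega>'
  proof -
    have p: "0 < measure \<rho> (cyl \<Lambda> \<omega>)" "0 < measure \<rho> (cyl \<Lambda> \<omega>')" "0 < m \<Lambda> \<omega>" "0 < m \<Lambda> \<omega>'"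
      using positive_measureD(2)[OF \<rho> \<Lambda>] \<mu>_pos[OF \<Lambda>] by auto
    have "d ^ card_bd * measure \<rho> (cyl \<Lambda> \<omega>) \<le> measure \<rho> (cyl \<Lambda> \<omega>')"
      by (rule compare_cyl[OF nn \<rho>p \<Lambda> \<Delta>(1)]) (simp add: eq)
    moreover have "\<delta> ^ card_bd * m \<Lambda> \<omega>' \<le> m \<Lambda> \<omega>"
      by (rule compare_cyl[OF \<delta>(2,1) \<mu>_prob \<Lambda> \<Delta>(1)]) (simp add: eq)
    ultimately have "(d ^ card_bd * measure \<rho> (cyl \<Lambda> \<omega>)) * (\<delta> ^ card_bd * m \<Lambda> \<omega>') \<le> measure \<rho> (cyl \<Lambda> \<omega>') * m \<Lambda> \<omega>"
      using p nn \<delta>(1) by (intro mult_mono) auto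
    then have "?e * dens \<rho> \<Lambda> \<omega> \<le> dens \<rho> \<Lambda> \<omega>'"
      unfolding dens_def using p by (simp add: field_simps)
    then have "ln (?e * dens \<rho> \<Lambda> \<omega>) \<le> ln (dens \<rho> \<Lambda> \<omega>')"
      using e dens_pos[OF \<rho> \<Lambda>] by (intro ln_mono) auto
    also have "ln (?e * dens \<rho> \<Lambda> \<omega>) = ln ?e + ln (dens \<rho> \<Lambda> \<omega>)"
      by (rule ln_mult_pos[OF e dens_pos[OF \<rho> \<Lambda>]])
    finally show ?thesis by linarith
  qed
  have l: "\<bar>ln (dens \<rho> \<Lambda> \<omega>) - ln (dens \<rho> \<Lambda> (override_on \<omega> \<xi> \<Delta>))\<bar> \<le> \<bar>ln ?e\<bar>" for \<omega>
  proof -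
    have "ln (dens \<rho> \<Lambda> \<omega>) - ln (dens \<rho> \<Lambda> (override_on \<omega> \<xi> \<Delta>)) \<le> - ln ?e"
      "ln (dens \<rho> \<Lambda> (override_on \<omega> \<xi> \<Delta>)) - ln (dens \<rho> \<Lambda> \<omega>) \<le> - ln ?e"
      by (rule half, simp)+
    then show ?thesis by linarith
  qed
  have "\<bar>prod_term \<rho> \<Lambda> \<Delta> \<xi>\<bar> \<le> (\<Sum>\<omega> \<in> \<Lambda> \<rightarrow>\<^sub>E UNIV. rate_sup * (\<bar>ln ?e\<bar> + 1) * ?w \<omega>)"
    unfolding prod_term_def
    using flux_crude[OF \<rho>p \<Lambda> \<Delta>] flux_crude[OF \<mu>_prob \<Lambda> \<Delta>] m_dens[OF \<Lambda>, of _ \<rho>]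
    by (intro order_trans[OF sum_abs] sum_mono flux_term_abs dens_pos[OF \<rho> \<Lambda>] \<mu>_pos[OF \<Lambda>] l)
      (simp_all add: mult.commute)
  also have "\<dots> = rate_sup * (\<bar>ln ?e\<bar> + 1) * (\<Sum>\<omega> \<in> \<Lambda> \<rightarrow>\<^sub>E UNIV. ?w \<omega>)"
    by (simp only: sum_distrib_left)
  also have "\<dots> \<le> rate_sup * (\<bar>ln ?e\<bar> + 1) * weight_bd"
    using sum_weight_le[OF \<rho>p \<Lambda> \<Delta>(1)] rate_sup(1) by (intro mult_left_mono) auto
  finally show ?thesis .
qed

text \<open>The density of \<open>\<mu>\<close> with respect to its image under a local change is almost local, and \<^const>\<open>rel_ent_fun\<close> decreases
  under summation over the additional spins.\<close>

lemma local_prod_mono: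
  assumes \<Delta>: "active \<Delta>" and \<xi>: "\<xi> \<in> \<Delta> \<rightarrow>\<^sub>E UNIV" and \<epsilon>: "0 < \<epsilon>"
  shows "\<exists>r. \<forall>\<Lambda> \<Lambda>' \<rho>. finite \<Lambda> \<longrightarrow> \<Lambda>' \<subseteq> \<Lambda> \<longrightarrow> \<Delta> \<subseteq> \<Lambda>' \<longrightarrow> cube r \<subseteq> \<Lambda>' \<longrightarrow> positive_measure \<rho> \<longrightarrow>
    local_prod \<rho> \<Lambda>' \<Delta> \<xi> - \<epsilon> * weight_bd \<le> local_prod \<rho> \<Lambda> \<Delta> \<xi>"
proof -
  obtain x where x: "x \<in> \<Delta>" using active_fin(3)[OF \<Delta>] by blast
  obtain r0 where r0: "\<forall>\<Delta>\<in>fin_sets. \<forall>x\<in>\<Delta>. \<forall>\<xi> \<in> \<Delta> \<rightarrow>\<^sub>E UNIV. \<forall>\<eta> \<eta>'.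
    (\<forall>y. y - x \<in> cube r0 \<longrightarrow> \<eta> y = \<eta>' y) \<longrightarrow> \<bar>c \<Delta> \<eta> \<xi> - c \<Delta> \<eta>' \<xi>\<bar> \<le> rate_inf / 2"
    using rate_local[of "rate_inf / 2"] rate_inf(1) by auto
  obtain r1 where r1: "translate x (cube r0) \<subseteq> cube r1"
    using finite_subset_cube[of "translate x (cube r0)"] by auto
  obtain r2 where r2: "\<forall>\<Lambda> \<Lambda>' \<omega> \<omega>'. finite \<Lambda> \<longrightarrow> \<Lambda>' \<subseteq> \<Lambda> \<longrightarrow> \<Delta> \<subseteq> \<Lambda>' \<longrightarrow> cube r2 \<subseteq> \<Lambda>' \<longrightarrow>
    (\<forall>x. x \<notin> \<Delta> \<longrightarrow> \<omega> x = \<omega>' x) \<longrightarrow>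
    \<bar>m \<Lambda> \<omega> / m \<Lambda> \<omega>' - m \<Lambda>' \<omega> / m \<Lambda>' \<omega>'\<bar> \<le> \<epsilon> * (m \<Lambda>' \<omega> / m \<Lambda>' \<omega>')"
    using gibbs_ratio_quasilocal[OF spec ql gibbs \<delta>(2,1) active_fin(1)[OF \<Delta>] \<epsilon>] by blast
  show ?thesis
  proof (intro exI[of _ "max r1 r2"] allI impI)
    fix \<Lambda> \<Lambda>' :: "'a site set" and \<rho> :: "('a, 'b) config measure"
    assume \<Lambda>: "finite \<Lambda>" and \<Lambda>': "\<Lambda>' \<subseteq> \<Lambda>" "\<Delta> \<subseteq> \<Lambda>'" "cube (max r1 r2) \<subseteq> \<Lambda>'" and \<rho>: "positive_measure \<rho>"
    note \<rho>p = positive_measureD(1)[OF \<rho>]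
    have fin': "finite \<Lambda>'" using \<Lambda> \<Lambda>' finite_subset by blast
    have cubes: "cube r1 \<subseteq> \<Lambda>'" "cube r2 \<subseteq> \<Lambda>'" using \<Lambda>'(3) cube_mono[of r1 "max r1 r2"] cube_mono[of r2 "max r1 r2"] by auto
    let ?E = "\<Lambda> - \<Lambda>'"
    have ee: "\<Lambda> - ?E = \<Lambda>'" "?E \<subseteq> \<Lambda>" using \<Lambda>' by auto
    have finE: "finite (?E \<rightarrow>\<^sub>E (UNIV :: 'b set))" "?E \<rightarrow>\<^sub>E (UNIV :: 'b set) \<noteq> {}"
      using \<Lambda> by (auto intro: finite_configs simp: PiE_eq_empty_iff)
    let ?f = "\<lambda>\<Lambda> \<omega>. if c \<Delta> \<omega> \<xi> > 0
     then m \<Lambda> \<omega> * rel_ent_fun (dens \<rho> \<Lambda> \<omega>) (dens \<rho> \<Lambda> (override_on \<omega> \<xi> \<Delta>)) else 0"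
    let ?w = "\<lambda>\<omega>. m \<Lambda>' \<omega> * (dens \<rho> \<Lambda>' \<omega> + dens \<rho> \<Lambda>' (override_on \<omega> \<xi> \<Delta>))"
    have fibre: "?f \<Lambda>' \<omega> - \<epsilon> * ?w \<omega> \<le> (\<Sum>\<sigma> \<in> ?E \<rightarrow>\<^sub>E UNIV. ?f \<Lambda> (override_on \<omega> \<sigma> ?E))" for \<omega>
    proof -
      \<comment> \<open>The added spins change the rate by at most half of the minimal positive
        rate, so they cannot decide whether the transition is possible.\<close>
      have sgn: "c \<Delta> (override_on \<omega> \<sigma> ?E) \<xi> > 0 \<longleftrightarrow> c \<Delta> \<omega> \<xi> > 0" for \<sigma>
      proof -
        have "\<forall>y. y - x \<in> cube r0 \<longrightarrow> override_on \<omega> \<sigma> ?E y = \<omega> y"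
        proof (intro allI impI)
          fix y assume "y - x \<in> cube r0"
          then have "y \<in> translate x (cube r0)" by (rule mem_translate[THEN iffD2])
          then show "override_on \<omega> \<sigma> ?E y = \<omega> y" using r1 cubes by (auto simp: override_on_def)
        qed
        then have h: "\<bar>c \<Delta> (override_on \<omega> \<sigma> ?E) \<xi> - c \<Delta> \<omega> \<xi>\<bar> \<le> rate_inf / 2"
          using r0 active_fin(1)[OF \<Delta>] x \<xi> by blast
        show ?thesis
        proof
          assume "c \<Delta> (override_on \<omega> \<sigma> ?E) \<xi> > 0"
          from rate_inf(2)[OF \<Delta> \<xi> this] show "c \<Delta> \<omega> \<xi> > 0" using h rate_inf(1) by linarith
        next
          assume "c \<Delta> \<omega> \<xi> > 0"
          from rate_inf(2)[OF \<Delta> \<xi> this] show "c \<Delta> (override_on \<omega> \<sigma> ?E) \<xi> > 0"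
            using h rate_inf(1) by linarith
        qed
      qed
      have wn: "0 \<le> ?w \<omega>" using dens_pos[OF \<rho> fin'] \<mu>_pos[OF fin'] by (simp add: less_imp_le add_nonneg_nonneg)
      show ?thesis
      proof (cases "c \<Delta> \<omega> \<xi> > 0")
        case False
        then show ?thesis using sgn wn \<epsilon> by simp
      next
        case True
        let ?\<omega>' = "override_on \<omega> \<xi> \<Delta>"
        let ?p = "\<lambda>\<sigma>. measure \<rho> (cyl \<Lambda> (override_on \<omega> \<sigma> ?E))"
        let ?p' = "\<lambda>\<sigma>. measure \<rho> (cyl \<Lambda> (override_on ?\<omega>' \<sigma> ?E))"
        \<comment> \<open>The \<mu>-ratio in the smaller volume is the same for every \<sigma>; with
          it the second arguments sum to exactly the second argument of the term for
          \<Lambda>'.\<close>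
        let ?R = "m \<Lambda>' \<omega> / m \<Lambda>' ?\<omega>'"
        have Rp: "0 < ?R" using \<mu>_pos[OF fin'] by simp
        have pp: "0 < ?p \<sigma>" "0 < ?p' \<sigma>" for \<sigma> using positive_measureD(2)[OF \<rho> \<Lambda>] by auto
        have comm: "override_on (override_on \<omega> \<sigma> ?E) \<xi> \<Delta> = override_on ?\<omega>' \<sigma> ?E" for \<sigma>
          using \<Lambda>'(2) by (auto simp: override_on_def fun_eq_iff)
        \<comment> \<open>In \<Lambda> the true ratio is \<open>?y * ?R\<close>, where
          \<open>?y\<close> is within \<epsilon> of 1 by quasilocality; exchanging the two ratios
          costs the \<epsilon>-term.\<close>
        have pert: "rel_ent_fun (?p \<sigma>) (?R * ?p' \<sigma>) - \<epsilon> * (?p \<sigma> + ?R * ?p' \<sigma>) \<le> ?f \<Lambda> (override_on \<omega> \<sigma> ?E)" for \<sigma>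
        proof -
          let ?\<zeta> = "override_on \<omega> \<sigma> ?E" and ?\<zeta>' = "override_on ?\<omega>' \<sigma> ?E"
          let ?y = "(m \<Lambda> ?\<zeta> / m \<Lambda> ?\<zeta>') / ?R"
          have mp: "0 < m \<Lambda> ?\<zeta>" "0 < m \<Lambda> ?\<zeta>'" using \<mu>_pos[OF \<Lambda>] by auto
          have "m \<Lambda>' ?\<zeta> = m \<Lambda>' \<omega>" "m \<Lambda>' ?\<zeta>' = m \<Lambda>' ?\<omega>'"
            by (rule arg_cong[where f = "measure \<mu>"], rule cyl_cong, simp)+
          moreover have "\<forall>x. x \<notin> \<Delta> \<longrightarrow> ?\<zeta> x = ?\<zeta>' x" by (simp add: override_on_def)
          ultimately have "\<bar>m \<Lambda> ?\<zeta> / m \<Lambda> ?\<zeta>' - ?R\<bar> \<le> \<epsilon> * ?R"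
            using r2[rule_format, OF \<Lambda> \<Lambda>'(1,2) cubes(2), of ?\<zeta> ?\<zeta>'] by simp
          then have y: "\<bar>?y - 1\<bar> \<le> \<epsilon>" by (rule abs_ratio_minus_one_le[OF Rp])
          have yp: "0 < ?y" by (rule divide_pos_pos[OF divide_pos_pos[OF mp] Rp])
          have "rel_ent_fun (?p \<sigma>) (?R * ?p' \<sigma>) - \<epsilon> * (?p \<sigma> + ?R * ?p' \<sigma>) \<le> rel_ent_fun (?p \<sigma>) (?y * (?R * ?p' \<sigma>))"
            by (rule rel_ent_fun_perturb[OF pp(1) mult_pos_pos[OF Rp pp(2)] yp y])
          also have "?y * (?R * ?p' \<sigma>) = m \<Lambda> ?\<zeta> / m \<Lambda> ?\<zeta>' * ?p' \<sigma>"
            unfolding mult.assoc[symmetric] nonzero_eq_divide_eq[OF less_imp_neq[OF Rp, symmetric], THEN iffD1, OF refl] ..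
          also have "\<dots> = m \<Lambda> ?\<zeta> * dens \<rho> \<Lambda> ?\<zeta>'" by (simp add: dens_def)
          also have "rel_ent_fun (?p \<sigma>) (m \<Lambda> ?\<zeta> * dens \<rho> \<Lambda> ?\<zeta>')
              = rel_ent_fun (m \<Lambda> ?\<zeta> * dens \<rho> \<Lambda> ?\<zeta>) (m \<Lambda> ?\<zeta> * dens \<rho> \<Lambda> ?\<zeta>')"
            by (simp only: m_dens[OF \<Lambda>])
          also have "rel_ent_fun (m \<Lambda> ?\<zeta> * dens \<rho> \<Lambda> ?\<zeta>) (m \<Lambda> ?\<zeta> * dens \<rho> \<Lambda> ?\<zeta>') = ?f \<Lambda> ?\<zeta>"
            using True sgn[of \<sigma>] by (simp add: comm rel_ent_fun_scale[OF mp(1)])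
          finally show ?thesis .
        qed
        have P: "(\<Sum>\<sigma> \<in> ?E \<rightarrow>\<^sub>E UNIV. ?p \<sigma>) = measure \<rho> (cyl \<Lambda>' \<omega>)"
          using measure_cyl_split[OF \<rho>p \<Lambda> ee(2), of \<omega>] ee(1) by simp
        have P': "(\<Sum>\<sigma> \<in> ?E \<rightarrow>\<^sub>E UNIV. ?R * ?p' \<sigma>) = ?R * measure \<rho> (cyl \<Lambda>' ?\<omega>')"
          using measure_cyl_split[OF \<rho>p \<Lambda> ee(2), of ?\<omega>'] ee(1) by (simp add: sum_distrib_left)
        have b: "?R * measure \<rho> (cyl \<Lambda>' ?\<omega>') = m \<Lambda>' \<omega> * dens \<rho> \<Lambda>' ?\<omega>'" by (simp add: dens_def)
        have "?f \<Lambda>' \<omega> = rel_ent_fun (m \<Lambda>' \<omega> * dens \<rho> \<Lambda>' \<omega>) (m \<Lambda>' \<omega> * dens \<rho> \<Lambda>' ?\<omega>')"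
          using True by (simp add: rel_ent_fun_scale[OF \<mu>_pos[OF fin']])
        also have "\<dots> = rel_ent_fun (\<Sum>\<sigma> \<in> ?E \<rightarrow>\<^sub>E UNIV. ?p \<sigma>) (\<Sum>\<sigma> \<in> ?E \<rightarrow>\<^sub>E UNIV. ?R * ?p' \<sigma>)"
          unfolding P P' b by (simp only: m_dens[OF fin'])
        also have "\<dots> \<le> (\<Sum>\<sigma> \<in> ?E \<rightarrow>\<^sub>E UNIV. rel_ent_fun (?p \<sigma>) (?R * ?p' \<sigma>))"
          by (rule rel_ent_fun_sum[OF finE pp(1) mult_pos_pos[OF Rp pp(2)]])
        finally have 1: "?f \<Lambda>' \<omega> \<le> (\<Sum>\<sigma> \<in> ?E \<rightarrow>\<^sub>E UNIV. rel_ent_fun (?p \<sigma>) (?R * ?p' \<sigma>))" .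
        have 2: "(\<Sum>\<sigma> \<in> ?E \<rightarrow>\<^sub>E UNIV. ?p \<sigma> + ?R * ?p' \<sigma>) = ?w \<omega>"
          unfolding sum.distrib P P' b by (simp add: m_dens[OF fin'] distrib_left)
        have "(\<Sum>\<sigma> \<in> ?E \<rightarrow>\<^sub>E UNIV. rel_ent_fun (?p \<sigma>) (?R * ?p' \<sigma>) - \<epsilon> * (?p \<sigma> + ?R * ?p' \<sigma>))
            \<le> (\<Sum>\<sigma> \<in> ?E \<rightarrow>\<^sub>E UNIV. ?f \<Lambda> (override_on \<omega> \<sigma> ?E))"
          by (rule sum_mono) (rule pert)
        then show ?thesis
          using 1 unfolding sum_subtractf sum_distrib_left[symmetric] 2 by linarith
      qed
    qed
    have "(\<Sum>\<omega> \<in> \<Lambda>' \<rightarrow>\<^sub>E UNIV. ?f \<Lambda>' \<omega> - \<epsilon> * ?w \<omega>)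
        \<le> (\<Sum>\<omega> \<in> \<Lambda>' \<rightarrow>\<^sub>E UNIV. \<Sum>\<sigma> \<in> ?E \<rightarrow>\<^sub>E UNIV. ?f \<Lambda> (override_on \<omega> \<sigma> ?E))"
      by (rule sum_mono) (rule fibre)
    also have "\<dots> = local_prod \<rho> \<Lambda> \<Delta> \<xi>"
      unfolding local_prod_def using sum_configs_split[OF ee(2), of "?f \<Lambda>"] ee(1) by simp
    finally have "local_prod \<rho> \<Lambda>' \<Delta> \<xi> - \<epsilon> * (\<Sum>\<omega> \<in> \<Lambda>' \<rightarrow>\<^sub>E UNIV. ?w \<omega>) \<le> local_prod \<rho> \<Lambda> \<Delta> \<xi>"
      by (simp only: sum_subtractf sum_distrib_left[symmetric] local_prod_def)
    moreover have "\<epsilon> * (\<Sum>\<omega> \<in> \<Lambda>' \<rightarrow>\<^sub>E UNIV. ?w \<omega>) \<le> \<epsilon> * weight_bd"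
      using sum_weight_le[OF \<rho>p fin' \<Delta>] \<epsilon> by (intro mult_left_mono) auto
    ultimately show "local_prod \<rho> \<Lambda>' \<Delta> \<xi> - \<epsilon> * weight_bd \<le> local_prod \<rho> \<Lambda> \<Delta> \<xi>" by linarith
  qed
qed

lemma local_prod_translate:
  assumes \<rho>: "\<rho> \<in> ti_measures" and \<Lambda>: "finite \<Lambda>" and \<Delta>: "active \<Delta>" "\<xi> \<in> \<Delta> \<rightarrow>\<^sub>E UNIV"
  shows "local_prod \<rho> (translate i \<Lambda>) (translate i \<Delta>) (shift i \<xi>) = local_prod \<rho> \<Lambda> \<Delta> \<xi>"
proof -
  have d: "dens \<rho> (translate i \<Lambda>) (shift i \<omega>) = dens \<rho> \<Lambda> \<omega>" for \<omega>
    unfolding dens_def by (simp only: ti_measure_cyl[OF \<rho> \<Lambda>] ti_measure_cyl[OF ti_\<mu> \<Lambda>])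
  show ?thesis
    unfolding local_prod_def
    by (subst sum.reindex_bij_betw[OF bij_shift_PiE[of i \<Lambda>], symmetric])
      (simp only: override_on_shift d rate_shift[OF active_fin(1)[OF \<Delta>(1)] \<Delta>(2)] ti_measure_cyl[OF ti_\<mu> \<Lambda>])
qed

end

section \<open>Volume estimates\<close>

definition shell :: "nat \<Rightarrow> nat \<Rightarrow> ('d::finite) site set" where
  "shell r n = cube n - cube (n - r)"

lemma card_shell: "real (card (shell r n :: ('d::finite) site set))
  = real (card (cube n :: 'd site set)) - real (card (cube (n - r) :: 'd site set))"
proof -
  have "(cube (n - r) :: 'd site set) \<subseteq> cube n" by (rule cube_mono) simp
  then show ?thesis
    unfolding shell_def by (subst card_Diff_subset) (auto simp: of_nat_diff card_mono)
qed

lemma card_cube_pos: "0 < real (card (cube n :: ('d::finite) site set))"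
  by (simp add: card_cube)

lemma shell_ratio: "(\<lambda>n. real (card (shell r n :: ('d::finite) site set)) / real (card (cube n :: 'd site set))) \<longlonglongrightarrow> 0"
proof -
  let ?q = "\<lambda>n. 1 - 2 * real r / (2 * real n + 1)"
  have "(\<lambda>n. 2 * real r * inverse (real (Suc n))) \<longlonglongrightarrow> 2 * real r * 0"
    by (intro tendsto_mult tendsto_const LIMSEQ_inverse_real_of_nat)
  then have "(\<lambda>n. 2 * real r * inverse (real (Suc n))) \<longlonglongrightarrow> 0" by simp
  moreover have "norm (2 * real r / (2 * real n + 1)) \<le> 2 * real r * inverse (real (Suc n))" for n
  proof -
    have "inverse (2 * real n + 1) \<le> inverse (real (Suc n))" by (rule le_imp_inverse_le) simp_all
    then have "2 * real r * inverse (2 * real n + 1) \<le> 2 * real r * inverse (real (Suc n))"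
      by (rule mult_left_mono) simp
    then show ?thesis by (simp add: divide_inverse)
  qed
  ultimately have "(\<lambda>n. 2 * real r / (2 * real n + 1)) \<longlonglongrightarrow> 0"
    by (rule Lim_null_comparison[OF always_eventually[OF allI], rotated])
  then have "(\<lambda>n. 1 - ?q n ^ CARD('d)) \<longlonglongrightarrow> 1 - (1 - 0) ^ CARD('d)"
    by (intro tendsto_intros)
  \<comment> \<open>The formula is valid from \<open>r \<le> n\<close> on; for smaller n the
    truncated difference \<open>n - r\<close> is 0.\<close>
  moreover have "\<forall>\<^sub>F n in sequentially. 1 - ?q n ^ CARD('d)
      = real (card (shell r n :: 'd site set)) / real (card (cube n :: 'd site set))"
  proof (rule eventually_sequentiallyI[of r])
    fix n assume "r \<le> n"
    then have "?q n = (2 * real (n - r) + 1) / (2 * real n + 1)"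
      by (simp add: of_nat_diff field_simps)
    then show "1 - ?q n ^ CARD('d) = real (card (shell r n :: 'd site set)) / real (card (cube n :: 'd site set))"
      by (simp add: card_shell card_cube diff_divide_distrib power_divide add.commute)
  qed
  ultimately show ?thesis by (simp add: Lim_transform_eventually)
qed

lemma shell_small:
  assumes "\<epsilon> > 0"
  shows "\<forall>\<^sub>F n in sequentially. real (card (shell r n :: ('d::finite) site set)) \<le> \<epsilon> * real (card (cube n :: 'd site set))"
proof -
  have "\<forall>\<^sub>F n in sequentially. real (card (shell r n :: 'd site set)) / real (card (cube n :: 'd site set)) < \<epsilon>"
    by (rule order_tendstoD(2)[OF shell_ratio assms])
  then show ?thesis
  proof eventually_elim
  case (elim n)
  then show ?case using card_cube_pos[of n, where 'd = 'd] by (simp add: divide_less_eq less_imp_le)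
  qed
qed

text \<open>A finite nonempty set has no period: a translation by i changes the sum of the k-th
  coordinates by \<open>card \<Delta> * i $ k\<close>.\<close>

lemma translate_eq_imp_eq:
  fixes \<Delta> :: "('d::finite) site set"
  assumes "finite \<Delta>" "\<Delta> \<noteq> {}" "translate i \<Delta> = translate j \<Delta>"
  shows "i = j"
proof -
  have "(\<Sum>x\<in>translate i \<Delta>. x $ k) = (\<Sum>x\<in>\<Delta>. x $ k) + int (card \<Delta>) * i $ k" for i k
    by (subst sum.reindex[OF inj_on_subset[OF translate_inj subset_UNIV]]) (simp add: sum.distrib)
  from this[of _ i] this[of _ j] have eq: "int (card \<Delta>) * i $ k = int (card \<Delta>) * j $ k" for k
    unfolding assms(3) by (metis add_left_cancel)
  have "int (card \<Delta>) \<noteq> 0" using assms(1,2) by simp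
  then have "i $ k = j $ k" for k using eq[of k] mult_cancel_left[of "int (card \<Delta>)" "i $ k" "j $ k"] by blast
  then show ?thesis by (simp add: vec_eq_iff)
qed

section \<open>Bulk and boundary transitions of a cube\<close>

context ips_gibbs
begin

text \<open>For these sets the spins in the cube determine the rates up to the accuracy that belongs
  to the radius r.\<close>

definition bulk :: "nat \<Rightarrow> nat \<Rightarrow> 'a site set \<Rightarrow> bool" where
  "bulk r n \<Delta> \<longleftrightarrow> (\<forall>x\<in>\<Delta>. \<forall>y. y - x \<in> cube r \<longrightarrow> y \<in> cube n)"

lemma card_UN_mult:
  "finite \<Lambda> \<Longrightarrow> card (\<Union>x\<in>\<Lambda>. {\<Delta>. active \<Delta> \<and> x \<in> \<Delta>}) \<le> mult_bd * card \<Lambda>"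
proof -
  assume "finite \<Lambda>"
  then have "card (\<Union>x\<in>\<Lambda>. {\<Delta>. active \<Delta> \<and> x \<in> \<Delta>}) \<le> (\<Sum>x\<in>\<Lambda>. card {\<Delta>. active \<Delta> \<and> x \<in> \<Delta>})"
    by (rule card_UN_le)
  also have "\<dots> \<le> (\<Sum>x\<in>\<Lambda>. mult_bd)" by (intro sum_mono mult_bd(2))
  finally show ?thesis by (simp add: mult.commute)
qed

lemma finite_UN_mult: "finite \<Lambda> \<Longrightarrow> finite (\<Union>x\<in>\<Lambda>. {\<Delta>. active \<Delta> \<and> x \<in> \<Delta>})"
  using mult_bd(1) by blast

lemma card_act_cube: "card (act (cube n)) \<le> mult_bd * card (cube n :: 'a site set)"
proof -
  have "act (cube n) = (\<Union>x\<in>cube n. {\<Delta>. active \<Delta> \<and> x \<in> \<Delta>})" by (auto simp: act_def)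
  then show ?thesis using card_UN_mult[of "cube n"] by simp
qed

text \<open>A point of \<Delta> in the cube is at most \<open>rng + r\<close> away from a point
  outside it, via another point of \<Delta>, so it lies in the shell of that thickness. The bound on
  n makes the truncated subtraction exact.\<close>

lemma card_not_bulk:
  assumes n: "r + rng \<le> n"
  shows "card {\<Delta> \<in> act (cube n). \<not> bulk r n \<Delta>} \<le> mult_bd * card (shell (r + rng) n :: 'a site set)"
proof -
  have "{\<Delta> \<in> act (cube n). \<not> bulk r n \<Delta>} \<subseteq> (\<Union>x\<in>shell (r + rng) n. {\<Delta>. active \<Delta> \<and> x \<in> \<Delta>})"
  proof
    fix \<Delta> assume "\<Delta> \<in> {\<Delta> \<in> act (cube n). \<not> bulk r n \<Delta>}"
    then obtain z x y where *: "active \<Delta>" "z \<in> \<Delta>" "z \<in> cube n" "x \<in> \<Delta>" "y - x \<in> cube r" "y \<notin> cube n"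
      by (auto simp: act_def bulk_def)
    have "z \<notin> cube (n - (r + rng))"
    proof
      assume z: "z \<in> cube (n - (r + rng))"
      have "z + ((y - x) + (x - z)) \<in> cube (n - (r + rng) + (r + rng))"
        by (rule cube_add[OF z cube_add[OF *(5) rng[OF *(1,2,4)]]])
      then show False using *(6) n by simp
    qed
    with * show "\<Delta> \<in> (\<Union>x\<in>shell (r + rng) n. {\<Delta>. active \<Delta> \<and> x \<in> \<Delta>})"
      by (auto simp: shell_def)
  qed
  moreover have fin: "finite (shell (r + rng) n :: 'a site set)" by (simp add: shell_def)
  ultimately have "card {\<Delta> \<in> act (cube n). \<not> bulk r n \<Delta>} \<le> card (\<Union>x\<in>shell (r + rng) n. {\<Delta>. active \<Delta> \<and> x \<in> \<Delta>})"
    by (intro card_mono finite_UN_mult)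
  then show ?thesis using card_UN_mult[OF fin] by linarith
qed

definition bulk_prod :: "('a, 'b) config measure \<Rightarrow> nat \<Rightarrow> nat \<Rightarrow> real" where
  "bulk_prod \<rho> r n = (\<Sum>\<Delta> | \<Delta> \<in> act (cube n) \<and> bulk r n \<Delta>. \<Sum>\<xi> \<in> \<Delta> \<rightarrow>\<^sub>E UNIV. local_prod \<rho> (cube n) \<Delta> \<xi>)"

lemma bulk_prod_nonneg: "positive_measure \<rho> \<Longrightarrow> 0 \<le> bulk_prod \<rho> r n"
  unfolding bulk_prod_def by (intro sum_nonneg local_prod_nonneg) auto

text \<open>Shared bookkeeping for the one-sided and the two-sided estimate: bulk errors a are paid
  per volume, boundary errors b per surface.\<close>

lemma sum_act_estimate:
  fixes f :: "'a site set \<Rightarrow> ('a, 'b) config \<Rightarrow> real"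
  assumes n: "r + rng \<le> n" and ab: "0 \<le> a" "0 \<le> b"
    and bulk: "\<And>\<Delta> \<xi>. active \<Delta> \<Longrightarrow> bulk r n \<Delta> \<Longrightarrow> \<xi> \<in> \<Delta> \<rightarrow>\<^sub>E UNIV \<Longrightarrow> f \<Delta> \<xi> \<le> k * local_prod \<rho> (cube n) \<Delta> \<xi> + a"
    and bdry: "\<And>\<Delta> \<xi>. active \<Delta> \<Longrightarrow> \<xi> \<in> \<Delta> \<rightarrow>\<^sub>E UNIV \<Longrightarrow> f \<Delta> \<xi> \<le> b"
  shows "(\<Sum>\<Delta>\<in>act (cube n). \<Sum>\<xi> \<in> \<Delta> \<rightarrow>\<^sub>E UNIV. f \<Delta> \<xi>) \<le> k * bulk_prod \<rho> r n
    + real mult_bd * configs_bd * (a * real (card (cube n :: 'a site set)) + b * real (card (shell (r + rng) n :: 'a site set)))"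
proof -
  let ?B = "{\<Delta> \<in> act (cube n). bulk r n \<Delta>}" and ?N = "{\<Delta> \<in> act (cube n). \<not> bulk r n \<Delta>}"
  have fin: "finite (act (cube n))" by (rule finite_act) simp
  have act: "active \<Delta>" if "\<Delta> \<in> act (cube n)" for \<Delta> using that by (simp add: act_def)
  have const: "(\<Sum>\<xi> \<in> \<Delta> \<rightarrow>\<^sub>E (UNIV :: 'b set). a') \<le> configs_bd * a'" if "active \<Delta>" "0 \<le> a'" for \<Delta> :: "'a site set" and a'
    using configs_bd[OF that(1) order_refl] that(2) by (simp add: mult_right_mono)
  have "(\<Sum>\<Delta>\<in>act (cube n). \<Sum>\<xi> \<in> \<Delta> \<rightarrow>\<^sub>E UNIV. f \<Delta> \<xi>)
      = (\<Sum>\<Delta>\<in>?B. \<Sum>\<xi> \<in> \<Delta> \<rightarrow>\<^sub>E UNIV. f \<Delta> \<xi>) + (\<Sum>\<Delta>\<in>?N. \<Sum>\<xi> \<in> \<Delta> \<rightarrow>\<^sub>E UNIV. f \<Delta> \<xi>)"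
  proof -
    have "act (cube n) = ?B \<union> ?N" by auto
    moreover have "?B \<inter> ?N = {}" by auto
    ultimately show ?thesis using fin sum.union_disjoint[of ?B ?N "\<lambda>\<Delta>. \<Sum>\<xi> \<in> \<Delta> \<rightarrow>\<^sub>E UNIV. f \<Delta> \<xi>"] by simp
  qed
  also have "(\<Sum>\<Delta>\<in>?B. \<Sum>\<xi> \<in> \<Delta> \<rightarrow>\<^sub>E UNIV. f \<Delta> \<xi>)
      \<le> (\<Sum>\<Delta>\<in>?B. k * (\<Sum>\<xi> \<in> \<Delta> \<rightarrow>\<^sub>E UNIV. local_prod \<rho> (cube n) \<Delta> \<xi>) + configs_bd * a)"
  proof (rule sum_mono)
    fix \<Delta> assume "\<Delta> \<in> ?B"
    then have \<Delta>: "active \<Delta>" "bulk r n \<Delta>" using act by auto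
    have "(\<Sum>\<xi> \<in> \<Delta> \<rightarrow>\<^sub>E UNIV. f \<Delta> \<xi>) \<le> (\<Sum>\<xi> \<in> \<Delta> \<rightarrow>\<^sub>E UNIV. k * local_prod \<rho> (cube n) \<Delta> \<xi> + a)"
      by (intro sum_mono bulk \<Delta>)
    then show "(\<Sum>\<xi> \<in> \<Delta> \<rightarrow>\<^sub>E UNIV. f \<Delta> \<xi>) \<le> k * (\<Sum>\<xi> \<in> \<Delta> \<rightarrow>\<^sub>E UNIV. local_prod \<rho> (cube n) \<Delta> \<xi>) + configs_bd * a"
      using const[OF \<Delta>(1) ab(1)] unfolding sum.distrib sum_distrib_left by linarith
  qed
  also have "\<dots> = k * bulk_prod \<rho> r n + real (card ?B) * (configs_bd * a)"
    by (simp add: bulk_prod_def sum.distrib sum_distrib_left)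
  also have "real (card ?B) * (configs_bd * a) \<le> real mult_bd * real (card (cube n :: 'a site set)) * (configs_bd * a)"
  proof (rule mult_right_mono)
    have "card ?B \<le> card (act (cube n))" using fin by (intro card_mono) auto
    then have "card ?B \<le> mult_bd * card (cube n :: 'a site set)" using card_act_cube[of n] by linarith
    then show "real (card ?B) \<le> real mult_bd * real (card (cube n :: 'a site set))"
      by (simp only: of_nat_mult[symmetric] of_nat_le_iff)
  qed (use configs_bd_pos ab in auto)
  also have "(\<Sum>\<Delta>\<in>?N. \<Sum>\<xi> \<in> \<Delta> \<rightarrow>\<^sub>E UNIV. f \<Delta> \<xi>) \<le> (\<Sum>\<Delta>\<in>?N. configs_bd * b)"
  proof (rule sum_mono)
    fix \<Delta> assume "\<Delta> \<in> ?N"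
    then have \<Delta>: "active \<Delta>" using act by auto
    have "(\<Sum>\<xi> \<in> \<Delta> \<rightarrow>\<^sub>E UNIV. f \<Delta> \<xi>) \<le> (\<Sum>\<xi> \<in> \<Delta> \<rightarrow>\<^sub>E (UNIV :: 'b set). b)"
      by (intro sum_mono bdry \<Delta>)
    then show "(\<Sum>\<xi> \<in> \<Delta> \<rightarrow>\<^sub>E UNIV. f \<Delta> \<xi>) \<le> configs_bd * b"
      using const[OF \<Delta> ab(2)] by linarith
  qed
  also have "\<dots> = real (card ?N) * (configs_bd * b)" by simp
  also have "\<dots> \<le> real mult_bd * real (card (shell (r + rng) n :: 'a site set)) * (configs_bd * b)"
  proof (rule mult_right_mono)
    show "real (card ?N) \<le> real mult_bd * real (card (shell (r + rng) n :: 'a site set))"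
      using card_not_bulk[OF n] by (simp only: of_nat_mult[symmetric] of_nat_le_iff)
  qed (use configs_bd_pos ab in auto)
  finally show ?thesis by (simp add: algebra_simps)
qed

section \<open>Entropy rates per unit volume\<close>

lemma bulk_near:
  assumes "\<epsilon> > 0"
  shows "\<exists>r0. \<forall>r n \<Delta> \<xi> \<omega> \<eta>. r0 \<le> r \<longrightarrow> active \<Delta> \<longrightarrow> bulk r n \<Delta> \<longrightarrow> \<xi> \<in> \<Delta> \<rightarrow>\<^sub>E UNIV \<longrightarrow>
    \<eta> \<in> cyl (cube n) \<omega> \<longrightarrow> \<bar>c \<Delta> \<eta> \<xi> - c \<Delta> \<omega> \<xi>\<bar> \<le> \<epsilon>"
proof -
  obtain r0 where r0: "\<forall>\<Delta>\<in>fin_sets. \<forall>x\<in>\<Delta>. \<forall>\<xi> \<in> \<Delta> \<rightarrow>\<^sub>E UNIV. \<forall>\<eta> \<eta>'.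
    (\<forall>y. y - x \<in> cube r0 \<longrightarrow> \<eta> y = \<eta>' y) \<longrightarrow> \<bar>c \<Delta> \<eta> \<xi> - c \<Delta> \<eta>' \<xi>\<bar> \<le> \<epsilon>"
    using rate_local[OF assms] by auto
  show ?thesis
  proof (intro exI[of _ r0] allI impI)
    fix r n \<Delta> and \<xi> \<omega> \<eta> :: "('a, 'b) config"
    assume r: "r0 \<le> r" and \<Delta>: "active \<Delta>" "bulk r n \<Delta>" "\<xi> \<in> \<Delta> \<rightarrow>\<^sub>E UNIV" and \<eta>: "\<eta> \<in> cyl (cube n) \<omega>"
    obtain x where x: "x \<in> \<Delta>" using active_fin(3)[OF \<Delta>(1)] by blast
    have "\<forall>y. y - x \<in> cube r0 \<longrightarrow> \<eta> y = \<omega> y"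
    proof (intro allI impI)
      fix y assume "y - x \<in> cube r0"
      then have "y - x \<in> cube r" using cube_mono[OF r] by blast
      then have "y \<in> cube n" using \<Delta>(2) x by (auto simp: bulk_def)
      then show "\<eta> y = \<omega> y" using \<eta> by (simp add: cyl_def)
    qed
    then show "\<bar>c \<Delta> \<eta> \<xi> - c \<Delta> \<omega> \<xi>\<bar> \<le> \<epsilon>"
      using r0 active_fin(1)[OF \<Delta>(1)] x \<Delta>(3) by blast
  qed
qed

text \<open>The 2 covers the bulk error, the term with l the boundary error. Here l bounds the
  log-ratio of densities; it is 0 in the one-sided estimate.\<close>

definition vol_const :: "real \<Rightarrow> real" where
  "vol_const l = real mult_bd * configs_bd * (weight_bd * (2 + rate_sup * (l + 1)))"

lemma vol_const_nonneg: "0 \<le> l \<Longrightarrow> 0 \<le> vol_const l"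
  unfolding vol_const_def using configs_bd_pos weight_bd_pos rate_sup(1)
  by (intro mult_nonneg_nonneg add_nonneg_nonneg) auto

lemma vol_const_bound:
  assumes l: "0 \<le> l" and nn: "0 \<le> \<epsilon>" "0 \<le> V" "0 \<le> S"
  shows "real mult_bd * configs_bd * (2 * \<epsilon> * weight_bd * V + rate_sup * (l + 1) * weight_bd * S)
    \<le> vol_const l * (\<epsilon> * V + S)"
proof -
  have "2 * \<epsilon> * weight_bd * V + rate_sup * (l + 1) * weight_bd * S
      \<le> weight_bd * (2 + rate_sup * (l + 1)) * (\<epsilon> * V + S)"
  proof -
    have "0 \<le> weight_bd * (rate_sup * (l + 1) * (\<epsilon> * V))" "0 \<le> weight_bd * (2 * S)"
      using assms weight_bd_pos rate_sup(1) by (auto intro!: mult_nonneg_nonneg)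
    then show ?thesis by (simp add: algebra_simps)
  qed
  then have "real mult_bd * configs_bd * (2 * \<epsilon> * weight_bd * V + rate_sup * (l + 1) * weight_bd * S)
      \<le> real mult_bd * configs_bd * (weight_bd * (2 + rate_sup * (l + 1)) * (\<epsilon> * V + S))"
    using configs_bd_pos by (intro mult_left_mono) auto
  then show ?thesis by (simp only: vol_const_def mult.assoc)
qed

text \<open>Both radius and constants are independent of \<rho>, so the bound can be used at all
  times of a trajectory.\<close>

lemma entropy_rate_upper:
  assumes \<epsilon>: "0 < \<epsilon>" "\<epsilon> \<le> rate_inf / 2"
  shows "\<exists>r0. \<forall>r n \<rho>. r0 \<le> r \<longrightarrow> r + rng \<le> n \<longrightarrow> positive_measure \<rho> \<longrightarrow>
    entropy_rate \<rho> (cube n) \<le> - (rate_inf / 2) * bulk_prod \<rho> r n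
      + vol_const 0 * (\<epsilon> * real (card (cube n :: 'a site set)) + real (card (shell (r + rng) n :: 'a site set)))"
proof -
  obtain r0 where "\<forall>r n \<Delta> \<xi> \<omega> \<eta>. r0 \<le> r \<longrightarrow> active \<Delta> \<longrightarrow> bulk r n \<Delta> \<longrightarrow> \<xi> \<in> \<Delta> \<rightarrow>\<^sub>E UNIV \<longrightarrow>
    \<eta> \<in> cyl (cube n) \<omega> \<longrightarrow> \<bar>c \<Delta> \<eta> \<xi> - c \<Delta> \<omega> \<xi>\<bar> \<le> \<epsilon>"
    using bulk_near[OF \<epsilon>(1)] by (elim exE)
  note near = this[rule_format]
  show ?thesis
  proof (intro exI[of _ r0] allI impI)
    fix r n and \<rho> :: "('a, 'b) config measure" assume r: "r0 \<le> r" and n: "r + rng \<le> n" and \<rho>: "positive_measure \<rho>"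
    let ?V = "real (card (cube n :: 'a site set))" and ?S = "real (card (shell (r + rng) n :: 'a site set))"
    have "entropy_rate \<rho> (cube n) = (\<Sum>\<Delta>\<in>act (cube n). \<Sum>\<xi> \<in> \<Delta> \<rightarrow>\<^sub>E UNIV. - prod_term \<rho> (cube n) \<Delta> \<xi>)"
      using entropy_rate_eq[OF positive_measureD(1)[OF \<rho>], of "cube n"] by (simp add: sum_negf)
    also have "\<dots> \<le> - (rate_inf / 2) * bulk_prod \<rho> r n
      + real mult_bd * configs_bd * (2 * \<epsilon> * weight_bd * ?V + rate_sup * weight_bd * ?S)"
    proof (rule sum_act_estimate[OF n])
      fix \<Delta> \<xi> assume \<Delta>: "active \<Delta>" "\<xi> \<in> \<Delta> \<rightarrow>\<^sub>E (UNIV :: 'b set)"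
      show "- prod_term \<rho> (cube n) \<Delta> \<xi> \<le> rate_sup * weight_bd"
        using prod_term_lower[OF \<rho> _ \<Delta>, of "cube n"] by simp
      assume "bulk r n \<Delta>"
      from prod_term_bulk(1)[OF \<rho> finite_cube[of n] \<Delta> \<epsilon> near[OF r \<Delta>(1) this \<Delta>(2)]]
      show "- prod_term \<rho> (cube n) \<Delta> \<xi> \<le> - (rate_inf / 2) * local_prod \<rho> (cube n) \<Delta> \<xi> + 2 * \<epsilon> * weight_bd"
        by simp
    qed (use \<epsilon> weight_bd_pos rate_sup(1) in auto)
    also have "real mult_bd * configs_bd * (2 * \<epsilon> * weight_bd * ?V + rate_sup * weight_bd * ?S)
        \<le> vol_const 0 * (\<epsilon> * ?V + ?S)"
      using vol_const_bound[of 0 \<epsilon> ?V ?S] \<epsilon> by simp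
    finally show "entropy_rate \<rho> (cube n) \<le> - (rate_inf / 2) * bulk_prod \<rho> r n + vol_const 0 * (\<epsilon> * ?V + ?S)"
      by simp
  qed
qed

text \<open>In contrast to the upper bound, the boundary term involves the constant d of
  non-nullness of \<rho>.\<close>

lemma entropy_rate_abs:
  assumes \<epsilon>: "0 < \<epsilon>" "\<epsilon> \<le> rate_inf / 2" and d: "0 < d"
  shows "\<exists>r0. \<forall>r n \<rho>. r0 \<le> r \<longrightarrow> r + rng \<le> n \<longrightarrow> positive_measure \<rho> \<longrightarrow> site_nonnull d \<rho> \<longrightarrow>
    \<bar>entropy_rate \<rho> (cube n)\<bar> \<le> (rate_sup + rate_inf) * bulk_prod \<rho> r n
      + vol_const \<bar>ln (d ^ card_bd * \<delta> ^ card_bd)\<bar>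
        * (\<epsilon> * real (card (cube n :: 'a site set)) + real (card (shell (r + rng) n :: 'a site set)))"
proof -
  obtain r0 where "\<forall>r n \<Delta> \<xi> \<omega> \<eta>. r0 \<le> r \<longrightarrow> active \<Delta> \<longrightarrow> bulk r n \<Delta> \<longrightarrow> \<xi> \<in> \<Delta> \<rightarrow>\<^sub>E UNIV \<longrightarrow>
    \<eta> \<in> cyl (cube n) \<omega> \<longrightarrow> \<bar>c \<Delta> \<eta> \<xi> - c \<Delta> \<omega> \<xi>\<bar> \<le> \<epsilon>"
    using bulk_near[OF \<epsilon>(1)] by (elim exE)
  note near = this[rule_format]
  let ?l = "\<bar>ln (d ^ card_bd * \<delta> ^ card_bd)\<bar>"
  show ?thesis
  proof (intro exI[of _ r0] allI impI)
    fix r n and \<rho> :: "('a, 'b) config measure" assume r: "r0 \<le> r" and n: "r + rng \<le> n" and \<rho>: "positive_measure \<rho>" and nn: "site_nonnull d \<rho>"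
    let ?V = "real (card (cube n :: 'a site set))" and ?S = "real (card (shell (r + rng) n :: 'a site set))"
    have "\<bar>entropy_rate \<rho> (cube n)\<bar> = \<bar>\<Sum>\<Delta>\<in>act (cube n). \<Sum>\<xi> \<in> \<Delta> \<rightarrow>\<^sub>E UNIV. prod_term \<rho> (cube n) \<Delta> \<xi>\<bar>"
      by (simp only: entropy_rate_eq[OF positive_measureD(1)[OF \<rho>] finite_cube, symmetric] abs_minus_cancel)
    also have "\<dots> \<le> (\<Sum>\<Delta>\<in>act (cube n). \<Sum>\<xi> \<in> \<Delta> \<rightarrow>\<^sub>E UNIV. \<bar>prod_term \<rho> (cube n) \<Delta> \<xi>\<bar>)"
      by (intro order_trans[OF sum_abs] sum_mono sum_abs)
    also have "\<dots> \<le> (rate_sup + rate_inf) * bulk_prod \<rho> r n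
      + real mult_bd * configs_bd * (2 * \<epsilon> * weight_bd * ?V + rate_sup * (?l + 1) * weight_bd * ?S)"
    proof (rule sum_act_estimate[OF n])
      fix \<Delta> \<xi> assume \<Delta>: "active \<Delta>" "\<xi> \<in> \<Delta> \<rightarrow>\<^sub>E (UNIV :: 'b set)"
      show "\<bar>prod_term \<rho> (cube n) \<Delta> \<xi>\<bar> \<le> rate_sup * (?l + 1) * weight_bd"
        by (rule prod_term_abs[OF \<rho> nn d _ \<Delta>]) simp
      assume "bulk r n \<Delta>"
      from prod_term_bulk(2)[OF \<rho> finite_cube[of n] \<Delta> \<epsilon> near[OF r \<Delta>(1) this \<Delta>(2)]]
      show "\<bar>prod_term \<rho> (cube n) \<Delta> \<xi>\<bar> \<le> (rate_sup + rate_inf) * local_prod \<rho> (cube n) \<Delta> \<xi> + 2 * \<epsilon> * weight_bd"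
        by simp
    qed (use \<epsilon> weight_bd_pos rate_sup(1) in auto)
    also have "real mult_bd * configs_bd * (2 * \<epsilon> * weight_bd * ?V + rate_sup * (?l + 1) * weight_bd * ?S)
        \<le> vol_const ?l * (\<epsilon> * ?V + ?S)"
      using \<epsilon> by (intro vol_const_bound) auto
    finally show "\<bar>entropy_rate \<rho> (cube n)\<bar> \<le> (rate_sup + rate_inf) * bulk_prod \<rho> r n
        + vol_const ?l * (\<epsilon> * ?V + ?S)"
      by simp
  qed
qed

text \<open>The order of choices matters: \<epsilon> comes first, the radius r is found afterwards
  depending on \<epsilon>, and the volume must then be large depending on r.\<close>

lemma error_small:
  assumes "0 \<le> C" "0 < e"
  shows "\<exists>\<epsilon>. 0 < \<epsilon> \<and> \<epsilon> \<le> rate_inf / 2 \<and>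
    (\<forall>r. \<forall>\<^sub>F n in sequentially. C * (\<epsilon> * real (card (cube n :: 'a site set)) + real (card (shell r n :: 'a site set)))
      \<le> e * real (card (cube n :: 'a site set)))"
proof -
  define \<epsilon> where "\<epsilon> = min (rate_inf / 2) (e / (2 * (C + 1)))"
  have \<epsilon>: "0 < \<epsilon>" "\<epsilon> \<le> rate_inf / 2" "\<epsilon> \<le> e / (2 * (C + 1))"
    unfolding \<epsilon>_def using assms rate_inf(1) by (simp, intro min.cobounded1, intro min.cobounded2)
  have C\<epsilon>: "C * (2 * \<epsilon>) \<le> e"
  proof -
    have "C * (2 * \<epsilon>) \<le> (C + 1) * (2 * (e / (2 * (C + 1))))"
      using assms \<epsilon> by (intro mult_mono) auto
    also have "\<dots> = e"
    proof -
      have "D * (2 * (e / (2 * D))) = e" if "0 < D" for D :: real using that by simp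
      from this[of "C + 1"] show ?thesis using assms(1) by (simp only: add_nonneg_pos zero_less_one)
    qed
    finally show ?thesis .
  qed
  show ?thesis
  proof (intro exI[of _ \<epsilon>] conjI allI \<epsilon>(1,2))
    fix r
    show "\<forall>\<^sub>F n in sequentially. C * (\<epsilon> * real (card (cube n :: 'a site set)) + real (card (shell r n :: 'a site set)))
      \<le> e * real (card (cube n :: 'a site set))"
      using shell_small[where 'd = 'a, OF \<epsilon>(1), of r]
    proof eventually_elim
      case (elim n)
      let ?V = "real (card (cube n :: 'a site set))"
      have "C * (\<epsilon> * ?V + real (card (shell r n :: 'a site set))) \<le> C * (\<epsilon> * ?V + \<epsilon> * ?V)"
        using elim assms by (intro mult_left_mono) auto
      also have "\<dots> = C * (2 * \<epsilon>) * ?V" by (simp add: algebra_simps)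
      also have "\<dots> \<le> e * ?V" using C\<epsilon> by (intro mult_right_mono) auto
      finally show ?case .
    qed
  qed
qed

text \<open>The bulk contribution has the favourable sign and is dropped; only errors of order
  \<epsilon> V plus surface remain.\<close>

lemma entropy_rate_le_small:
  assumes "0 < e"
  shows "\<forall>\<^sub>F n in sequentially. \<forall>\<rho>. positive_measure \<rho> \<longrightarrow>
    entropy_rate \<rho> (cube n) \<le> e * real (card (cube n :: 'a site set))"
proof -
  obtain \<epsilon> where \<epsilon>: "0 < \<epsilon>" "\<epsilon> \<le> rate_inf / 2"
    and small: "\<forall>r. \<forall>\<^sub>F n in sequentially. vol_const 0 * (\<epsilon> * real (card (cube n :: 'a site set)) + real (card (shell r n :: 'a site set)))
      \<le> e * real (card (cube n :: 'a site set))"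
    using error_small[OF vol_const_nonneg[OF order_refl] assms] by (elim exE conjE)
  obtain r where "\<forall>r' n \<rho>. r \<le> r' \<longrightarrow> r' + rng \<le> n \<longrightarrow> positive_measure \<rho> \<longrightarrow>
    entropy_rate \<rho> (cube n) \<le> - (rate_inf / 2) * bulk_prod \<rho> r' n
      + vol_const 0 * (\<epsilon> * real (card (cube n :: 'a site set)) + real (card (shell (r' + rng) n :: 'a site set)))"
    using entropy_rate_upper[OF \<epsilon>] by (elim exE)
  note r = this[rule_format, OF order_refl]
  show ?thesis
    using small[rule_format, of "r + rng"] eventually_ge_at_top[of "r + rng"]
  proof eventually_elim
    case (elim n)
    show ?case
    proof (intro allI impI)
      fix \<rho> :: "('a, 'b) config measure" assume \<rho>: "positive_measure \<rho>"
      have "0 \<le> rate_inf / 2 * bulk_prod \<rho> r n" using bulk_prod_nonneg[OF \<rho>] rate_inf(1) by simp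
      with r[OF elim(2) \<rho>] elim(1) show "entropy_rate \<rho> (cube n) \<le> e * real (card (cube n :: 'a site set))" by simp
    qed
  qed
qed

text \<open>One uniformly positive contribution is repeated at every translate inside the cube. Seen
  from a translate the cube is off centre, which is why the lower bound is assumed for all volumes
  containing \<Lambda>.\<close>

lemma bulk_prod_lower:
  assumes \<Delta>: "active \<Delta>" "\<xi> \<in> \<Delta> \<rightarrow>\<^sub>E UNIV" and k: "\<Delta> \<subseteq> cube k" "\<Lambda> \<subseteq> cube k" "k + r \<le> n"
    and \<rho>: "positive_measure \<rho>" "\<rho> \<in> ti_measures"
    and low: "\<And>L. finite L \<Longrightarrow> \<Lambda> \<subseteq> L \<Longrightarrow> s \<le> local_prod \<rho> L \<Delta> \<xi>"
  shows "s * real (card (cube (n - (k + r)) :: 'a site set)) \<le> bulk_prod \<rho> r n"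
proof -
  let ?I = "cube (n - (k + r)) :: 'a site set"
  let ?f = "\<lambda>\<Delta>. \<Sum>\<xi> \<in> \<Delta> \<rightarrow>\<^sub>E UNIV. local_prod \<rho> (cube n) \<Delta> \<xi>"
  have inj: "inj_on (\<lambda>i. translate i \<Delta>) ?I"
    using translate_eq_imp_eq[OF active_fin(2)[OF \<Delta>(1)] active_fin(3)[OF \<Delta>(1)]] by (auto intro: inj_onI)
  have shifted: "x + i \<in> cube (n - r)" if "x \<in> cube k" "i \<in> ?I" for x i
    using cube_add[OF that] k(3) by simp
  have "s * real (card ?I) = (\<Sum>i\<in>?I. s)" by simp
  also have "\<dots> \<le> (\<Sum>i\<in>?I. ?f (translate i \<Delta>))"
  proof (rule sum_mono)
    fix i assume i: "i \<in> ?I"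
    \<comment> \<open>Moving the cube back by i turns the term of the translated set into a term of
      \<Delta> itself.\<close>
    have tr: "translate i (translate (- i) (cube n)) = cube n" by (simp add: image_image)
    have "\<Lambda> \<subseteq> translate (- i) (cube n)"
    proof
      fix x assume "x \<in> \<Lambda>"
      then have "x + i \<in> cube n" using shifted[OF _ i] k(2) cube_mono[of "n - r" n] by auto
      then show "x \<in> translate (- i) (cube n)" by (intro mem_translate[THEN iffD2]) simp
    qed
    then have "s \<le> local_prod \<rho> (translate (- i) (cube n)) \<Delta> \<xi>" by (intro low) auto
    also have "\<dots> = local_prod \<rho> (cube n) (translate i \<Delta>) (shift i \<xi>)"
      using local_prod_translate[OF \<rho>(2) _ \<Delta>, of "translate (- i) (cube n)" i] unfolding tr by simp
    also have "\<dots> \<le> ?f (translate i \<Delta>)"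
      using shift_PiE[of i \<xi> \<Delta>] \<Delta>(2) active_fin(2)[OF \<Delta>(1)]
      by (intro member_le_sum local_prod_nonneg[OF \<rho>(1)] finite_configs) auto
    finally show "s \<le> ?f (translate i \<Delta>)" .
  qed
  also have "\<dots> = (\<Sum>\<Delta>'\<in>(\<lambda>i. translate i \<Delta>) ` ?I. ?f \<Delta>')" by (rule sum.reindex_cong[OF inj refl refl, symmetric])
  also have "\<dots> \<le> (\<Sum>\<Delta>' | \<Delta>' \<in> act (cube n) \<and> bulk r n \<Delta>'. ?f \<Delta>')"
  proof (rule sum_mono2)
    show "finite {\<Delta>' \<in> act (cube n). bulk r n \<Delta>'}" using finite_act[of "cube n"] by simp
    show "(\<lambda>i. translate i \<Delta>) ` ?I \<subseteq> {\<Delta>' \<in> act (cube n). bulk r n \<Delta>'}"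
    proof clarify
      fix i assume i: "i \<in> ?I"
      have sub: "x \<in> cube (n - r)" if "x \<in> translate i \<Delta>" for x
        using shifted[OF _ i, of "x - i"] that k(1) unfolding mem_translate by auto
      have "active (translate i \<Delta>)" using \<Delta>(1) by (simp only: active_translate)
      moreover have "translate i \<Delta> \<inter> cube n \<noteq> {}"
        using sub active_fin(3)[OF \<Delta>(1)] cube_mono[of "n - r" n] by fastforce
      moreover have "bulk r n (translate i \<Delta>)"
        unfolding bulk_def
      proof (intro ballI allI impI)
        fix x y assume "x \<in> translate i \<Delta>" "y - x \<in> cube r"
        from cube_add[OF sub[OF this(1)] this(2)] show "y \<in> cube n" using k(3) by simp
      qed
      ultimately show "translate i \<Delta> \<in> act (cube n) \<and> bulk r n (translate i \<Delta>)" by (simp add: act_def)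
    qed
  qed (intro sum_nonneg local_prod_nonneg[OF \<rho>(1)]; simp)
  finally show ?thesis by (simp add: bulk_prod_def)
qed

text \<open>A production of 2s in a fixed window persists as s in all larger volumes, and at least
  half of the sites of a large cube carry a translate.\<close>

lemma entropy_rate_negative:
  assumes \<Delta>: "active \<Delta>" "\<xi> \<in> \<Delta> \<rightarrow>\<^sub>E UNIV" and \<Lambda>: "finite \<Lambda>" and s: "0 < s"
    and mono: "\<And>L \<rho>. finite L \<Longrightarrow> \<Lambda> \<subseteq> L \<Longrightarrow> positive_measure \<rho> \<Longrightarrow>
      local_prod \<rho> \<Lambda> \<Delta> \<xi> - s \<le> local_prod \<rho> L \<Delta> \<xi>"
  shows "\<forall>\<^sub>F n in sequentially. \<forall>\<rho>. positive_measure \<rho> \<longrightarrow> \<rho> \<in> ti_measures \<longrightarrow> 2 * s \<le> local_prod \<rho> \<Lambda> \<Delta> \<xi> \<longrightarrow>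
    entropy_rate \<rho> (cube n) \<le> - (rate_inf * s / 8) * real (card (cube n :: 'a site set))"
proof -
  \<comment> \<open>The production is at least \<open>rate_inf / 2 * (s * (?V / 2))\<close>, twice
    the decay claimed, and the errors may consume the other half.\<close>
  have e: "0 < rate_inf * s / 8" using s rate_inf(1) by simp
  obtain \<epsilon> where \<epsilon>: "0 < \<epsilon>" "\<epsilon> \<le> rate_inf / 2"
    and small: "\<forall>r. \<forall>\<^sub>F n in sequentially. vol_const 0 * (\<epsilon> * real (card (cube n :: 'a site set)) + real (card (shell r n :: 'a site set)))
      \<le> rate_inf * s / 8 * real (card (cube n :: 'a site set))"
    using error_small[OF vol_const_nonneg[OF order_refl] e] by (elim exE conjE)
  obtain r where "\<forall>r' n \<rho>. r \<le> r' \<longrightarrow> r' + rng \<le> n \<longrightarrow> positive_measure \<rho> \<longrightarrow>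
    entropy_rate \<rho> (cube n) \<le> - (rate_inf / 2) * bulk_prod \<rho> r' n
      + vol_const 0 * (\<epsilon> * real (card (cube n :: 'a site set)) + real (card (shell (r' + rng) n :: 'a site set)))"
    using entropy_rate_upper[OF \<epsilon>] by (elim exE)
  note r = this[rule_format, OF order_refl]
  have "finite (\<Delta> \<union> \<Lambda>)" using active_fin(2)[OF \<Delta>(1)] \<Lambda> by simp
  then obtain k where k: "\<Delta> \<subseteq> cube k" "\<Lambda> \<subseteq> cube k" using finite_subset_cube[of "\<Delta> \<union> \<Lambda>"] by auto
  have half: "0 < (1 / 2 :: real)" by simp
  show ?thesis
    using small[rule_format, of "r + rng"] eventually_ge_at_top[of "r + rng"] eventually_ge_at_top[of "k + r"]
      shell_small[where 'd = 'a, OF half, of "k + r"]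
  proof eventually_elim
    case (elim n)
    let ?V = "real (card (cube n :: 'a site set))"
    show ?case
    proof (intro allI impI)
      fix \<rho> :: "('a, 'b) config measure"
      assume \<rho>: "positive_measure \<rho>" "\<rho> \<in> ti_measures" "2 * s \<le> local_prod \<rho> \<Lambda> \<Delta> \<xi>"
      have "s * real (card (cube (n - (k + r)) :: 'a site set)) \<le> bulk_prod \<rho> r n"
      proof (rule bulk_prod_lower[OF \<Delta> k elim(3) \<rho>(1,2)])
        fix L :: "'a site set" assume "finite L" "\<Lambda> \<subseteq> L"
        from mono[OF this \<rho>(1)] \<rho>(3) show "s \<le> local_prod \<rho> L \<Delta> \<xi>" by linarith
      qed
      moreover have "?V / 2 \<le> real (card (cube (n - (k + r)) :: 'a site set))"
        using elim(4) unfolding card_shell by simp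
      then have "s * (?V / 2) \<le> s * real (card (cube (n - (k + r)) :: 'a site set))"
        using s by (intro mult_left_mono) auto
      ultimately have "s * (?V / 2) \<le> bulk_prod \<rho> r n" by linarith
      then have "rate_inf / 2 * (s * (?V / 2)) \<le> rate_inf / 2 * bulk_prod \<rho> r n"
        using rate_inf(1) by (intro mult_left_mono) auto
      moreover have "rate_inf / 2 * (s * (?V / 2)) = 2 * (rate_inf * s / 8 * ?V)" by simp
      ultimately show "entropy_rate \<rho> (cube n) \<le> - (rate_inf * s / 8) * ?V"
        using r[OF elim(2) \<rho>(1)] elim(1) unfolding mult_minus_left by linarith
    qed
  qed
qed

text \<open>Up to translation only finitely many pairs of a set and a target occur, so the vanishing
  in large volumes is uniform over all bulk transitions.\<close>

lemma entropy_rate_density_zero: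
  assumes \<rho>: "\<rho> \<in> ti_measures" "site_nonnull d \<rho>" "0 < d"
    and vanish: "\<And>\<Delta> \<xi> e. active \<Delta> \<Longrightarrow> \<xi> \<in> \<Delta> \<rightarrow>\<^sub>E UNIV \<Longrightarrow> 0 < e \<Longrightarrow>
      \<exists>r. \<forall>\<Lambda>. finite \<Lambda> \<longrightarrow> cube r \<subseteq> \<Lambda> \<longrightarrow> local_prod \<rho> \<Lambda> \<Delta> \<xi> \<le> e"
  shows "(\<lambda>n. entropy_rate \<rho> (cube n) / real (card (cube n :: 'a site set))) \<longlonglongrightarrow> 0"
proof -
  have \<rho>p: "\<rho> \<in> prob_measures" using \<rho>(1) by (simp add: ti_measures_def)
  have pos: "positive_measure \<rho>"
    unfolding positive_measure_def using \<rho>p site_nonnull_pos[OF \<rho>(2,3) _ \<rho>p] by blast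
  let ?l = "\<bar>ln (d ^ card_bd * \<delta> ^ card_bd)\<bar>"
  have "\<forall>\<^sub>F n in sequentially. \<bar>entropy_rate \<rho> (cube n)\<bar> \<le> e * real (card (cube n :: 'a site set))" if e: "0 < e" for e
  proof -
    \<comment> \<open>Collects all factors between a bound a on each production term and the entropy
      rate; the choice of a makes this part at most half of e.\<close>
    define X where "X = (rate_sup + rate_inf) * real mult_bd * configs_bd"
    define a where "a = e / (2 * (X + 1))"
    have X: "0 \<le> X"
      using rate_sup(1) rate_inf(1) configs_bd_pos by (simp add: X_def)
    have a: "0 < a" using e X by (simp add: a_def)
    have a_le: "(rate_sup + rate_inf) * (real mult_bd * configs_bd * a) \<le> e / 2"
    proof -
      have "X * a \<le> (X + 1) * a" using a by (intro mult_right_mono) auto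
      also have "(X + 1) * a = e / 2"
      proof -
        have "D * (e / (2 * D)) = e / 2" if "0 < D" for D :: real using that by simp
        from this[of "X + 1"] show ?thesis using X by (simp only: a_def add_nonneg_pos zero_less_one)
      qed
      finally show ?thesis by (simp add: mult.assoc X_def)
    qed
    have e2: "0 < e / 2" using e by simp
    obtain \<epsilon> where \<epsilon>: "0 < \<epsilon>" "\<epsilon> \<le> rate_inf / 2"
      and small: "\<forall>r. \<forall>\<^sub>F n in sequentially. vol_const ?l * (\<epsilon> * real (card (cube n :: 'a site set)) + real (card (shell r n :: 'a site set)))
        \<le> e / 2 * real (card (cube n :: 'a site set))"
      using error_small[OF vol_const_nonneg[OF abs_ge_zero, of "ln (d ^ card_bd * \<delta> ^ card_bd)"] e2] by (elim exE conjE)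
    obtain r0 where "\<forall>r n \<rho>. r0 \<le> r \<longrightarrow> r + rng \<le> n \<longrightarrow> positive_measure \<rho> \<longrightarrow> site_nonnull d \<rho> \<longrightarrow>
      \<bar>entropy_rate \<rho> (cube n)\<bar> \<le> (rate_sup + rate_inf) * bulk_prod \<rho> r n
        + vol_const ?l * (\<epsilon> * real (card (cube n :: 'a site set)) + real (card (shell (r + rng) n :: 'a site set)))"
      using entropy_rate_abs[OF \<epsilon> \<rho>(3)] by (elim exE)
    note r0 = this[rule_format, OF _ _ pos \<rho>(2)]
    have "\<exists>r. \<forall>\<Lambda>. finite \<Lambda> \<longrightarrow> cube r \<subseteq> \<Lambda> \<longrightarrow> local_prod \<rho> \<Lambda> \<Delta> \<xi> \<le> a"
      if "\<Delta> \<in> orbit_reps" "\<xi> \<in> \<Delta> \<rightarrow>\<^sub>E UNIV" for \<Delta> \<xi>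
      using vanish[OF orbit_reps_active[OF that(1)] that(2) a] .
    then obtain rr where rr: "\<And>\<Delta> \<xi> \<Lambda>. \<Delta> \<in> orbit_reps \<Longrightarrow> \<xi> \<in> \<Delta> \<rightarrow>\<^sub>E UNIV \<Longrightarrow> finite \<Lambda> \<Longrightarrow> cube (rr \<Delta> \<xi>) \<subseteq> \<Lambda> \<Longrightarrow> local_prod \<rho> \<Lambda> \<Delta> \<xi> \<le> a"
      by metis
    \<comment> \<open>A common radius for all representatives; the sum dominates each
      summand.\<close>
    define r1 where "r1 = (\<Sum>\<Delta>\<in>orbit_reps. \<Sum>\<xi> \<in> \<Delta> \<rightarrow>\<^sub>E UNIV. rr \<Delta> \<xi>)"
    have r1: "rr \<Delta> \<xi> \<le> r1" if "\<Delta> \<in> orbit_reps" "\<xi> \<in> \<Delta> \<rightarrow>\<^sub>E UNIV" for \<Delta> \<xi>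
    proof -
      have "rr \<Delta> \<xi> \<le> (\<Sum>\<xi> \<in> \<Delta> \<rightarrow>\<^sub>E UNIV. rr \<Delta> \<xi>)"
        using finite_configs[OF active_fin(2)[OF orbit_reps_active[OF that(1)]]] that(2)
        by (intro member_le_sum) auto
      also have "\<dots> \<le> r1"
        unfolding r1_def using finite_orbit_reps that(1)
        by (intro member_le_sum[of _ _ "\<lambda>\<Delta>. \<Sum>\<xi> \<in> \<Delta> \<rightarrow>\<^sub>E UNIV. rr \<Delta> \<xi>"]) auto
      finally show ?thesis .
    qed
    have "finite (\<Union> orbit_reps)" using finite_orbit_reps active_fin(2)[OF orbit_reps_active] by auto
    then obtain k where k: "\<Union> orbit_reps \<subseteq> cube k" using finite_subset_cube by blast
    \<comment> \<open>The radius r0 is for the accuracy of the rates, r1 for the smallness of the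
      production terms, and k allows for the distance between the origin and a point of a
      representative.\<close>
    define r where "r = r0 + (r1 + k)"
    \<comment> \<open>Moved back to its representative, a bulk transition sees a volume containing
      the cube of radius r1 around the origin.\<close>
    have lp: "local_prod \<rho> (cube n) \<Delta> \<xi> \<le> a" if \<Delta>: "active \<Delta>" "bulk r n \<Delta>" "\<xi> \<in> \<Delta> \<rightarrow>\<^sub>E UNIV" for n \<Delta> \<xi>
    proof -
      obtain \<Delta>\<^sub>0 i where \<Delta>\<^sub>0: "\<Delta>\<^sub>0 \<in> orbit_reps" "\<Delta> = translate i \<Delta>\<^sub>0" by (rule active_cases[OF \<Delta>(1)])
      note act0 = orbit_reps_active[OF \<Delta>\<^sub>0(1)]
      have \<xi>0: "shift (- i) \<xi> \<in> \<Delta>\<^sub>0 \<rightarrow>\<^sub>E UNIV"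
        using rate_translate(1)[OF active_fin(1)[OF act0], of \<xi> i] \<Delta>(3) \<Delta>\<^sub>0(2) by simp
      obtain z where z: "z \<in> \<Delta>\<^sub>0" using active_fin(3)[OF act0] by blast
      have tr: "translate i (translate (- i) (cube n)) = cube n" by (simp add: image_image)
      have "cube (rr \<Delta>\<^sub>0 (shift (- i) \<xi>)) \<subseteq> translate (- i) (cube n)"
      proof
        fix u :: "'a site" assume "u \<in> cube (rr \<Delta>\<^sub>0 (shift (- i) \<xi>))"
        then have "u \<in> cube r1" using cube_mono[OF r1[OF \<Delta>\<^sub>0(1) \<xi>0]] by blast
        moreover have "- z \<in> cube k" using z k \<Delta>\<^sub>0(1) by (auto simp: cube_uminus)
        ultimately have "u + - z \<in> cube (r1 + k)" by (rule cube_add)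
        then have "(u + i) - (z + i) \<in> cube r" using cube_mono[of "r1 + k" r] by (auto simp: r_def)
        moreover have "z + i \<in> \<Delta>" using z \<Delta>\<^sub>0(2) by simp
        ultimately have "u + i \<in> cube n" using \<Delta>(2) unfolding bulk_def by blast
        then show "u \<in> translate (- i) (cube n)" by (intro mem_translate[THEN iffD2]) simp
      qed
      then have "local_prod \<rho> (translate (- i) (cube n)) \<Delta>\<^sub>0 (shift (- i) \<xi>) \<le> a"
        by (intro rr[OF \<Delta>\<^sub>0(1) \<xi>0]) auto
      moreover have "local_prod \<rho> (translate i (translate (- i) (cube n))) (translate i \<Delta>\<^sub>0) (shift i (shift (- i) \<xi>))
          = local_prod \<rho> (translate (- i) (cube n)) \<Delta>\<^sub>0 (shift (- i) \<xi>)"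
        by (rule local_prod_translate[OF \<rho>(1) _ act0 \<xi>0]) simp
      then have "local_prod \<rho> (cube n) \<Delta> \<xi> = local_prod \<rho> (translate (- i) (cube n)) \<Delta>\<^sub>0 (shift (- i) \<xi>)"
        unfolding tr \<Delta>\<^sub>0(2)[symmetric] by (simp add: shift_shift shift_0)
      ultimately show ?thesis by simp
    qed
    have bp: "bulk_prod \<rho> r n \<le> real mult_bd * configs_bd * a * real (card (cube n :: 'a site set))" for n
    proof -
      have "bulk_prod \<rho> r n \<le> (\<Sum>\<Delta> | \<Delta> \<in> act (cube n) \<and> bulk r n \<Delta>. configs_bd * a)"
        unfolding bulk_prod_def
      proof (rule sum_mono)
        fix \<Delta> assume "\<Delta> \<in> {\<Delta> \<in> act (cube n). bulk r n \<Delta>}"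
        then have \<Delta>: "active \<Delta>" "bulk r n \<Delta>" by (auto simp: act_def)
        have "(\<Sum>\<xi> \<in> \<Delta> \<rightarrow>\<^sub>E UNIV. local_prod \<rho> (cube n) \<Delta> \<xi>) \<le> (\<Sum>\<xi> \<in> \<Delta> \<rightarrow>\<^sub>E (UNIV :: 'b set). a)"
          by (intro sum_mono lp \<Delta>)
        also have "\<dots> \<le> configs_bd * a"
          using configs_bd[OF \<Delta>(1) order_refl] a by (simp add: mult_right_mono)
        finally show "(\<Sum>\<xi> \<in> \<Delta> \<rightarrow>\<^sub>E UNIV. local_prod \<rho> (cube n) \<Delta> \<xi>) \<le> configs_bd * a" .
      qed
      also have "\<dots> = real (card {\<Delta> \<in> act (cube n). bulk r n \<Delta>}) * (configs_bd * a)" by simp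
      also have "\<dots> \<le> real (mult_bd * card (cube n :: 'a site set)) * (configs_bd * a)"
      proof (intro mult_right_mono of_nat_mono)
        have "card {\<Delta> \<in> act (cube n). bulk r n \<Delta>} \<le> card (act (cube n))"
          using finite_act[of "cube n"] by (intro card_mono) auto
        then show "card {\<Delta> \<in> act (cube n). bulk r n \<Delta>} \<le> mult_bd * card (cube n :: 'a site set)"
          using card_act_cube[of n] by linarith
      qed (use a configs_bd_pos in auto)
      finally show ?thesis by (simp add: mult_ac)
    qed
    show ?thesis
      using small[rule_format, of "r + rng"] eventually_ge_at_top[of "r + rng"]
    proof eventually_elim
      case (elim n)
      let ?V = "real (card (cube n :: 'a site set))"
      have "(rate_sup + rate_inf) * bulk_prod \<rho> r n \<le> (rate_sup + rate_inf) * (real mult_bd * configs_bd * a * ?V)"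
        using bp rate_sup(1) rate_inf(1) by (intro mult_left_mono) auto
      also have "\<dots> = (rate_sup + rate_inf) * (real mult_bd * configs_bd * a) * ?V" by simp
      also have "\<dots> \<le> e / 2 * ?V" using a_le by (intro mult_right_mono) auto
      finally show ?case using r0[of r n] elim by (simp add: r_def)
    qed
  qed
  then have ev: "\<forall>\<^sub>F n in sequentially. \<bar>entropy_rate \<rho> (cube n)\<bar> \<le> e * real (card (cube n :: 'a site set))" if "0 < e" for e
    using that by blast
  show ?thesis
  proof (rule tendstoI)
    fix e :: real assume "0 < e"
    then have "0 < e / 2" by simp
    from ev[OF this]
    show "\<forall>\<^sub>F n in sequentially. dist (entropy_rate \<rho> (cube n) / real (card (cube n :: 'a site set))) 0 < e"
    proof eventually_elim
      case (elim n)
      have V: "0 < real (card (cube n :: 'a site set))" by (rule card_cube_pos)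
      have "e / 2 * real (card (cube n :: 'a site set)) < e * real (card (cube n :: 'a site set))"
        using V \<open>0 < e\<close> by (intro mult_strict_right_mono) auto
      with elim have "\<bar>entropy_rate \<rho> (cube n)\<bar> < e * real (card (cube n :: 'a site set))" by linarith
      then show ?case using V by (simp add: dist_real_def pos_divide_less_eq)
    qed
  qed
qed

end

section \<open>Weak convergence and mixtures\<close>

lemma apply_Bcontfun_cyl:
  fixes \<eta> :: "('d::finite, 'q::{finite,discrete_topology}) config"
  assumes "finite \<Lambda>"
  shows "apply_bcontfun (Bcontfun (indicator (cyl \<Lambda> \<eta>))) = (indicator (cyl \<Lambda> \<eta>) :: _ \<Rightarrow> real)"
  by (intro apply_Bcontfun_continuous continuous_local local_indicator_cyl assms)

lemma measure_cyl_eq_integral: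
  fixes \<nu> :: "('d::finite, 'q::{finite,discrete_topology}) config measure"
  assumes "\<nu> \<in> prob_measures" "finite \<Lambda>"
  shows "measure \<nu> (cyl \<Lambda> \<eta>) = (\<integral>\<omega>. apply_bcontfun (Bcontfun (indicator (cyl \<Lambda> \<eta>))) \<omega> \<partial>\<nu>)"
  using integral_cyl[OF assms, of \<eta>] by (simp add: apply_Bcontfun_cyl[OF assms(2)])

text \<open>In the pullback topology, integration against f is continuous, being the composition
  with a coordinate projection.\<close>

lemma weak_limit_integral:
  fixes f :: "('d::finite, 'q::{finite,discrete_topology}) config \<Rightarrow>\<^sub>C real"
  assumes "limitin weak_topology \<rho> \<nu> F"
  shows "((\<lambda>n. \<integral>\<omega>. apply_bcontfun f \<omega> \<partial>(\<rho> n)) \<longlongrightarrow> (\<integral>\<omega>. apply_bcontfun f \<omega> \<partial>\<nu>)) F"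
proof (rule topological_tendstoI)
  fix S :: "real set" assume S: "open S" "(\<integral>\<omega>. apply_bcontfun f \<omega> \<partial>\<nu>) \<in> S"
  let ?I = "\<lambda>\<nu> (f :: ('d, 'q) config \<Rightarrow>\<^sub>C real). \<integral>\<omega>. apply_bcontfun f \<omega> \<partial>\<nu>"
  let ?U = "?I -` ((\<lambda>\<phi>. \<phi> f) -` S) \<inter> prob_measures"
  have "open ((\<lambda>\<phi> :: (('d, 'q) config \<Rightarrow>\<^sub>C real) \<Rightarrow> real. \<phi> f) -` S)"
    by (rule open_vimage[OF S(1) continuous_on_product_coordinates])
  then have "openin weak_topology ?U"
    unfolding weak_topology_def openin_pullback_topology by (intro exI[of _ "(\<lambda>\<phi>. \<phi> f) -` S"]) simp
  moreover have "\<nu> \<in> ?U"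
    using assms S(2) by (simp add: limitin_def weak_topology_def topspace_pullback_topology)
  ultimately have "\<forall>\<^sub>F n in F. \<rho> n \<in> ?U" using assms unfolding limitin_def by blast
  then show "\<forall>\<^sub>F n in F. (\<integral>\<omega>. apply_bcontfun f \<omega> \<partial>(\<rho> n)) \<in> S"
    by (rule eventually_mono) simp
qed

lemma weak_limit_prob: "limitin weak_topology \<rho> \<nu> F \<Longrightarrow> \<nu> \<in> prob_measures"
  by (simp add: limitin_def weak_topology_def topspace_pullback_topology)

lemma ti_measuresI:
  fixes \<nu> :: "('d::finite, 'q::{finite,discrete_topology}) config measure"
  assumes \<nu>: "\<nu> \<in> prob_measures"
    and eq: "\<And>\<Lambda> i \<eta>. finite \<Lambda> \<Longrightarrow> measure \<nu> (cyl (translate i \<Lambda>) (shift i \<eta>)) = measure \<nu> (cyl \<Lambda> \<eta>)"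
  shows "\<nu> \<in> ti_measures"
proof -
  interpret prob_space \<nu> using \<nu> by (simp add: prob_measures_def)
  note s = prob_measuresD[OF \<nu>]
  have meas: "shift i \<in> \<nu> \<rightarrow>\<^sub>M borel" for i :: "'d site"
    using measurable_shift[of i, where 'q = 'q] s(2) by (simp cong: measurable_cong_sets)
  have "distr \<nu> borel (shift i) = \<nu>" for i
  proof (rule measure_eqI_cyl[OF _ \<nu>])
    show "distr \<nu> borel (shift i) \<in> prob_measures"
      using prob_space_distr[OF meas] by (simp add: prob_measures_def)
    fix \<Lambda> :: "'d site set" and \<eta> :: "('d, 'q) config" assume \<Lambda>: "finite \<Lambda>"
    have "measure (distr \<nu> borel (shift i)) (cyl \<Lambda> \<eta>) = measure \<nu> (shift i -` cyl \<Lambda> \<eta> \<inter> space \<nu>)"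
      using \<Lambda> by (intro measure_distr meas) simp
    also have "\<dots> = measure \<nu> (cyl (translate (- i) \<Lambda>) (shift (- i) \<eta>))"
      unfolding cyl_shift s(3) by simp
    also have "\<dots> = measure \<nu> (cyl \<Lambda> \<eta>)" by (rule eq[OF \<Lambda>])
    finally show "measure (distr \<nu> borel (shift i)) (cyl \<Lambda> \<eta>) = measure \<nu> (cyl \<Lambda> \<eta>)" .
  qed
  then show ?thesis using \<nu> by (simp add: ti_measures_def)
qed

text \<open>Cylinders are clopen, so their probabilities converge, and equality of the probabilities
  of a cylinder and its translate passes to the limit.\<close>

lemma weak_limit_ti:
  fixes \<nu> :: "('d::finite, 'q::{finite,discrete_topology}) config measure"
  assumes lim: "limitin weak_topology \<rho> \<nu> sequentially" and \<rho>: "\<And>n. \<rho> n \<in> ti_measures"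
  shows "\<nu> \<in> ti_measures"
proof (rule ti_measuresI[OF weak_limit_prob[OF lim]])
  fix \<Lambda> :: "'d site set" and i and \<eta> :: "('d, 'q) config" assume \<Lambda>: "finite \<Lambda>"
  have \<nu>: "\<nu> \<in> prob_measures" by (rule weak_limit_prob[OF lim])
  have \<rho>p: "\<rho> n \<in> prob_measures" for n using \<rho>[of n] by (simp add: ti_measures_def)
  have conv: "(\<lambda>n. measure (\<rho> n) (cyl L \<zeta>)) \<longlonglongrightarrow> measure \<nu> (cyl L \<zeta>)" if "finite L" for L \<zeta>
    unfolding measure_cyl_eq_integral[OF \<rho>p that] measure_cyl_eq_integral[OF \<nu> that]
    by (rule weak_limit_integral[OF lim])
  have fin: "finite (translate i \<Lambda>)" using \<Lambda> by simp
  have "(\<lambda>n. measure (\<rho> n) (cyl \<Lambda> \<eta>)) \<longlonglongrightarrow> measure \<nu> (cyl (translate i \<Lambda>) (shift i \<eta>))"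
    using conv[OF fin, of "shift i \<eta>"] by (simp only: ti_measure_cyl[OF \<rho> \<Lambda>])
  from LIMSEQ_unique[OF this conv[OF \<Lambda>]]
  show "measure \<nu> (cyl (translate i \<Lambda>) (shift i \<eta>)) = measure \<nu> (cyl \<Lambda> \<eta>)" .
qed

text \<open>A convex combination specified by its action on continuous functions: the combination of
  two states is a state, so such a measure exists.\<close>

definition mixture :: "real \<Rightarrow> ('d::finite, 'q::{finite,discrete_topology}) config measure \<Rightarrow>
    ('d, 'q) config measure \<Rightarrow> ('d, 'q) config measure" where
  "mixture \<theta> \<nu> \<mu> = (SOME \<rho>. \<rho> \<in> prob_measures \<and> (\<forall>f. (\<integral>\<omega>. apply_bcontfun f \<omega> \<partial>\<rho>)
    = (1 - \<theta>) * (\<integral>\<omega>. apply_bcontfun f \<omega> \<partial>\<nu>) + \<theta> * (\<integral>\<omega>. apply_bcontfun f \<omega> \<partial>\<mu>)))"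

lemma mixture:
  fixes \<nu> \<mu> :: "('d::finite, 'q::{finite,discrete_topology}) config measure"
  assumes "\<nu> \<in> prob_measures" "\<mu> \<in> prob_measures" "0 \<le> \<theta>" "\<theta> \<le> 1"
  shows mixture_prob: "mixture \<theta> \<nu> \<mu> \<in> prob_measures"
    and integral_mixture: "(\<integral>\<omega>. apply_bcontfun f \<omega> \<partial>(mixture \<theta> \<nu> \<mu>))
      = (1 - \<theta>) * (\<integral>\<omega>. apply_bcontfun f \<omega> \<partial>\<nu>) + \<theta> * (\<integral>\<omega>. apply_bcontfun f \<omega> \<partial>\<mu>)"
proof -
  let ?E = "\<lambda>f :: ('d, 'q) config \<Rightarrow>\<^sub>C real.
    (1 - \<theta>) * (\<integral>\<omega>. apply_bcontfun f \<omega> \<partial>\<nu>) + \<theta> * (\<integral>\<omega>. apply_bcontfun f \<omega> \<partial>\<mu>)"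
  note st = state_integral[OF assms(1)] state_integral[OF assms(2)]
  have "state ?E"
    unfolding state_def
  proof (intro conjI allI impI)
    have l: "linear (\<lambda>f :: ('d, 'q) config \<Rightarrow>\<^sub>C real. \<integral>\<omega>. apply_bcontfun f \<omega> \<partial>\<nu>)"
      "linear (\<lambda>f :: ('d, 'q) config \<Rightarrow>\<^sub>C real. \<integral>\<omega>. apply_bcontfun f \<omega> \<partial>\<mu>)"
      using st by (auto simp: state_def)
    show "linear ?E"
      by (rule linearI; simp only: linear_add[OF l(1)] linear_add[OF l(2)] linear_scale[OF l(1)] linear_scale[OF l(2)])
        (simp_all add: algebra_simps)
    fix f :: "('d, 'q) config \<Rightarrow>\<^sub>C real" assume "\<forall>\<eta>. 0 \<le> apply_bcontfun f \<eta>"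
    then show "0 \<le> ?E f" using st assms(3,4) by (auto simp: state_def intro!: add_nonneg_nonneg mult_nonneg_nonneg)
  qed (use st in \<open>simp add: state_def\<close>)
  then have "\<exists>\<rho>. \<rho> \<in> prob_measures \<and> (\<forall>f. (\<integral>\<omega>. apply_bcontfun f \<omega> \<partial>\<rho>) = ?E f)"
    using state_measure by blast
  from someI_ex[OF this, folded mixture_def]
  show "mixture \<theta> \<nu> \<mu> \<in> prob_measures"
    "(\<integral>\<omega>. apply_bcontfun f \<omega> \<partial>(mixture \<theta> \<nu> \<mu>))
      = (1 - \<theta>) * (\<integral>\<omega>. apply_bcontfun f \<omega> \<partial>\<nu>) + \<theta> * (\<integral>\<omega>. apply_bcontfun f \<omega> \<partial>\<mu>)" by blast+
qed

lemma measure_mixture_cyl: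
  fixes \<nu> \<mu> :: "('d::finite, 'q::{finite,discrete_topology}) config measure"
  assumes "\<nu> \<in> prob_measures" "\<mu> \<in> prob_measures" "0 \<le> \<theta>" "\<theta> \<le> 1" "finite \<Lambda>"
  shows "measure (mixture \<theta> \<nu> \<mu>) (cyl \<Lambda> \<eta>) = (1 - \<theta>) * measure \<nu> (cyl \<Lambda> \<eta>) + \<theta> * measure \<mu> (cyl \<Lambda> \<eta>)"
  unfolding measure_cyl_eq_integral[OF mixture_prob[OF assms(1-4)] assms(5)]
    measure_cyl_eq_integral[OF assms(1,5)] measure_cyl_eq_integral[OF assms(2,5)]
  by (rule integral_mixture[OF assms(1-4)])

lemma mixture_ti:
  fixes \<nu> \<mu> :: "('d::finite, 'q::{finite,discrete_topology}) config measure"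
  assumes "\<nu> \<in> ti_measures" "\<mu> \<in> ti_measures" "0 \<le> \<theta>" "\<theta> \<le> 1"
  shows "mixture \<theta> \<nu> \<mu> \<in> ti_measures"
proof (rule ti_measuresI)
  have p: "\<nu> \<in> prob_measures" "\<mu> \<in> prob_measures" using assms by (auto simp: ti_measures_def)
  show "mixture \<theta> \<nu> \<mu> \<in> prob_measures" by (rule mixture_prob[OF p assms(3,4)])
  fix \<Lambda> :: "'d site set" and i and \<eta> :: "('d, 'q) config" assume \<Lambda>: "finite \<Lambda>"
  show "measure (mixture \<theta> \<nu> \<mu>) (cyl (translate i \<Lambda>) (shift i \<eta>)) = measure (mixture \<theta> \<nu> \<mu>) (cyl \<Lambda> \<eta>)"
    by (simp only: measure_mixture_cyl[OF p assms(3,4) finite_imageI[OF \<Lambda>]] measure_mixture_cyl[OF p assms(3,4) \<Lambda>]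
        ti_measure_cyl[OF assms(1) \<Lambda>] ti_measure_cyl[OF assms(2) \<Lambda>])
qed

section \<open>A decreasing function with infinitely many definite drops\<close>

text \<open>The n-dependent functions are compared at times that do not depend on n. Each round ends
  at a time T after which, for all large n, another \<sigma> \<tau> / 2 per volume has been lost;
  the threshold for n may grow from round to round, since only finitely many rounds contradict
  nonnegativity.\<close>

lemma decay_contradiction:
  fixes H G :: "nat \<Rightarrow> real \<Rightarrow> real" and V :: "nat \<Rightarrow> real" and t :: "nat \<Rightarrow> real"
  assumes V: "\<And>n. 0 < V n"
    and H: "\<And>n u. 0 \<le> u \<Longrightarrow> 0 \<le> H n u" "\<And>n u. 0 \<le> u \<Longrightarrow> H n u \<le> C * V n"
    and deriv: "\<And>n u. 0 \<le> u \<Longrightarrow> (H n has_real_derivative G n u) (at u within {0..})"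
    and small: "\<And>e. 0 < e \<Longrightarrow> \<forall>\<^sub>F n in sequentially. \<forall>u\<ge>0. G n u \<le> e * V n"
    and neg: "0 < \<sigma>" "0 < \<tau>" "\<forall>\<^sub>F n in sequentially. \<forall>k\<ge>K. \<forall>s. 0 < s \<longrightarrow> s < \<tau> \<longrightarrow> G n (t k + s) \<le> - \<sigma> * V n"
    and t: "\<And>k. 0 \<le> t k" "filterlim t at_top sequentially"
  shows False
proof -
  have mvt: "H n b - H n a \<le> g * (b - a)"
    if ab: "0 \<le> a" "a < b" and g: "\<And>x. a < x \<Longrightarrow> x < b \<Longrightarrow> G n x \<le> g" for n a b g
  proof -
    have "(H n has_derivative (\<lambda>h. G n x * h)) (at x within {a..b})" if "a \<le> x" "x \<le> b" for x
      using has_field_derivative_subset[OF deriv[of x n], of "{a..b}"] ab that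
      by (auto simp: has_field_derivative_def)
    from mvt_simple[OF ab(2) this] obtain x where x: "x \<in> {a<..<b}" "H n b - H n a = G n x * (b - a)" by auto
    then show ?thesis using g[of x] ab(2) by (simp add: mult_right_mono)
  qed
  have claim: "\<exists>T\<ge>0. \<forall>\<^sub>F n in sequentially. H n T \<le> (C - real J * (\<sigma> * \<tau> / 2)) * V n" for J
  proof (induction J)
    case 0
    have "H n 0 \<le> (C - real 0 * (\<sigma> * \<tau> / 2)) * V n" for n using H(2)[of 0 n] by simp
    then show ?case by (intro exI[of _ 0]) simp
  next
    case (Suc J)
    then obtain T where T: "0 \<le> T" "\<forall>\<^sub>F n in sequentially. H n T \<le> (C - real J * (\<sigma> * \<tau> / 2)) * V n" by blast
    \<comment> \<open>A time beyond T is chosen before the volume, so the waiting time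
      \<open>t k - T\<close> does not depend on n.\<close>
    have "\<forall>\<^sub>F k in sequentially. T < t k" using t(2) by (simp add: filterlim_at_top_dense)
    then obtain k where k: "K \<le> k" "T < t k"
      using eventually_happens'[OF sequentially_bot eventually_conj[OF eventually_ge_at_top[of K]]] by blast
    \<comment> \<open>Over the waiting time the entropy rises by at most \<sigma> \<tau> / 2 per
      volume; the drop of \<sigma> \<tau> after \<open>t k\<close> leaves a net loss of half its
      size.\<close>
    define e where "e = \<sigma> * \<tau> / 2 / (t k - T)"
    have e: "0 < e" using k(2) neg(1,2) by (simp add: e_def)
    have e': "e * (t k - T) = \<sigma> * \<tau> / 2"
      unfolding e_def using k(2) by (subst times_divide_eq_left, subst nonzero_mult_div_cancel_right) auto
    show ?case
    proof (intro exI[of _ "t k + \<tau>"] conjI)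
      show "0 \<le> t k + \<tau>" using t(1)[of k] neg(2) by simp
      show "\<forall>\<^sub>F n in sequentially. H n (t k + \<tau>) \<le> (C - real (Suc J) * (\<sigma> * \<tau> / 2)) * V n"
        using T(2) small[OF e] neg(3)
      proof eventually_elim
        case (elim n)
        have "H n (t k) - H n T \<le> e * V n * (t k - T)"
          using elim(2) T(1) k(2) by (intro mvt) auto
        also have "\<dots> = \<sigma> * \<tau> / 2 * V n" unfolding e'[symmetric] by (simp only: mult_ac)
        finally have 1: "H n (t k) - H n T \<le> \<sigma> * \<tau> / 2 * V n" .
        have "H n (t k + \<tau>) - H n (t k) \<le> - \<sigma> * V n * (t k + \<tau> - t k)"
        proof (rule mvt)
          fix x assume "t k < x" "x < t k + \<tau>"
          then show "G n x \<le> - \<sigma> * V n" using elim(3)[rule_format, OF k(1), of "x - t k"] by simp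
        qed (use t(1) neg(2) in auto)
        moreover have "- \<sigma> * V n * (t k + \<tau> - t k) = - 2 * (\<sigma> * \<tau> / 2 * V n)" by simp
        moreover have "(C - real (Suc J) * (\<sigma> * \<tau> / 2)) * V n
            = (C - real J * (\<sigma> * \<tau> / 2)) * V n - \<sigma> * \<tau> / 2 * V n"
          by (simp add: algebra_simps add_divide_distrib)
        ultimately show ?case using 1 elim(1) by linarith
      qed
    qed
  qed
  obtain J where J: "C / (\<sigma> * \<tau> / 2) < real J" using reals_Archimedean2 by blast
  obtain T where T: "0 \<le> T" "\<forall>\<^sub>F n in sequentially. H n T \<le> (C - real J * (\<sigma> * \<tau> / 2)) * V n"
    using claim[of J] by blast
  obtain n where n: "H n T \<le> (C - real J * (\<sigma> * \<tau> / 2)) * V n"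
    using eventually_happens'[OF sequentially_bot T(2)] by blast
  have "C - real J * (\<sigma> * \<tau> / 2) < 0" using J neg(1,2) by (simp add: pos_divide_less_eq)
  then have "(C - real J * (\<sigma> * \<tau> / 2)) * V n < 0" using V[of n] by (rule mult_neg_pos)
  with n H(1)[OF T(1), of n] show False by linarith
qed

section \<open>Time derivative of the relative entropy\<close>

context ips_gibbs
begin

definition entropy :: "('a, 'b) config measure \<Rightarrow> 'a site set \<Rightarrow> real" where
  "entropy \<rho> \<Lambda> = (\<Sum>\<omega> \<in> \<Lambda> \<rightarrow>\<^sub>E UNIV. measure \<rho> (cyl \<Lambda> \<omega>) * ln (dens \<rho> \<Lambda> \<omega>))"

lemma entropy_nonneg:
  assumes \<rho>: "positive_measure \<rho>" and \<Lambda>: "finite \<Lambda>"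
  shows "0 \<le> entropy \<rho> \<Lambda>"
proof -
  have "(\<Sum>\<omega> \<in> \<Lambda> \<rightarrow>\<^sub>E UNIV. measure \<rho> (cyl \<Lambda> \<omega>) - m \<Lambda> \<omega>) \<le> entropy \<rho> \<Lambda>"
    unfolding entropy_def dens_def
    by (intro sum_mono mult_ln_div_ge positive_measureD(2)[OF \<rho> \<Lambda>] \<mu>_pos[OF \<Lambda>])
  then show ?thesis
    using sum_measure_cyl[OF positive_measureD(1)[OF \<rho>] \<Lambda>] sum_measure_cyl[OF \<mu>_prob \<Lambda>]
    by (simp add: sum_subtractf)
qed

text \<open>The probabilities of \<rho> are at most 1, so only the lower bound on those of \<mu>
  enters, and the constant is the same for all \<rho>.\<close>

lemma entropy_le:
  assumes \<rho>: "positive_measure \<rho>" and \<Lambda>: "finite \<Lambda>"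
  shows "entropy \<rho> \<Lambda> \<le> - ln \<delta> * real (card \<Lambda>)"
proof -
  note \<rho>p = positive_measureD(1)[OF \<rho>]
  have "measure \<rho> (cyl \<Lambda> \<omega>) * ln (dens \<rho> \<Lambda> \<omega>) \<le> measure \<rho> (cyl \<Lambda> \<omega>) * (- ln \<delta> * real (card \<Lambda>))" for \<omega>
  proof (rule mult_left_mono)
    have p: "0 < measure \<rho> (cyl \<Lambda> \<omega>)" "0 < m \<Lambda> \<omega>" using positive_measureD(2)[OF \<rho> \<Lambda>] \<mu>_pos[OF \<Lambda>] by auto
    have "\<delta> ^ card \<Lambda> \<le> m \<Lambda> \<omega>" using \<delta> by (intro site_nonnull_lower[OF _ _ \<Lambda> \<mu>_prob]) auto
    then have "ln (\<delta> ^ card \<Lambda>) \<le> ln (m \<Lambda> \<omega>)" using \<delta>(1) by (intro ln_mono) auto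
    moreover have "ln (measure \<rho> (cyl \<Lambda> \<omega>)) \<le> 0"
      using p(1) prob_space.prob_le_1[OF prob_measuresD(1)[OF \<rho>p]] by (simp add: ln_le_zero_iff)
    moreover have "ln (dens \<rho> \<Lambda> \<omega>) = ln (measure \<rho> (cyl \<Lambda> \<omega>)) - ln (m \<Lambda> \<omega>)"
      using p by (simp add: dens_def ln_div)
    moreover have "ln (\<delta> ^ card \<Lambda>) = ln \<delta> * real (card \<Lambda>)"
      using \<delta>(1) by (simp add: ln_realpow)
    ultimately show "ln (dens \<rho> \<Lambda> \<omega>) \<le> - ln \<delta> * real (card \<Lambda>)" unfolding mult_minus_left by linarith
  qed simp
  then have "entropy \<rho> \<Lambda> \<le> (\<Sum>\<omega> \<in> \<Lambda> \<rightarrow>\<^sub>E UNIV. measure \<rho> (cyl \<Lambda> \<omega>) * (- ln \<delta> * real (card \<Lambda>)))"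
    unfolding entropy_def by (rule sum_mono)
  then show ?thesis
    unfolding sum_distrib_right[symmetric] using sum_measure_cyl[OF \<rho>p \<Lambda>] by simp
qed

text \<open>Conservation of mass: the indicators sum to 1, so gains and losses cancel for each
  transition.\<close>

lemma sum_integral_generator:
  assumes \<rho>: "\<rho> \<in> prob_measures" and \<Lambda>: "finite \<Lambda>"
  shows "(\<Sum>\<omega> \<in> \<Lambda> \<rightarrow>\<^sub>E UNIV. \<integral>\<eta>. ips_generator c (indicator (cyl \<Lambda> \<omega>)) \<eta> \<partial>\<rho>) = 0"
proof -
  have ind: "indicator (cyl \<Lambda> \<omega>) \<eta> = (indicator (cyl \<Lambda> \<omega>) \<zeta> :: real)"
    if "\<forall>x\<in>\<Lambda>. \<eta> x = \<zeta> x" for \<omega> \<eta> \<zeta> :: "('a, 'b) config"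
    using that by (simp add: indicator_def cyl_def)
  have one: "(\<Sum>\<omega> \<in> \<Lambda> \<rightarrow>\<^sub>E UNIV. indicator (cyl \<Lambda> \<omega>) \<eta>) = (1 :: real)" for \<eta> :: "('a, 'b) config"
    using local_expansion[OF \<Lambda>, of "\<lambda>_. 1" \<eta>] by simp
  have "(\<Sum>\<omega>' \<in> \<Lambda> \<rightarrow>\<^sub>E UNIV. \<integral>\<eta>. ips_generator c (indicator (cyl \<Lambda> \<omega>')) \<eta> \<partial>\<rho>)
      = (\<Sum>\<omega>' \<in> \<Lambda> \<rightarrow>\<^sub>E UNIV. \<Sum>\<Delta>\<in>act \<Lambda>. \<Sum>\<xi> \<in> \<Delta> \<rightarrow>\<^sub>E UNIV. \<Sum>\<omega> \<in> \<Lambda> \<rightarrow>\<^sub>E UNIV.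
      flux \<rho> \<Lambda> \<Delta> \<xi> \<omega> * (indicator (cyl \<Lambda> \<omega>') (override_on \<omega> \<xi> \<Delta>) - indicator (cyl \<Lambda> \<omega>') \<omega>))"
    by (simp only: integral_generator_local[OF \<rho> \<Lambda> ind])
  also have "\<dots> = (\<Sum>\<Delta>\<in>act \<Lambda>. \<Sum>\<xi> \<in> \<Delta> \<rightarrow>\<^sub>E UNIV. \<Sum>\<omega> \<in> \<Lambda> \<rightarrow>\<^sub>E UNIV. \<Sum>\<omega>' \<in> \<Lambda> \<rightarrow>\<^sub>E UNIV.
      flux \<rho> \<Lambda> \<Delta> \<xi> \<omega> * (indicator (cyl \<Lambda> \<omega>') (override_on \<omega> \<xi> \<Delta>) - indicator (cyl \<Lambda> \<omega>') \<omega>))"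
    apply (subst sum.swap, rule sum.cong[OF refl])
    apply (subst sum.swap, rule sum.cong[OF refl])
    apply (subst sum.swap, rule sum.cong[OF refl])
    by (rule refl)
  also have "\<dots> = 0"
    by (simp only: sum_distrib_left[symmetric] sum_subtractf one) simp
  finally show ?thesis .
qed

text \<open>Stated for an arbitrary curve of measures whose cylinder probabilities follow the
  generator, so that it covers both the trajectory and its mixture with \<mu>.\<close>

lemma entropy_derivative:
  assumes \<rho>: "positive_measure (\<rho> t)" and \<Lambda>: "finite \<Lambda>"
    and deriv: "\<And>\<omega>. ((\<lambda>t. measure (\<rho> t) (cyl \<Lambda> \<omega>)) has_real_derivative
      (\<integral>\<eta>. ips_generator c (indicator (cyl \<Lambda> \<omega>)) \<eta> \<partial>(\<rho> t))) (at t within S)"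
  shows "((\<lambda>t. entropy (\<rho> t) \<Lambda>) has_real_derivative entropy_rate (\<rho> t) \<Lambda>) (at t within S)"
proof -
  let ?p = "\<lambda>t \<omega>. measure (\<rho> t) (cyl \<Lambda> \<omega>)"
  let ?p' = "\<lambda>\<omega>. \<integral>\<eta>. ips_generator c (indicator (cyl \<Lambda> \<omega>)) \<eta> \<partial>(\<rho> t)"
  have "((\<lambda>t. ?p t \<omega> * ln (?p t \<omega> / m \<Lambda> \<omega>)) has_real_derivative ?p' \<omega> * ln (?p t \<omega> / m \<Lambda> \<omega>) + ?p' \<omega>) (at t within S)" for \<omega>
  proof -
    have pos: "0 < ?p t \<omega>" "0 < m \<Lambda> \<omega>" using positive_measureD(2)[OF \<rho> \<Lambda>] \<mu>_pos[OF \<Lambda>] by auto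
    note [derivative_intros] = deriv
    show ?thesis by (rule derivative_eq_intros refl | use pos in \<open>simp add: field_simps\<close>)+
  qed
  then have "((\<lambda>t. entropy (\<rho> t) \<Lambda>) has_real_derivative
      (\<Sum>\<omega> \<in> \<Lambda> \<rightarrow>\<^sub>E UNIV. ?p' \<omega> * ln (?p t \<omega> / m \<Lambda> \<omega>) + ?p' \<omega>)) (at t within S)"
    unfolding entropy_def dens_def by (rule DERIV_sum)
  moreover have "(\<Sum>\<omega> \<in> \<Lambda> \<rightarrow>\<^sub>E UNIV. ?p' \<omega> * ln (?p t \<omega> / m \<Lambda> \<omega>) + ?p' \<omega>) = entropy_rate (\<rho> t) \<Lambda>"
    unfolding sum.distrib sum_integral_generator[OF positive_measureD(1)[OF \<rho>] \<Lambda>]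
    by (simp add: entropy_rate_def dens_def)
  ultimately show ?thesis by simp
qed

lemma measure_evolve_cyl_derivative:
  assumes \<nu>: "\<nu> \<in> prob_measures" and \<Lambda>: "finite \<Lambda>" and t: "0 \<le> t"
  shows "((\<lambda>t. measure (evolve P t \<nu>) (cyl \<Lambda> \<omega>)) has_real_derivative
      (\<integral>\<eta>. ips_generator c (indicator (cyl \<Lambda> \<omega>)) \<eta> \<partial>(evolve P t \<nu>))) (at t within {0..})"
proof (rule has_field_derivative_transform_within[OF generator_derivative[OF local_indicator_cyl[OF \<Lambda>] \<nu> t] zero_less_one])
  show "t \<in> {0..}" using t by simp
  fix s :: real assume "s \<in> {0..}"
  then show "(\<integral>\<eta>. indicator (cyl \<Lambda> \<omega>) \<eta> \<partial>(evolve P s \<nu>)) = measure (evolve P s \<nu>) (cyl \<Lambda> \<omega>)"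
    by (intro integral_cyl evolve_prob[OF feller _ \<nu>] \<Lambda>) simp
qed

lemma evolve_0: "\<nu> \<in> prob_measures \<Longrightarrow> evolve P 0 \<nu> = \<nu>"
proof (rule measure_eqI_cyl)
  assume \<nu>: "\<nu> \<in> prob_measures"
  show "evolve P 0 \<nu> \<in> prob_measures" by (rule evolve_prob[OF feller order_refl \<nu>])
  fix \<Lambda> :: "'a site set" and \<eta> :: "('a, 'b) config" assume \<Lambda>: "finite \<Lambda>"
  have "P 0 f = f" for f using feller by (simp add: feller_semigroup_def)
  then show "measure (evolve P 0 \<nu>) (cyl \<Lambda> \<eta>) = measure \<nu> (cyl \<Lambda> \<eta>)"
    unfolding measure_cyl_eq_integral[OF evolve_prob[OF feller order_refl \<nu>] \<Lambda>] measure_cyl_eq_integral[OF \<nu> \<Lambda>]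
      integral_evolve[OF feller order_refl \<nu>] by simp
qed

text \<open>Every nonempty event over \<Lambda> contains a cylinder and so has positive \<mu>-mass;
  absolute continuity is automatic and the value finite.\<close>

lemma rel_entropy_eq:
  assumes \<Lambda>: "finite \<Lambda>"
  shows "rel_entropy \<Lambda> \<nu> \<mu> = ereal (entropy \<nu> \<Lambda>)"
proof -
  have "measure \<nu> A = 0" if A: "A \<in> sets (coord_algebra \<Lambda>)" "measure \<mu> A = 0" for A
  proof (cases "A = {}")
    case False
    then obtain \<omega> where \<omega>: "\<omega> \<in> A" by blast
    have "cyl \<Lambda> \<omega> \<subseteq> A"
      using coord_algebra_determined[OF A(1), of \<omega>] \<omega> by (auto simp: cyl_def)
    moreover have "A \<in> sets \<mu>"
      using coord_algebra_subalgebra[OF prob_measuresD(2)[OF \<mu>_prob], of \<Lambda>] A(1) by (auto simp: subalgebra_def)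
    moreover have "finite_measure \<mu>"
      using prob_measuresD(1)[OF \<mu>_prob] by (rule prob_space.finite_measure)
    ultimately have "m \<Lambda> \<omega> \<le> measure \<mu> A" by (intro finite_measure.finite_measure_mono)
    then show ?thesis using \<mu>_pos[OF \<Lambda>, of \<omega>] A(2) by simp
  qed simp
  then show ?thesis by (simp add: rel_entropy_def entropy_def dens_def)
qed

text \<open>Positivity at time zero is enough for differentiating the logarithm there; the quotient
  of extended reals is then that of real numbers.\<close>

lemma entropy_loss_eq:
  assumes \<nu>: "positive_measure \<nu>"
  shows "entropy_loss P n \<nu> \<mu> = ereal (entropy_rate \<nu> (cube (2 ^ n - 1)))"
proof -
  let ?\<Lambda> = "cube (2 ^ n - 1) :: 'a site set"
  note \<nu>p = positive_measureD(1)[OF \<nu>]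
  let ?h = "\<lambda>t. entropy (evolve P t \<nu>) ?\<Lambda>"
  have "(?h has_real_derivative entropy_rate (evolve P 0 \<nu>) ?\<Lambda>) (at 0 within {0..})"
    using \<nu> by (intro entropy_derivative measure_evolve_cyl_derivative[OF \<nu>p]) (simp_all add: evolve_0[OF \<nu>p])
  then have "(?h has_real_derivative entropy_rate \<nu> ?\<Lambda>) (at_right 0)"
    unfolding evolve_0[OF \<nu>p] by (rule has_field_derivative_subset) auto
  then have "((\<lambda>t. (?h t - ?h 0) / t) \<longlongrightarrow> entropy_rate \<nu> ?\<Lambda>) (at_right 0)"
    by (simp add: has_field_derivative_iff)
  then have "((\<lambda>t. ereal ((?h t - ?h 0) / t)) \<longlongrightarrow> ereal (entropy_rate \<nu> ?\<Lambda>)) (at_right 0)"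
    by (rule tendsto_ereal)
  moreover have "\<forall>\<^sub>F t in at_right 0. ereal ((?h t - ?h 0) / t)
      = (rel_entropy ?\<Lambda> (evolve P t \<nu>) \<mu> - rel_entropy ?\<Lambda> (evolve P 0 \<nu>) \<mu>) / ereal t"
    using eventually_at_right_less[of 0] by eventually_elim (simp add: rel_entropy_eq)
  ultimately have "((\<lambda>t. (rel_entropy ?\<Lambda> (evolve P t \<nu>) \<mu> - rel_entropy ?\<Lambda> (evolve P 0 \<nu>) \<mu>) / ereal t)
      \<longlongrightarrow> ereal (entropy_rate \<nu> ?\<Lambda>)) (at_right 0)"
    by (rule Lim_transform_eventually)
  then show ?thesis
    unfolding entropy_loss_def Let_def by (intro tendsto_Lim) simp
qed

lemma entropy_loss_density_zero:
  assumes \<nu>: "positive_measure \<nu>"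
    and lim: "(\<lambda>n. entropy_rate \<nu> (cube n) / real (card (cube n :: 'a site set))) \<longlonglongrightarrow> 0"
  shows "entropy_loss_density P \<nu> \<mu> = 0"
proof -
  have "filterlim (\<lambda>n. 2 ^ n - 1 :: nat) at_top sequentially"
  proof (rule filterlim_at_top_mono[OF filterlim_ident])
    have "n < 2 ^ n" for n :: nat by (rule less_exp)
    then show "\<forall>\<^sub>F n in sequentially. n \<le> 2 ^ n - 1" by (intro always_eventually allI) (metis Suc_leI Suc_le_mono Suc_pred' le_less_trans zero_le not_less_zero gr0I)
  qed
  then have "(\<lambda>n. entropy_loss P n \<nu> \<mu> / ereal (real (card (cube (2 ^ n - 1) :: 'a site set)))) \<longlonglongrightarrow> ereal 0"
  proof -
    \<comment> \<open>Ensures a nonzero volume, so that the quotient of extended reals is the real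
      one.\<close>
    have "(cube k :: 'a site set) \<noteq> {}" for k using zero_in_cube by blast
    then show ?thesis
      using tendsto_ereal[OF filterlim_compose[OF lim \<open>filterlim (\<lambda>n. 2 ^ n - 1 :: nat) at_top sequentially\<close>]]
      by (simp add: entropy_loss_eq[OF \<nu>])
  qed
  from lim_imp_Limsup[OF sequentially_bot this] show ?thesis
    by (simp add: entropy_loss_density_def)
qed

section \<open>Convergence to Gibbs measures\<close>

text \<open>The bound does not depend on t, so what is known near the limit at the times
  \<open>t n\<close> extends to time intervals of one common length after them.\<close>

lemma measure_evolve_near:
  assumes \<nu>: "\<nu> \<in> prob_measures" and \<Lambda>: "finite \<Lambda>" and "0 \<le> t" "0 \<le> u"
  shows "\<bar>measure (evolve P (t + u) \<nu>) (cyl \<Lambda> \<omega>) - measure (evolve P t \<nu>) (cyl \<Lambda> \<omega>)\<bar>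
    \<le> norm (P u (Bcontfun (indicator (cyl \<Lambda> \<omega>))) - Bcontfun (indicator (cyl \<Lambda> \<omega>)))"
proof -
  let ?f = "Bcontfun (indicator (cyl \<Lambda> \<omega>)) :: ('a, 'b) config \<Rightarrow>\<^sub>C real"
  let ?E = "\<lambda>f :: ('a, 'b) config \<Rightarrow>\<^sub>C real. \<integral>\<omega>. apply_bcontfun f \<omega> \<partial>(evolve P t \<nu>)"
  have tu: "0 \<le> t + u" using assms(3,4) by simp
  have st: "state ?E" by (rule state_integral[OF evolve_prob[OF feller assms(3) \<nu>]])
  have lin: "linear ?E" using st by (simp add: state_def)
  have "P (t + u) ?f = P t (P u ?f)" using feller assms(3,4) by (simp add: feller_semigroup_def)
  then have "measure (evolve P (t + u) \<nu>) (cyl \<Lambda> \<omega>) = ?E (P u ?f)"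
    unfolding measure_cyl_eq_integral[OF evolve_prob[OF feller tu \<nu>] \<Lambda>]
      integral_evolve[OF feller tu \<nu>] integral_evolve[OF feller assms(3) \<nu>] by simp
  moreover have "measure (evolve P t \<nu>) (cyl \<Lambda> \<omega>) = ?E ?f"
    by (rule measure_cyl_eq_integral[OF evolve_prob[OF feller assms(3) \<nu>] \<Lambda>])
  moreover have "?E (P u ?f) - ?E ?f = ?E (P u ?f - ?f)" by (rule linear_diff[OF lin, symmetric])
  ultimately show ?thesis using state_abs_le[OF st, of "P u ?f - ?f"] by simp
qed

lemma integral_mixture_continuous:
  fixes \<nu> \<nu>' :: "('a, 'b) config measure"
  assumes "\<nu> \<in> prob_measures" "\<nu>' \<in> prob_measures" "0 \<le> \<theta>" "\<theta> \<le> 1" "continuous_on UNIV F"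
  shows "(\<integral>\<omega>. F \<omega> \<partial>(mixture \<theta> \<nu> \<nu>')) = (1 - \<theta>) * (\<integral>\<omega>. F \<omega> \<partial>\<nu>) + \<theta> * (\<integral>\<omega>. F \<omega> \<partial>\<nu>')"
  using integral_mixture[OF assms(1-4), of "Bcontfun F"] by (simp only: apply_Bcontfun_continuous[OF assms(5)])

lemma local_prod_tendsto:
  assumes \<Lambda>: "finite \<Lambda>" and pos: "positive_measure \<nu>"
    and lim: "\<And>\<omega>. ((\<lambda>p. measure (\<rho> p) (cyl \<Lambda> \<omega>)) \<longlongrightarrow> measure \<nu> (cyl \<Lambda> \<omega>)) F"
  shows "((\<lambda>p. local_prod (\<rho> p) \<Lambda> \<Delta> \<xi>) \<longlongrightarrow> local_prod \<nu> \<Lambda> \<Delta> \<xi>) F"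
proof -
  have d: "((\<lambda>p. dens (\<rho> p) \<Lambda> \<omega>) \<longlongrightarrow> dens \<nu> \<Lambda> \<omega>) F" for \<omega>
    unfolding dens_def using \<mu>_pos[OF \<Lambda>, of \<omega>] by (intro tendsto_divide lim tendsto_const) simp
  have "((\<lambda>p. m \<Lambda> \<omega> * rel_ent_fun (dens (\<rho> p) \<Lambda> \<omega>) (dens (\<rho> p) \<Lambda> \<omega>'))
      \<longlongrightarrow> m \<Lambda> \<omega> * rel_ent_fun (dens \<nu> \<Lambda> \<omega>) (dens \<nu> \<Lambda> \<omega>')) F" for \<omega> \<omega>'
    unfolding rel_ent_fun_def using dens_pos[OF pos \<Lambda>, of \<omega>] dens_pos[OF pos \<Lambda>, of \<omega>']
    by (intro tendsto_intros d) auto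
  then show ?thesis
    unfolding local_prod_def by (intro tendsto_sum) (simp split: if_split)
qed

text \<open>If some production term does not vanish in large volumes at the limit, it is also
  positive for measures close to the limit, and the entropy falls at a fixed rate per volume during
  a fixed time after each late \<open>t k\<close>.\<close>

lemma attractor_entropy_rate:
  fixes t :: "nat \<Rightarrow> real"
  assumes \<nu>: "\<nu> \<in> prob_measures" and ev: "\<And>s. 0 \<le> s \<Longrightarrow> evolve P s \<nu> \<in> ti_measures"
    and t: "\<And>k. 0 \<le> t k" "filterlim t at_top sequentially"
    and lim: "limitin weak_topology (\<lambda>n. evolve P (t n) \<nu>) \<nu>' sequentially"
    and ti': "\<nu>' \<in> ti_measures" and nn: "site_nonnull d \<nu>'" "0 < d"
  shows "(\<lambda>n. entropy_rate \<nu>' (cube n) / real (card (cube n :: 'a site set))) \<longlonglongrightarrow> 0"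
proof (rule entropy_rate_density_zero[OF ti' nn], rule ccontr)
  have \<nu>'p: "\<nu>' \<in> prob_measures" using ti' by (simp add: ti_measures_def)
  have pos': "positive_measure \<nu>'"
    unfolding positive_measure_def using \<nu>'p site_nonnull_pos[OF nn _ \<nu>'p] by blast
  have evp: "evolve P s \<nu> \<in> prob_measures" if "0 \<le> s" for s by (rule evolve_prob[OF feller that \<nu>])
  fix \<Delta> \<xi> and e :: real
  assume \<Delta>: "active \<Delta>" "\<xi> \<in> \<Delta> \<rightarrow>\<^sub>E (UNIV :: 'b set)" and e: "0 < e"
    and not: "\<not> (\<exists>r. \<forall>\<Lambda>. finite \<Lambda> \<longrightarrow> cube r \<subseteq> \<Lambda> \<longrightarrow> local_prod \<nu>' \<Lambda> \<Delta> \<xi> \<le> e)"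
  \<comment> \<open>The limit exceeds 4s, nearby measures exceed 2s, and enlarging the volume costs
    s, which leaves a production of at least s.\<close>
  define s where "s = e / 4"
  have s: "0 < s" using e by (simp add: s_def)
  define \<epsilon> where "\<epsilon> = s / weight_bd"
  have \<epsilon>: "0 < \<epsilon>" and \<epsilon>w: "\<epsilon> * weight_bd \<le> s"
    using s weight_bd_pos by (simp_all add: \<epsilon>_def)
  obtain r0 where r0: "\<forall>\<Lambda> \<Lambda>' \<rho>. finite \<Lambda> \<longrightarrow> \<Lambda>' \<subseteq> \<Lambda> \<longrightarrow> \<Delta> \<subseteq> \<Lambda>' \<longrightarrow> cube r0 \<subseteq> \<Lambda>' \<longrightarrow> positive_measure \<rho> \<longrightarrow>
    local_prod \<rho> \<Lambda>' \<Delta> \<xi> - \<epsilon> * weight_bd \<le> local_prod \<rho> \<Lambda> \<Delta> \<xi>"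
    using local_prod_mono[OF \<Delta> \<epsilon>] by (elim exE)
  obtain k where k: "\<Delta> \<subseteq> cube k" using finite_subset_cube[OF active_fin(2)[OF \<Delta>(1)]] by blast
  obtain \<Lambda> where \<Lambda>: "finite \<Lambda>" "cube (max r0 k) \<subseteq> \<Lambda>" and big: "e < local_prod \<nu>' \<Lambda> \<Delta> \<xi>"
    using not by (meson not_le)
  have sub: "\<Delta> \<subseteq> \<Lambda>" "cube r0 \<subseteq> \<Lambda>"
    using k \<Lambda>(2) cube_mono[of k "max r0 k"] cube_mono[of r0 "max r0 k"] by auto
  have mono: "local_prod \<rho> \<Lambda> \<Delta> \<xi> - s \<le> local_prod \<rho> L \<Delta> \<xi>"
    if "finite L" "\<Lambda> \<subseteq> L" "positive_measure \<rho>" for L \<rho>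
    using r0[rule_format, OF that(1,2) sub that(3)] \<epsilon>w by linarith
  have neg: "\<forall>\<^sub>F n in sequentially. \<forall>\<rho>. positive_measure \<rho> \<longrightarrow> \<rho> \<in> ti_measures \<longrightarrow> 2 * s \<le> local_prod \<rho> \<Lambda> \<Delta> \<xi> \<longrightarrow>
    entropy_rate \<rho> (cube n) \<le> - (rate_inf * s / 8) * real (card (cube n :: 'a site set))"
    by (rule entropy_rate_negative[OF \<Delta> \<Lambda>(1) s]) (rule mono)
  define \<rho> where "\<rho> \<theta> u = mixture \<theta> (evolve P u \<nu>) \<mu>" for \<theta> u
  \<comment> \<open>Three parameters tend to their limits jointly: the index of the time, the delay
    after it, and the weight of \<mu> in the mixture.\<close>
  let ?F = "(sequentially \<times>\<^sub>F at_right (0 :: real)) \<times>\<^sub>F at_right (0 :: real)"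
  let ?\<rho> = "\<lambda>p. \<rho> (snd p) (t (fst (fst p)) + snd (fst p))"
  have F1: "filterlim (\<lambda>p. fst (fst p)) sequentially ?F"
    by (rule filterlim_compose[OF filterlim_fst filterlim_fst])
  have F2: "filterlim (\<lambda>p. snd (fst p)) (at_right 0) ?F"
    by (rule filterlim_compose[OF filterlim_snd filterlim_fst])
  have F3: "filterlim snd (at_right 0) ?F" by (rule filterlim_snd)
  have u_pos: "\<forall>\<^sub>F p in ?F. 0 < snd (fst p)"
    using filterlim_iff[THEN iffD1, OF F2, rule_format, OF eventually_at_right_less[of 0]] .
  have \<theta>_pos: "\<forall>\<^sub>F p in ?F. 0 < snd p"
    using filterlim_iff[THEN iffD1, OF F3, rule_format, OF eventually_at_right_less[of 0]] .
  have \<theta>_lim: "(snd \<longlongrightarrow> 0) ?F"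
    by (rule filterlim_compose[OF _ F3]) (simp add: tendsto_ident_at)
  have \<theta>_1: "\<forall>\<^sub>F p in ?F. snd p < 1"
    by (rule order_tendstoD(2)[OF \<theta>_lim]) simp
  have cyl_lim: "((\<lambda>p. measure (?\<rho> p) (cyl \<Lambda> \<omega>)) \<longlongrightarrow> measure \<nu>' (cyl \<Lambda> \<omega>)) ?F" for \<omega>
  proof -
    let ?a = "\<lambda>u. measure (evolve P u \<nu>) (cyl \<Lambda> \<omega>)"
    let ?f = "Bcontfun (indicator (cyl \<Lambda> \<omega>)) :: ('a, 'b) config \<Rightarrow>\<^sub>C real"
    have "(\<lambda>n. ?a (t n)) \<longlonglongrightarrow> measure \<nu>' (cyl \<Lambda> \<omega>)"
      unfolding measure_cyl_eq_integral[OF evp[OF t(1)] \<Lambda>(1)] measure_cyl_eq_integral[OF \<nu>'p \<Lambda>(1)]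
      by (rule weak_limit_integral[OF lim])
    from filterlim_compose[OF this F1]
    have 1: "((\<lambda>p. ?a (t (fst (fst p)))) \<longlongrightarrow> measure \<nu>' (cyl \<Lambda> \<omega>)) ?F" .
    have "((\<lambda>u. P u ?f) \<longlongrightarrow> ?f) (at_right 0)" using feller by (simp add: feller_semigroup_def)
    then have "((\<lambda>u. norm (P u ?f - ?f)) \<longlongrightarrow> 0) (at_right 0)"
      by (intro tendsto_norm_zero LIM_zero)
    from filterlim_compose[OF this F2]
    have 2: "((\<lambda>p. norm (P (snd (fst p)) ?f - ?f)) \<longlongrightarrow> 0) ?F" .
    have 3: "((\<lambda>p. ?a (t (fst (fst p)) + snd (fst p)) - ?a (t (fst (fst p)))) \<longlongrightarrow> 0) ?F"
    proof (rule Lim_null_comparison[OF _ 2])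
      show "\<forall>\<^sub>F p in ?F. norm (?a (t (fst (fst p)) + snd (fst p)) - ?a (t (fst (fst p))))
          \<le> norm (P (snd (fst p)) ?f - ?f)"
        using u_pos by eventually_elim (simp add: measure_evolve_near[OF \<nu> \<Lambda>(1) t(1)])
    qed
    have 4: "((\<lambda>p. ?a (t (fst (fst p)) + snd (fst p))) \<longlongrightarrow> measure \<nu>' (cyl \<Lambda> \<omega>)) ?F"
      using tendsto_add[OF 1 3] by simp
    have "((\<lambda>p. (1 - snd p) * ?a (t (fst (fst p)) + snd (fst p)) + snd p * m \<Lambda> \<omega>)
        \<longlongrightarrow> (1 - 0) * measure \<nu>' (cyl \<Lambda> \<omega>) + 0 * m \<Lambda> \<omega>) ?F"
      by (intro tendsto_intros 4 \<theta>_lim)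
    then have "((\<lambda>p. (1 - snd p) * ?a (t (fst (fst p)) + snd (fst p)) + snd p * m \<Lambda> \<omega>)
        \<longlongrightarrow> measure \<nu>' (cyl \<Lambda> \<omega>)) ?F" by simp
    moreover have "\<forall>\<^sub>F p in ?F. (1 - snd p) * ?a (t (fst (fst p)) + snd (fst p)) + snd p * m \<Lambda> \<omega>
        = measure (?\<rho> p) (cyl \<Lambda> \<omega>)"
      using u_pos \<theta>_pos \<theta>_1
    proof eventually_elim
      case (elim p)
      have "0 \<le> t (fst (fst p)) + snd (fst p)" using elim(1) t(1)[of "fst (fst p)"] by simp
      then show ?case
        unfolding \<rho>_def using elim by (intro measure_mixture_cyl[symmetric] evp \<mu>_prob \<Lambda>(1)) auto
    qed
    ultimately show ?thesis by (rule Lim_transform_eventually)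
  qed
  have "2 * s < local_prod \<nu>' \<Lambda> \<Delta> \<xi>" using big e by (simp add: s_def)
  then have "\<forall>\<^sub>F p in ?F. 2 * s < local_prod (?\<rho> p) \<Lambda> \<Delta> \<xi>"
    by (rule order_tendstoD(1)[OF local_prod_tendsto[OF \<Lambda>(1) pos' cyl_lim]])
  \<comment> \<open>Unfolding the product filter separates the parameters: one weight, one index K
    and one delay bound \<tau> then work together.\<close>
  then obtain Q P\<theta> where Q: "eventually Q (sequentially \<times>\<^sub>F at_right (0 :: real))"
    and P\<theta>: "eventually P\<theta> (at_right (0 :: real))"
    and QP: "\<And>q \<theta>. Q q \<Longrightarrow> P\<theta> \<theta> \<Longrightarrow> 2 * s < local_prod (?\<rho> (q, \<theta>)) \<Lambda> \<Delta> \<xi>"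
    unfolding eventually_prod_filter[of _ "sequentially \<times>\<^sub>F at_right (0 :: real)"] by blast
  obtain Pn Pu where Pn: "eventually Pn sequentially" and Pu: "eventually Pu (at_right (0 :: real))"
    and PnPu: "\<And>n u. Pn n \<Longrightarrow> Pu u \<Longrightarrow> Q (n, u)"
    using Q unfolding eventually_prod_filter by blast
  have "\<forall>\<^sub>F \<theta> in at_right (0 :: real). \<theta> < 1" by (rule order_tendstoD(2)[OF tendsto_ident_at]) simp
  then have "\<forall>\<^sub>F \<theta> in at_right (0 :: real). P\<theta> \<theta> \<and> 0 < \<theta> \<and> \<theta> < 1"
    using P\<theta> eventually_at_right_less[of "0 :: real"] by eventually_elim simp
  \<comment> \<open>From here on the weight is a fixed positive number, so all cylinder
    probabilities of the mixture are positive at all times.\<close>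
  then obtain \<theta> where \<theta>: "P\<theta> \<theta>" "0 < \<theta>" "\<theta> < 1"
    using eventually_happens'[of "at_right (0 :: real)"] by auto
  obtain \<tau> where \<tau>: "0 < \<tau>" "\<And>u. 0 < u \<Longrightarrow> u < \<tau> \<Longrightarrow> Pu u"
    using Pu unfolding eventually_at_right_field by blast
  obtain K where K: "\<And>n. K \<le> n \<Longrightarrow> Pn n" using Pn unfolding eventually_sequentially by blast
  have \<theta>01: "0 \<le> \<theta>" "\<theta> \<le> 1" using \<theta> by auto
  have \<rho>_cyl: "measure (\<rho> \<theta> u) (cyl L \<omega>) = (1 - \<theta>) * measure (evolve P u \<nu>) (cyl L \<omega>) + \<theta> * m L \<omega>"
    if "0 \<le> u" "finite L" for u L \<omega>
    unfolding \<rho>_def by (rule measure_mixture_cyl[OF evp[OF that(1)] \<mu>_prob \<theta>01 that(2)])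
  have \<rho>_pos: "positive_measure (\<rho> \<theta> u)" if u: "0 \<le> u" for u
    unfolding positive_measure_def
  proof (intro conjI allI impI)
    show "\<rho> \<theta> u \<in> prob_measures" unfolding \<rho>_def by (rule mixture_prob[OF evp[OF u] \<mu>_prob \<theta>01])
    fix L :: "'a site set" and \<omega> assume L: "finite L"
    show "0 < measure (\<rho> \<theta> u) (cyl L \<omega>)"
      unfolding \<rho>_cyl[OF u L] using \<theta> \<mu>_pos[OF L, of \<omega>] by (intro add_nonneg_pos) auto
  qed
  have \<rho>_ti: "\<rho> \<theta> u \<in> ti_measures" if "0 \<le> u" for u
    unfolding \<rho>_def by (rule mixture_ti[OF ev[OF that] ti_\<mu> \<theta>01])
  \<comment> \<open>Because \<mu> annihilates the generator, the mixture follows the same evolution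
    equation as the trajectory.\<close>
  have cyl_deriv: "((\<lambda>u. measure (\<rho> \<theta> u) (cyl L \<omega>)) has_real_derivative
      (\<integral>\<eta>. ips_generator c (indicator (cyl L \<omega>)) \<eta> \<partial>(\<rho> \<theta> u))) (at u within {0..})"
    if u: "0 \<le> u" and L: "finite L" for u L \<omega>
  proof -
    let ?g = "ips_generator c (indicator (cyl L \<omega>))"
    have loc: "local_function (indicator (cyl L \<omega>) :: _ \<Rightarrow> real)" by (rule local_indicator_cyl[OF L])
    have "((\<lambda>u. (1 - \<theta>) * measure (evolve P u \<nu>) (cyl L \<omega>) + \<theta> * m L \<omega>) has_real_derivative
        (1 - \<theta>) * (\<integral>\<eta>. ?g \<eta> \<partial>(evolve P u \<nu>)) + 0) (at u within {0..})"
      by (intro DERIV_add DERIV_cmult measure_evolve_cyl_derivative[OF \<nu> L u] DERIV_const)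
    moreover have "(1 - \<theta>) * (\<integral>\<eta>. ?g \<eta> \<partial>(evolve P u \<nu>)) + 0 = (\<integral>\<eta>. ?g \<eta> \<partial>(\<rho> \<theta> u))"
      unfolding \<rho>_def integral_mixture_continuous[OF evp[OF u] \<mu>_prob \<theta>01 continuous_generator_local[OF loc]]
      by (simp add: stationary_local[OF loc])
    ultimately have "((\<lambda>u. (1 - \<theta>) * measure (evolve P u \<nu>) (cyl L \<omega>) + \<theta> * m L \<omega>) has_real_derivative
        (\<integral>\<eta>. ?g \<eta> \<partial>(\<rho> \<theta> u))) (at u within {0..})" by simp
    then show ?thesis
      by (rule has_field_derivative_transform_within[OF _ zero_less_one]) (use u in \<open>simp_all add: \<rho>_cyl[OF _ L]\<close>)
  qed
  show False
  proof (rule decay_contradiction[where V = "\<lambda>n. real (card (cube n :: 'a site set))" and C = "- ln \<delta>"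
      and H = "\<lambda>n u. entropy (\<rho> \<theta> u) (cube n)" and G = "\<lambda>n u. entropy_rate (\<rho> \<theta> u) (cube n)"
      and \<sigma> = "rate_inf * s / 8" and \<tau> = \<tau> and K = K and t = t])
    fix n and u :: real assume u: "0 \<le> u"
    show "0 \<le> entropy (\<rho> \<theta> u) (cube n)" by (rule entropy_nonneg[OF \<rho>_pos[OF u] finite_cube])
    show "entropy (\<rho> \<theta> u) (cube n) \<le> - ln \<delta> * real (card (cube n :: 'a site set))"
      by (rule entropy_le[OF \<rho>_pos[OF u] finite_cube])
    show "((\<lambda>u. entropy (\<rho> \<theta> u) (cube n)) has_real_derivative entropy_rate (\<rho> \<theta> u) (cube n)) (at u within {0..})"
      by (rule entropy_derivative[OF \<rho>_pos[OF u] finite_cube cyl_deriv[OF u finite_cube]])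
  next
    fix a :: real assume "0 < a"
    from entropy_rate_le_small[OF this]
    show "\<forall>\<^sub>F n in sequentially. \<forall>u\<ge>0. entropy_rate (\<rho> \<theta> u) (cube n) \<le> a * real (card (cube n :: 'a site set))"
      by (rule eventually_mono) (simp add: \<rho>_pos)
  next
    show "\<forall>\<^sub>F n in sequentially. \<forall>k\<ge>K. \<forall>u. 0 < u \<longrightarrow> u < \<tau> \<longrightarrow>
        entropy_rate (\<rho> \<theta> (t k + u)) (cube n) \<le> - (rate_inf * s / 8) * real (card (cube n :: 'a site set))"
      using neg
    proof (rule eventually_mono, intro allI impI)
      fix n k and u :: real
      assume *: "\<forall>\<rho>. positive_measure \<rho> \<longrightarrow> \<rho> \<in> ti_measures \<longrightarrow> 2 * s \<le> local_prod \<rho> \<Lambda> \<Delta> \<xi> \<longrightarrow>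
          entropy_rate \<rho> (cube n) \<le> - (rate_inf * s / 8) * real (card (cube n :: 'a site set))"
        and k: "K \<le> k" and u: "0 < u" "u < \<tau>"
      have tu: "0 \<le> t k + u" using t(1)[of k] u by simp
      have "2 * s < local_prod (\<rho> \<theta> (t k + u)) \<Lambda> \<Delta> \<xi>"
        using QP[OF PnPu[OF K[OF k] \<tau>(2)[OF u]] \<theta>(1)] by simp
      then show "entropy_rate (\<rho> \<theta> (t k + u)) (cube n) \<le> - (rate_inf * s / 8) * real (card (cube n :: 'a site set))"
        using *[rule_format, OF \<rho>_pos[OF tu] \<rho>_ti[OF tu]] by simp
    qed
  qed (use t \<tau>(1) s rate_inf(1) card_cube_pos in auto)
qed

end

theorem theorem2p8:
  fixes c :: "('d::finite, 'q::{finite,discrete_topology}) rates"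
    and P :: "('d, 'q) semigroup"
    and \<gamma> :: "('d, 'q) kernels"
    and \<mu> \<nu> \<nu>_star :: "('d, 'q) config measure"
    and D :: "('d, 'q) config measure set"
    and t :: "nat \<Rightarrow> real"
  assumes "well_defined_ips c" and "ips_semigroup c P"
    and "ti_rates c" and "finitely_many_types c" and "uniformly_continuous_rates c"
    and "positive_min_rate c" and "no_trap_entry c"
    and "is_specification \<gamma>" and "ti_specification \<gamma>"
    and "nonnull_specification \<gamma>" and "quasilocal \<gamma>"
    and "\<mu> \<in> gibbs_measures \<gamma>" and "\<mu> \<in> ti_measures" and "asymptotically_decoupled \<mu>"
    and "\<forall>s\<ge>0. evolve P s \<mu> = \<mu>"
    and "D \<subseteq> ti_measures" and "closedin (subtopology weak_topology ti_measures) D"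
    and "\<mu> \<in> D"
    and "\<forall>\<rho>\<in>D. \<forall>s\<ge>0. evolve P s \<rho> \<in> D"
    and "\<forall>\<rho>\<in>D. entropy_loss_density P \<rho> \<mu> = 0 \<longrightarrow> \<rho> \<in> gibbs_measures \<gamma>"
    and "\<nu> \<in> D"
    and "\<forall>n. 0 \<le> t n" and "incseq t" and "filterlim t at_top sequentially"
    and "\<forall>n. nonnull_measure (evolve P (t n) \<nu>)"
    and "limitin weak_topology (\<lambda>n. evolve P (t n) \<nu>) \<nu>_star sequentially"
    and "nonnull_measure \<nu>_star"
  shows "\<nu>_star \<in> gibbs_measures \<gamma>"
proof -
  interpret ips_gibbs c P \<gamma> \<mu>
    using assms by unfold_locales
  have evD: "evolve P s \<nu> \<in> D" if "0 \<le> s" for s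
    using assms(19,21) that by blast
  then have ev: "evolve P s \<nu> \<in> ti_measures" if "0 \<le> s" for s
    using assms(16) that by blast
  have \<nu>: "\<nu> \<in> prob_measures" using assms(16,21) by (auto simp: ti_measures_def)
  have t: "0 \<le> t n" for n using assms(22) by blast
  note lim = assms(26)
  \<comment> \<open>Closedness of D is relative to the translation-invariant measures, so the limit
    has to be placed among them first.\<close>
  have star: "\<nu>_star \<in> ti_measures" by (rule weak_limit_ti[OF lim ev[OF t]])
  have "limitin (subtopology weak_topology ti_measures) (\<lambda>n. evolve P (t n) \<nu>) \<nu>_star sequentially"
    unfolding limitin_subtopology using lim star ev[OF t] by simp
  from limitin_closedin[OF this assms(17) _ sequentially_bot]
  have "\<nu>_star \<in> D" using evD[OF t] by simp
  obtain d where d: "0 < d" "site_nonnull d \<nu>_star"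
    using nonnull_measure_site_nonnull[OF assms(27) star] by blast
  have p: "\<nu>_star \<in> prob_measures" using star by (simp add: ti_measures_def)
  have "positive_measure \<nu>_star"
    unfolding positive_measure_def using p site_nonnull_pos[OF d(2,1) _ p] by blast
  from entropy_loss_density_zero[OF this attractor_entropy_rate[OF \<nu> ev t assms(24) lim star d(2,1)]]
  show ?thesis using assms(20) \<open>\<nu>_star \<in> D\<close> by blast
qed

end
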